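(* Let $1\le p<q$ and let $\mathcal G\subset\mathcal C_{q,p}(\Omega)$ be a convex cone for which there exist $c_q\in\mathbb R_+$ and $\xi_q\in\mathcal G$ with $|X_T|^q\le c_q+\xi_q$ on $\Omega$. Then there exists an increasing sequence $\{K_n\}_{n\in\mathbb N}$ of compact subsets of $\Omega$ such that $$\lim_{n\to\infty}\Phi(\mathbf 1_{\Omega\setminus K_n};\mathcal I(\mathcal G))\le 0.$$
   Context: **Space.** Let $T>0$, $d\ge 1$, and let $D=\mathcal D([0,T];\mathbb R^d_+)$ be the set of càdlàg functions $[0,T]\to\mathbb R^d_+$. For $\nu^n,\nu^*\in D$ write $\nu^n\rightharpoonup_S\nu^*$ if for each $\varepsilon>0$ there are functions of finite variation $\nu^{n,\varepsilon},\nu^{*,\varepsilon}\in D$ with $\|\nu^*-\nu^{*,\varepsilon}\|_\infty\le\varepsilon$, $\|\nu^n-\nu^{n,\varepsilon}\|_\infty\le\varepsilon$ for all $n$, and $\int_{[0,T]}f(t)\,d\nu^{n,\varepsilon}_t\to\int_{[0,T]}f(t)\,d\nu^{*,\varepsilon}_t$ for all $f\in C_b([0,T];\mathbb R^d)$ (Stieltjes integrals with $\nu^{n,\varepsilon}_{0-}=\nu^{*,\varepsilon}_{0-}=0$). A subset $C\subset D$ is $S$-closed iff it is sequentially closed for $\rightharpoonup_S$; this defines the $S$-topology on $D$. Fix a non-empty $S$-closed set $\Omega\subset D$ and denote the relative topology on $\Omega$ again by $S$. The topology $S^*$ on $\Omega$ is the coarsest topology making all $S$-continuous functions $\Omega\to\mathbb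 R$ continuous. All topological notions on $\Omega$ (continuity, compactness, Borel sets) refer to $S^*$. **Process.** $X_t(\omega)=\omega(t)$; $|\cdot|$ is the Euclidean norm; $\|\omega\|_\infty=\sup_{t\in[0,T]}|\omega(t)|$. $\mathcal F^X_t=\sigma(X_s:s\le t)$, $\mathcal F_t=\bigcap_{s>t}\mathcal F^X_s$ for $t<T$, $\mathcal F_T=\mathcal F^X_T$ (which equals the Borel $\sigma$-algebra of $\Omega$), $\mathbb F=(\mathcal F_t)_{t\in[0,T]}$. **Function spaces.** $\mathcal B(\Omega)$: Borel functions $\Omega\to[-\infty,\infty]$. For $r>0$, $\mathcal B_r(\Omega)$: those $\xi\in\mathcal B(\Omega)$ for which $\xi(\omega)/(1+\|\omega\|_\infty^r)$ is bounded. $\mathcal C(\Omega)$: real-valued continuous functions; $\mathcal C_r(\Omega)=\mathcal C(\Omega)\cap\mathcal B_r(\Omega)$; $\mathcal C_{q,p}(\Omega)=\{\xi\in\mathcal C(\Omega):\xi^+\in\mathcal C_q(\Omega),\ \xi^-\in\mathcal C_p(\Omega)\}$ with $\xi^\pm=\max(\pm\xi,0)$. A superscript $+$ on a function space denotes its non-negative elements. Convex cones are understood to contain $0$. **Integrals.** A simple integrand $H=(\tau_n,h_n)_{n\ge 0}$ consists of $\mathbb F$-stopping times $\tau_0\le\tau_1\le\cdots$ such that for each $\omega$ some $\tau_{n(\omega)}(\omega)\ge T$, and $\mathcal F_{\tau_n}$-measurable $h_n\in\mathcal B_{q-1}(\Omega)^d$; its integral is $(H\cdot X)_t=\sum_{n\ge0}h_n\cdot(X_{\tau_{n+1}\wedge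 t}-X_{\tau_n\wedge t})$. It is admissible if for some $\lambda\in\mathcal B_q^+(\Omega)$, $(H\cdot X)_{\tau_m\wedge t}(\omega)\ge-\lambda(\omega)$ for all $t\in[0,T]$, $\omega\in\Omega$, $m\in\mathbb N$; $\mathcal H_s$ is the set of admissible simple integrands. $\mathcal H$ is the set of sequences $H=(H^k)_{k\in\mathbb N}\subset\mathcal H_s$ for which there is $\Lambda\in\mathcal B_q^+(\Omega)$ with $(H^k\cdot X)_t\ge-\Lambda$ for all $t\in[0,T]$, $k\in\mathbb N$; for such $H$, $(H\cdot X)_t(\omega)=\liminf_{k\to\infty}(H^k\cdot X)_t(\omega)$. Set $\mathcal I(\mathcal G)=\{\gamma+(H\cdot X)_T:\gamma\in\mathcal G,\ H\in\mathcal H\}$. **Functional.** $\Phi(\xi;\mathcal I)=\inf\{c\in\mathbb R: c+\ell\ge\xi \text{ on }\Omega\text{ for some }\ell\in\mathcal I\}$, with $\inf\emptyset=+\infty$. (Values in $[-\infty,\infty]$; the limit is taken in $[-\infty,\infty]$.) *)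

theory Defs
  imports "HOL-Probability.Stopping_Time"
begin

section \<open>Path space\<close>

text \<open>A path on the interval from \<open>0\<close> to \<open>T\<close> is an extensional function on the reals, so that
  equality of paths is equality on that interval.\<close>

type_synonym 'd path = "real \<Rightarrow> real^'d"

definition skorokhod_space :: "real \<Rightarrow> 'd::finite path set" where
  "skorokhod_space T = {\<omega> \<in> extensional {0..T}.
     (\<forall>t\<in>{0..T}. \<forall>i. 0 \<le> \<omega> t $ i) \<and>
     (\<forall>t\<in>{0..<T}. (\<omega> \<longlongrightarrow> \<omega> t) (at_right t)) \<and>
     (\<forall>t\<in>{0<..T}. \<exists>l. (\<omega> \<longlongrightarrow> l) (at_left t))}"

definition sup_norm :: "real \<Rightarrow> 'd::finite path \<Rightarrow> real" where
  "sup_norm T \<omega> = (SUP t\<in>{0..T}. norm (\<omega> t))"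

section \<open>Finite variation and Stieltjes integrals\<close>

definition variation_sums :: "real \<Rightarrow> real \<Rightarrow> (real \<Rightarrow> 'a::real_normed_vector) \<Rightarrow> real set" where
  "variation_sums a b g = {(\<Sum>k<n. norm (g (s (Suc k)) - g (s k))) | n s.
     (\<forall>k\<le>n. s k \<in> {a..b}) \<and> (\<forall>k<n. s k \<le> s (Suc k))}"

definition finite_variation_on :: "real \<Rightarrow> real \<Rightarrow> (real \<Rightarrow> 'a::real_normed_vector) \<Rightarrow> bool" where
  "finite_variation_on a b g \<longleftrightarrow> bdd_above (variation_sums a b g)"

definition total_variation :: "real \<Rightarrow> real \<Rightarrow> (real \<Rightarrow> 'a::real_normed_vector) \<Rightarrow> real" where
  "total_variation a b g = Sup (variation_sums a b g)"

text \<open>The positive part of the Jordan decomposition of \<open>g\<close>, where \<open>g\<close> is continued by \<open>0\<close> to the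
  left of \<open>0\<close> (this is the convention \<open>g(0-) = 0\<close>, which gives \<open>0\<close> the mass \<open>g 0\<close>) and by
  \<open>g T\<close> to the right of \<open>T\<close>. The negative part is the positive part of \<open>- g\<close>.\<close>

definition jordan_pos :: "real \<Rightarrow> (real \<Rightarrow> real) \<Rightarrow> real \<Rightarrow> real" where
  "jordan_pos T g t =
     (if t < 0 then 0 else (\<bar>g 0\<bar> + total_variation 0 (min t T) g + g (min t T)) / 2)"

text \<open>The Lebesgue--Stieltjes integral of \<open>f\<close> against \<open>g\<close> over the closed interval from \<open>0\<close>
  to \<open>T\<close>, for right-continuous \<open>g\<close> of finite variation.\<close>

definition stieltjes_integral :: "real \<Rightarrow> (real \<Rightarrow> real) \<Rightarrow> (real \<Rightarrow> real) \<Rightarrow> real" where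
  "stieltjes_integral T f g =
     (LINT t:{0..T}|interval_measure (jordan_pos T g). f t) -
     (LINT t:{0..T}|interval_measure (jordan_pos T (\<lambda>s. - g s)). f t)"

definition vec_stieltjes_integral :: "real \<Rightarrow> 'd::finite path \<Rightarrow> 'd path \<Rightarrow> real" where
  "vec_stieltjes_integral T f \<nu> = (\<Sum>i\<in>UNIV. stieltjes_integral T (\<lambda>t. f t $ i) (\<lambda>t. \<nu> t $ i))"

section \<open>The topologies \<open>S\<close> and \<open>S*\<close>\<close>

definition S_converges :: "real \<Rightarrow> (nat \<Rightarrow> 'd::finite path) \<Rightarrow> 'd path \<Rightarrow> bool" where
  "S_converges T \<nu> \<mu> \<longleftrightarrow> (\<forall>n. \<nu> n \<in> skorokhod_space T) \<and> \<mu> \<in> skorokhod_space T \<and>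
     (\<forall>\<epsilon>>0. \<exists>\<nu>' \<mu>'.
        (\<forall>n. \<nu>' n \<in> skorokhod_space T \<and> finite_variation_on 0 T (\<nu>' n)) \<and>
        \<mu>' \<in> skorokhod_space T \<and> finite_variation_on 0 T \<mu>' \<and>
        sup_norm T (\<lambda>t. \<mu> t - \<mu>' t) \<le> \<epsilon> \<and>
        (\<forall>n. sup_norm T (\<lambda>t. \<nu> n t - \<nu>' n t) \<le> \<epsilon>) \<and>
        (\<forall>f. continuous_on {0..T} f \<and> bounded (f ` {0..T}) \<longrightarrow>
           (\<lambda>n. vec_stieltjes_integral T f (\<nu>' n)) \<longlonglongrightarrow> vec_stieltjes_integral T f \<mu>'))"

definition S_closed :: "real \<Rightarrow> 'd::finite path set \<Rightarrow> bool" where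
  "S_closed T C \<longleftrightarrow> C \<subseteq> skorokhod_space T \<and>
     (\<forall>\<nu> \<mu>. (\<forall>n. \<nu> n \<in> C) \<and> S_converges T \<nu> \<mu> \<longrightarrow> \<mu> \<in> C)"

definition S_topology :: "real \<Rightarrow> 'd::finite path topology" where
  "S_topology T =
     topology (\<lambda>U. U \<subseteq> skorokhod_space T \<and> S_closed T (skorokhod_space T - U))"

definition S_star_topology :: "real \<Rightarrow> 'd::finite path set \<Rightarrow> 'd path topology" where
  "S_star_topology T \<Omega> = topology_generated_by
     {{\<omega> \<in> \<Omega>. f \<omega> \<in> U} | f U.
        continuous_map (subtopology (S_topology T) \<Omega>) euclideanreal f \<and> open U}"

lemma S_converges_subseq:
  assumes "S_converges T \<nu> \<mu>" "strict_mono r"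
  shows "S_converges T (\<nu> \<circ> r) \<mu>"
  unfolding S_converges_def
proof (intro conjI allI impI)
  show "(\<nu> \<circ> r) n \<in> skorokhod_space T" for n
    using assms(1) by (simp add: S_converges_def)
  show "\<mu> \<in> skorokhod_space T"
    using assms(1) by (simp add: S_converges_def)
  fix \<epsilon> :: real assume "\<epsilon> > 0"
  then obtain \<nu>' \<mu>' where *: "\<forall>n. \<nu>' n \<in> skorokhod_space T \<and> finite_variation_on 0 T (\<nu>' n)"
    "\<mu>' \<in> skorokhod_space T" "finite_variation_on 0 T \<mu>'"
    "sup_norm T (\<lambda>t. \<mu> t - \<mu>' t) \<le> \<epsilon>" "\<forall>n. sup_norm T (\<lambda>t. \<nu> n t - \<nu>' n t) \<le> \<epsilon>"
    "\<forall>f. continuous_on {0..T} f \<and> bounded (f ` {0..T}) \<longrightarrow>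
       (\<lambda>n. vec_stieltjes_integral T f (\<nu>' n)) \<longlonglongrightarrow> vec_stieltjes_integral T f \<mu>'"
    using assms(1) unfolding S_converges_def by meson
  have "(\<lambda>n. vec_stieltjes_integral T f ((\<nu>' \<circ> r) n)) \<longlonglongrightarrow> vec_stieltjes_integral T f \<mu>'"
    if "continuous_on {0..T} f \<and> bounded (f ` {0..T})" for f
    using LIMSEQ_subseq_LIMSEQ[OF *(6)[rule_format, OF that] assms(2)] by (simp add: o_def)
  with * show "\<exists>\<nu>' \<mu>'.
      (\<forall>n. \<nu>' n \<in> skorokhod_space T \<and> finite_variation_on 0 T (\<nu>' n)) \<and>
      \<mu>' \<in> skorokhod_space T \<and> finite_variation_on 0 T \<mu>' \<and>
      sup_norm T (\<lambda>t. \<mu> t - \<mu>' t) \<le> \<epsilon> \<and>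
      (\<forall>n. sup_norm T (\<lambda>t. (\<nu> \<circ> r) n t - \<nu>' n t) \<le> \<epsilon>) \<and>
      (\<forall>f. continuous_on {0..T} f \<and> bounded (f ` {0..T}) \<longrightarrow>
         (\<lambda>n. vec_stieltjes_integral T f (\<nu>' n)) \<longlonglongrightarrow> vec_stieltjes_integral T f \<mu>')"
    by (intro exI[of _ "\<nu>' \<circ> r"] exI[of _ \<mu>']) simp
qed

lemma S_closed_Un:
  assumes A: "S_closed T A" and B: "S_closed T B"
  shows "S_closed T (A \<union> B)"
  unfolding S_closed_def
proof (intro conjI allI impI)
  show "A \<union> B \<subseteq> skorokhod_space T"
    using A B by (simp add: S_closed_def)
  fix \<nu> \<mu> assume *: "(\<forall>n. \<nu> n \<in> A \<union> B) \<and> S_converges T \<nu> \<mu>"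
  have key: "\<mu> \<in> C" if C: "S_closed T C" and inf: "infinite {n. \<nu> n \<in> C}" for C
  proof -
    have "\<forall>n. (\<nu> \<circ> enumerate {n. \<nu> n \<in> C}) n \<in> C"
      using enumerate_in_set[OF inf] by simp
    moreover have "S_converges T (\<nu> \<circ> enumerate {n. \<nu> n \<in> C}) \<mu>"
      using * strict_mono_enumerate[OF inf] by (intro S_converges_subseq) auto
    ultimately show ?thesis
      using C unfolding S_closed_def by blast
  qed
  have "{n. \<nu> n \<in> A} \<union> {n. \<nu> n \<in> B} = UNIV"
    using * by auto
  then have "infinite {n. \<nu> n \<in> A} \<or> infinite {n. \<nu> n \<in> B}"
    by (metis finite_Un infinite_UNIV_nat)
  then show "\<mu> \<in> A \<union> B"
    using key A B by blast
qed

lemma openin_S_topology: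
  fixes U :: "'d::finite path set"
  shows "openin (S_topology T) U \<longleftrightarrow> U \<subseteq> skorokhod_space T \<and> S_closed T (skorokhod_space T - U)"
proof -
  let ?D = "skorokhod_space T :: 'd::finite path set"
  have "istopology (\<lambda>U. U \<subseteq> ?D \<and> S_closed T (?D - U))"
    unfolding istopology_def
  proof (intro conjI allI impI)
    fix U V assume "U \<subseteq> ?D \<and> S_closed T (?D - U)" "V \<subseteq> ?D \<and> S_closed T (?D - V)"
    then have "S_closed T ((?D - U) \<union> (?D - V))"
      by (intro S_closed_Un) auto
    then show "S_closed T (?D - U \<inter> V)"
      by (simp add: Diff_Int)
  next
    fix \<K> assume "\<forall>K\<in>\<K>. K \<subseteq> ?D \<and> S_closed T (?D - K)"
    then have K: "S_closed T (?D - K)" if "K \<in> \<K>" for K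
      using that by blast
    show "S_closed T (?D - \<Union>\<K>)"
      unfolding S_closed_def
    proof (intro conjI allI impI)
      fix \<nu> and \<mu> :: "'d path" assume *: "(\<forall>n. \<nu> n \<in> ?D - \<Union>\<K>) \<and> S_converges T \<nu> \<mu>"
      have "\<mu> \<in> ?D - K" if "K \<in> \<K>" for K
      proof -
        have "\<forall>n. \<nu> n \<in> ?D - K"
          using * that by blast
        then show ?thesis
          using K[OF that] * by (simp only: S_closed_def) blast
      qed
      moreover have "\<mu> \<in> ?D"
        using * by (simp add: S_converges_def)
      ultimately show "\<mu> \<in> ?D - \<Union>\<K>"
        by blast
    qed blast
  qed blast+
  then show ?thesis
    by (simp add: S_topology_def topology_inverse')
qed

lemma topspace_S_topology [simp]: "topspace (S_topology T) = skorokhod_space T"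
proof
  show "topspace (S_topology T) \<subseteq> skorokhod_space T"
    unfolding topspace_def openin_S_topology by blast
  have "openin (S_topology T) (skorokhod_space T)"
    by (simp add: openin_S_topology S_closed_def)
  then show "skorokhod_space T \<subseteq> topspace (S_topology T)"
    by (rule openin_subset)
qed

lemma closedin_S_topology: "closedin (S_topology T) C \<longleftrightarrow> S_closed T C"
proof -
  have "C \<subseteq> skorokhod_space T" if "S_closed T C"
    using that by (simp add: S_closed_def)
  then show ?thesis
    unfolding closedin_def openin_S_topology topspace_S_topology
    by (metis Diff_subset double_diff subset_refl)
qed

lemma topspace_S_star_topology [simp]: "topspace (S_star_topology T \<Omega>) = \<Omega>"
proof -
  have "\<Omega> \<in> {{\<omega> \<in> \<Omega>. f \<omega> \<in> U} | f U.
      continuous_map (subtopology (S_topology T) \<Omega>) euclideanreal f \<and> open U}"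
    by (rule CollectI, rule exI[of _ "\<lambda>_. 0"], rule exI[of _ UNIV]) simp
  then show ?thesis
    unfolding S_star_topology_def topology_generated_by_topspace by blast
qed

section \<open>The filtration\<close>

definition path_borel :: "real \<Rightarrow> 'd::finite path set \<Rightarrow> 'd path measure" where
  "path_borel T \<Omega> = sigma \<Omega> {U. openin (S_star_topology T \<Omega>) U}"

definition raw_filtration :: "'d::finite path set \<Rightarrow> real \<Rightarrow> 'd path measure" where
  "raw_filtration \<Omega> t = sigma \<Omega> {(\<lambda>\<omega>. \<omega> s) -` A \<inter> \<Omega> | s A. s \<in> {0..t} \<and> A \<in> sets borel}"

definition right_filtration :: "real \<Rightarrow> 'd::finite path set \<Rightarrow> real \<Rightarrow> 'd path measure" where
  "right_filtration T \<Omega> t =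
     (if t < T then sigma \<Omega> (\<Inter>s\<in>{t<..T}. sets (raw_filtration \<Omega> s)) else raw_filtration \<Omega> T)"

text \<open>The filtration is continued as a constant after \<open>T\<close>, so that stopping times may take any value
  in the extended half-line and the library notions apply. The minimum is taken before leaving
  \<^typ>\<open>ennreal\<close> because \<^const>\<open>enn2real\<close> sends \<open>\<infinity>\<close> to \<open>0\<close>.\<close>

definition path_filtration :: "real \<Rightarrow> 'd::finite path set \<Rightarrow> ennreal \<Rightarrow> 'd path measure" where
  "path_filtration T \<Omega> t = right_filtration T \<Omega> (enn2real (min t (ennreal T)))"

lemma space_raw_filtration [simp]: "space (raw_filtration \<Omega> t) = \<Omega>"
  unfolding raw_filtration_def by (rule space_measure_of) auto

lemma sets_raw_filtration_mono:
  assumes "s \<le> t"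
  shows "sets (raw_filtration \<Omega> s) \<subseteq> sets (raw_filtration \<Omega> t)"
proof -
  let ?G = "\<lambda>t. {(\<lambda>\<omega>. \<omega> s) -` A \<inter> \<Omega> | s A. s \<in> {0..t} \<and> A \<in> sets borel}"
  have "?G s \<subseteq> ?G t"
    using assms by fastforce
  moreover have "?G r \<subseteq> Pow \<Omega>" for r
    by auto
  ultimately show ?thesis
    unfolding raw_filtration_def by (simp add: sets_measure_of sigma_sets_mono')
qed

lemma sets_right_filtration:
  assumes "t < T"
  shows "sets (right_filtration T \<Omega> t) = (\<Inter>s\<in>{t<..T}. sets (raw_filtration \<Omega> s))"
proof -
  have "sigma_algebra \<Omega> (\<Inter>s\<in>{t<..T}. sets (raw_filtration \<Omega> s))"
    unfolding sigma_algebra_iff2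
  proof (intro conjI ballI allI impI)
    show "(\<Inter>s\<in>{t<..T}. sets (raw_filtration \<Omega> s)) \<subseteq> Pow \<Omega>"
      using assms sets.sets_into_space[of _ "raw_filtration \<Omega> T"] by fastforce
    show "\<Omega> - A \<in> (\<Inter>s\<in>{t<..T}. sets (raw_filtration \<Omega> s))"
      if "A \<in> (\<Inter>s\<in>{t<..T}. sets (raw_filtration \<Omega> s))" for A
      using that sets.compl_sets[of A "raw_filtration \<Omega> _"] by simp
  qed auto
  then show ?thesis
    using assms by (simp add: right_filtration_def sigma_algebra.sets_measure_of_eq)
qed

lemma space_right_filtration [simp]: "space (right_filtration T \<Omega> t) = \<Omega>"
proof (cases "t < T")
  case True
  have "A \<subseteq> \<Omega>" if "A \<in> (\<Inter>s\<in>{t<..T}. sets (raw_filtration \<Omega> s))" for A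
    using that True sets.sets_into_space[of A "raw_filtration \<Omega> T"] by auto
  then show ?thesis
    using True by (auto simp: right_filtration_def intro!: space_measure_of)
qed (simp add: right_filtration_def)

lemma sets_right_filtration_mono:
  assumes "s \<le> t"
  shows "sets (right_filtration T \<Omega> s) \<subseteq> sets (right_filtration T \<Omega> t)"
proof (cases "t < T")
  case True
  then show ?thesis
    using assms by (auto simp: sets_right_filtration)
next
  case False
  show ?thesis
  proof (cases "s < T")
    case True
    then show ?thesis
      using False by (auto simp: sets_right_filtration) (simp add: right_filtration_def)
  qed (use False in \<open>simp add: right_filtration_def\<close>)
qed

lemma filtration_path_filtration: "filtration \<Omega> (path_filtration T \<Omega>)"
proof
  show "space (path_filtration T \<Omega> i) = \<Omega>" for i
    by (simp add: path_filtration_def)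
  show "sets (path_filtration T \<Omega> i) \<subseteq> sets (path_filtration T \<Omega> j)" if "i \<le> j" for i j
    unfolding path_filtration_def using that
    by (intro sets_right_filtration_mono enn2real_mono) (auto simp: min_def less_top[symmetric] top_unique)
qed

section \<open>Function spaces\<close>

text \<open>Functions on \<open>\<Omega>\<close> are represented by total functions whose values outside \<open>\<Omega>\<close> are
  irrelevant. Real-valued functions are embedded by \<^const>\<open>ereal\<close>.\<close>

definition borel_fun :: "real \<Rightarrow> 'd::finite path set \<Rightarrow> ('d path \<Rightarrow> ereal) set" where
  "borel_fun T \<Omega> = borel_measurable (path_borel T \<Omega>)"

definition borel_growth :: "real \<Rightarrow> 'd::finite path set \<Rightarrow> real \<Rightarrow> ('d path \<Rightarrow> ereal) set" where
  "borel_growth T \<Omega> r = {\<xi> \<in> borel_fun T \<Omega>.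
     \<exists>C::real. \<forall>\<omega>\<in>\<Omega>. \<bar>\<xi> \<omega> / ereal (1 + sup_norm T \<omega> powr r)\<bar> \<le> ereal C}"

definition borel_growth_nonneg :: "real \<Rightarrow> 'd::finite path set \<Rightarrow> real \<Rightarrow> ('d path \<Rightarrow> ereal) set" where
  "borel_growth_nonneg T \<Omega> r = {\<xi> \<in> borel_growth T \<Omega> r. \<forall>\<omega>\<in>\<Omega>. 0 \<le> \<xi> \<omega>}"

definition cont_fun :: "real \<Rightarrow> 'd::finite path set \<Rightarrow> ('d path \<Rightarrow> real) set" where
  "cont_fun T \<Omega> = {\<xi>. continuous_map (S_star_topology T \<Omega>) euclideanreal \<xi>}"

definition cont_growth :: "real \<Rightarrow> 'd::finite path set \<Rightarrow> real \<Rightarrow> ('d path \<Rightarrow> real) set" where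
  "cont_growth T \<Omega> r = {\<xi> \<in> cont_fun T \<Omega>. (\<lambda>\<omega>. ereal (\<xi> \<omega>)) \<in> borel_growth T \<Omega> r}"

definition cont_growth2 :: "real \<Rightarrow> 'd::finite path set \<Rightarrow> real \<Rightarrow> real \<Rightarrow> ('d path \<Rightarrow> real) set" where
  "cont_growth2 T \<Omega> q p = {\<xi> \<in> cont_fun T \<Omega>.
     (\<lambda>\<omega>. max (\<xi> \<omega>) 0) \<in> cont_growth T \<Omega> q \<and> (\<lambda>\<omega>. max (- \<xi> \<omega>) 0) \<in> cont_growth T \<Omega> p}"

definition fun_convex_cone :: "('a \<Rightarrow> real) set \<Rightarrow> bool" where
  "fun_convex_cone G \<longleftrightarrow> (\<lambda>_. 0) \<in> G \<and>
     (\<forall>f\<in>G. \<forall>g\<in>G. \<forall>a\<ge>0. \<forall>b\<ge>0. (\<lambda>\<omega>. a * f \<omega> + b * g \<omega>) \<in> G)"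

section \<open>Integrands and integrals\<close>

text \<open>A simple integrand is a pair \<open>(\<tau>, h)\<close> of a sequence of stopping times and a sequence of
  coefficients.\<close>

type_synonym 'd integrand = "(nat \<Rightarrow> 'd path \<Rightarrow> ennreal) \<times> (nat \<Rightarrow> 'd path \<Rightarrow> real^'d)"

definition stop_at :: "('d path \<Rightarrow> ennreal) \<Rightarrow> real \<Rightarrow> 'd path \<Rightarrow> real" where
  "stop_at \<tau> t \<omega> = enn2real (min (\<tau> \<omega>) (ennreal t))"

definition simple_integrand :: "real \<Rightarrow> 'd::finite path set \<Rightarrow> real \<Rightarrow> 'd integrand \<Rightarrow> bool" where
  "simple_integrand T \<Omega> q = (\<lambda>(\<tau>, h).
     (\<forall>n. stopping_time (path_filtration T \<Omega>) (\<tau> n)) \<and>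
     (\<forall>\<omega>\<in>\<Omega>. \<forall>n. \<tau> n \<omega> \<le> \<tau> (Suc n) \<omega>) \<and>
     (\<forall>\<omega>\<in>\<Omega>. \<exists>n. ennreal T \<le> \<tau> n \<omega>) \<and>
     (\<forall>n. h n \<in> borel_measurable (filtration.pre_sigma \<Omega> (path_filtration T \<Omega>) (\<tau> n))) \<and>
     (\<forall>n i. (\<lambda>\<omega>. ereal (h n \<omega> $ i)) \<in> borel_growth T \<Omega> (q - 1)))"

text \<open>For a simple integrand, \<open>\<omega> \<in> \<Omega>\<close> and \<open>t \<le> T\<close>, only finitely many terms of the series are
  nonzero.\<close>

definition simple_integral :: "'d::finite integrand \<Rightarrow> real \<Rightarrow> 'd path \<Rightarrow> real" where
  "simple_integral = (\<lambda>(\<tau>, h) t \<omega>.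
     \<Sum>n. h n \<omega> \<bullet> (\<omega> (stop_at (\<tau> (Suc n)) t \<omega>) - \<omega> (stop_at (\<tau> n) t \<omega>)))"

definition simple_admissible :: "real \<Rightarrow> 'd::finite path set \<Rightarrow> real \<Rightarrow> 'd integrand set" where
  "simple_admissible T \<Omega> q = {H. simple_integrand T \<Omega> q H \<and>
     (\<exists>l\<in>borel_growth_nonneg T \<Omega> q. \<forall>t\<in>{0..T}. \<forall>\<omega>\<in>\<Omega>. \<forall>m.
        - l \<omega> \<le> ereal (simple_integral H (stop_at (fst H m) t \<omega>) \<omega>))}"

definition admissible :: "real \<Rightarrow> 'd::finite path set \<Rightarrow> real \<Rightarrow> (nat \<Rightarrow> 'd integrand) set" where
  "admissible T \<Omega> q = {H. (\<forall>k. H k \<in> simple_admissible T \<Omega> q) \<and>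
     (\<exists>\<Lambda>\<in>borel_growth_nonneg T \<Omega> q. \<forall>t\<in>{0..T}. \<forall>\<omega>\<in>\<Omega>. \<forall>k.
        - \<Lambda> \<omega> \<le> ereal (simple_integral (H k) t \<omega>))}"

definition liminf_integral :: "(nat \<Rightarrow> 'd::finite integrand) \<Rightarrow> real \<Rightarrow> 'd path \<Rightarrow> ereal" where
  "liminf_integral H t \<omega> = liminf (\<lambda>k. ereal (simple_integral (H k) t \<omega>))"

definition attainable ::
  "real \<Rightarrow> 'd::finite path set \<Rightarrow> real \<Rightarrow> ('d path \<Rightarrow> real) set \<Rightarrow> ('d path \<Rightarrow> ereal) set" where
  "attainable T \<Omega> q G =
     {\<lambda>\<omega>. ereal (\<gamma> \<omega>) + liminf_integral H T \<omega> | \<gamma> H. \<gamma> \<in> G \<and> H \<in> admissible T \<Omega> q}"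

definition superhedging :: "'a set \<Rightarrow> ('a \<Rightarrow> ereal) \<Rightarrow> ('a \<Rightarrow> ereal) set \<Rightarrow> ereal" where
  "superhedging \<Omega> \<xi> I = Inf (ereal ` {c. \<exists>l\<in>I. \<forall>\<omega>\<in>\<Omega>. \<xi> \<omega> \<le> ereal c + l \<omega>})"

end

theory Submission
  imports Defs
begin

text \<open>
The compact sets are sets of \<^emph>\<open>tame\<close> paths: \<open>tame_paths T \<Omega> R m\<close> consists of the paths in \<open>\<Omega>\<close> that
have norm at most \<open>R\<close> and, for every \<open>j\<close>, fewer than \<open>m j\<close> disjoint oscillations of size more than
\<open>1 / (j + 1)\<close>. Two facts are needed: such sets are compact, and leaving them can be superhedged at
a small cost.

Compactness (\<open>compactin_tame_paths\<close>). A tame path is approximated uniformly by step paths with a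
controlled number of steps, so that a diagonal extraction of step times and values gives an
\<open>S\<close>-convergent subsequence (\<open>tame_paths_seq_compact\<close>). The limit is tame because sizes and
oscillations of paths are seen by the integrals over short time windows, which are Stieltjes
integrals of continuous functions (\<open>S_converges_path_mass\<close>, \<open>oscillates_S_limit\<close>). Countably many
of these integrals separate paths. They embed the tame paths injectively into a metrizable space,
which turns sequential compactness into compactness for \<open>S\<close> and hence for the coarser topology
\<open>S*\<close>.

Superhedging (\<open>superhedging_tame_paths_le\<close>). Start from a claim on \<open>3 / R\<close> times the sum of the
final components, which is nonnegative and dominates \<open>3 / R\<close> times the norm because the components
of paths are nonnegative. If the path leaves the ball of radius \<open>R\<close>, selling the claim at the exit
realizes its value, a third of which is at least \<open>1\<close>, as in the pathwise form of Doob's maximal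
inequality. As long as the path stays in the ball, let the \<^emph>\<open>anchor\<close> be moved to its current value
whenever this is more than \<open>\<delta>\<close> away. Holding \<open>- 2\<close> times the anchor replicates the sum of the
squared moves of the anchor up to terms at the two ends (\<open>anchor_gain\<close>), and this sum is at least
\<open>m * \<delta>\<^sup>2\<close> when there are \<open>m\<close> oscillations of size more than \<open>2 * \<delta>\<close> (\<open>energy_pairs\<close>). With a
weight inversely proportional to \<open>m * \<delta>\<^sup>2\<close> this pays \<open>1\<close> as well. The potential losses are linear
in the norm of the path at the end or at the exit, with a factor that is small for large \<open>m\<close>, so
that for all levels \<open>j\<close> together they are covered by the other two thirds of the claim. The claim
itself is dominated by a multiple of \<open>1 + norm (\<omega> T) powr q\<close> and thus by a constant and an element
of \<open>G\<close>, at a cost of order \<open>1 / R\<close>.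

The strategies trade on deterministic time grids, where stopping times and measurability are
elementary. The definition of the integral as a limit inferior along sequences of simple
integrands makes this sufficient: refining the grid detects every oscillation of a
right-continuous path in the end (\<open>oscillates_grid\<close>), and the number of levels can grow with the
grid, which deals with infinitely many levels at once. Finally \<open>R\<close> tends to infinity.
\<close>

section \<open>Variation functions and Stieltjes integrals\<close>

lemma variation_sums_mono:
  assumes "a' \<le> a" "b \<le> b'"
  shows "variation_sums a b g \<subseteq> variation_sums a' b' g"
proof
  fix x assume "x \<in> variation_sums a b g"
  then obtain n s where "x = (\<Sum>k<n. norm (g (s (Suc k)) - g (s k)))"
    "\<forall>k\<le>n. s k \<in> {a..b}" "\<forall>k<n. s k \<le> s (Suc k)"
    unfolding variation_sums_def by blast
  moreover have "\<forall>k\<le>n. s k \<in> {a'..b'}"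
    using calculation(2) assms by fastforce
  ultimately show "x \<in> variation_sums a' b' g"
    unfolding variation_sums_def by blast
qed

lemma zero_in_variation_sums:
  assumes "a \<le> b"
  shows "0 \<in> variation_sums a b g"
  unfolding variation_sums_def using assms
  by (intro CollectI exI[of _ 0] exI[of _ "\<lambda>_. a"]) auto

lemma variation_sum_le_total_variation:
  assumes "finite_variation_on a b' g" "x \<in> variation_sums a b g" "b \<le> b'"
  shows "x \<le> total_variation a b g"
  unfolding total_variation_def
  using assms variation_sums_mono[of a a b b' g]
  by (intro cSup_upper) (auto simp: finite_variation_on_def intro: bdd_above_mono)

lemma total_variation_increment:
  assumes g: "finite_variation_on a b g" and st: "a \<le> s" "s \<le> t" "t \<le> b"
  shows "total_variation a s g + norm (g t - g s) \<le> total_variation a t g"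
proof -
  have "x \<le> total_variation a t g - norm (g t - g s)" if "x \<in> variation_sums a s g" for x
  proof -
    from that obtain n r where x: "x = (\<Sum>k<n. norm (g (r (Suc k)) - g (r k)))"
      and r: "\<And>k. k \<le> n \<Longrightarrow> r k \<in> {a..s}" "\<And>k. k < n \<Longrightarrow> r k \<le> r (Suc k)"
      unfolding variation_sums_def by blast
    define r' where "r' k = (if k \<le> n then r k else if k = Suc n then s else t)" for k
    have "(\<Sum>k<Suc (Suc n). norm (g (r' (Suc k)) - g (r' k))) \<in> variation_sums a t g"
      unfolding variation_sums_def mem_Collect_eq
    proof (intro exI[of _ "Suc (Suc n)"] exI[of _ r'] conjI allI impI refl)
      show "r' k \<in> {a..t}" if "k \<le> Suc (Suc n)" for k
        using r(1)[of k] st by (auto simp: r'_def)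
      show "r' k \<le> r' (Suc k)" if "k < Suc (Suc n)" for k
        using r(1)[of k] r(2)[of k] st by (auto simp: r'_def le_Suc_eq)
    qed
    then have "(\<Sum>k<Suc (Suc n). norm (g (r' (Suc k)) - g (r' k))) \<le> total_variation a t g"
      by (rule variation_sum_le_total_variation[OF g]) (use st in auto)
    moreover have "(\<Sum>k<n. norm (g (r' (Suc k)) - g (r' k))) = x"
      unfolding x by (intro sum.cong) (auto simp: r'_def)
    then have "(\<Sum>k<Suc (Suc n). norm (g (r' (Suc k)) - g (r' k)))
        = x + norm (g s - g (r n)) + norm (g t - g s)"
      by (simp add: r'_def)
    ultimately show ?thesis
      by (smt (verit) norm_ge_zero)
  qed
  then have "total_variation a s g \<le> total_variation a t g - norm (g t - g s)"
    unfolding total_variation_def[of a s] using st zero_in_variation_sums[of a s g]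
    by (intro cSup_least) auto
  then show ?thesis by simp
qed

text \<open>
Among the functions whose increments dominate those of \<open>g\<close>, the variation function grows least.
\<close>

lemma variation_sums_le_dominating:
  fixes W :: "real \<Rightarrow> real"
  assumes "\<And>s t. a \<le> s \<Longrightarrow> s \<le> t \<Longrightarrow> t \<le> b \<Longrightarrow> norm (g t - g s) \<le> W t - W s"
    and x: "x \<in> variation_sums a b g"
  shows "x \<le> W b - W a"
proof -
  obtain n r where x: "x = (\<Sum>k<n. norm (g (r (Suc k)) - g (r k)))"
    and r: "\<And>k. k \<le> n \<Longrightarrow> r k \<in> {a..b}" "\<And>k. k < n \<Longrightarrow> r k \<le> r (Suc k)"
    using x unfolding variation_sums_def by blast
  have "x \<le> (\<Sum>k<n. W (r (Suc k)) - W (r k))"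
    unfolding x
  proof (intro sum_mono assms(1))
    fix k assume "k \<in> {..<n}"
    then show "a \<le> r k" "r k \<le> r (Suc k)" "r (Suc k) \<le> b"
      using r(1)[of k] r(1)[of "Suc k"] r(2)[of k] by auto
  qed
  also have "\<dots> = W (r n) - W (r 0)"
    by (rule sum_lessThan_telescope)
  also have "\<dots> \<le> W b - W a"
    using order_trans[OF norm_ge_zero assms(1)[of "r n" b]]
      order_trans[OF norm_ge_zero assms(1)[of a "r 0"]] r(1)[of 0] r(1)[of n]
    by auto
  finally show ?thesis .
qed

lemma total_variation_le_dominating:
  fixes W :: "real \<Rightarrow> real"
  assumes "\<And>s t. a \<le> s \<Longrightarrow> s \<le> t \<Longrightarrow> t \<le> b \<Longrightarrow> norm (g t - g s) \<le> W t - W s" "a \<le> b"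
  shows "total_variation a b g \<le> W b - W a"
  unfolding total_variation_def
  using zero_in_variation_sums[OF assms(2)] variation_sums_le_dominating[of a b g W, OF assms(1)]
  by (intro cSup_least) auto

text \<open>
If the variation function \<open>V\<close> jumped by \<open>e\<close> just after \<open>t\<close>, then \<open>V\<close> lowered by \<open>e\<close> to the right
of \<open>t\<close> would still dominate all increments of \<open>g\<close>: an increment across \<open>t\<close> can be split at points
\<open>u\<close> decreasing to \<open>t\<close>, where \<open>g\<close> has no jump. This contradicts the minimality of \<open>V\<close>. The point of
the lemma is that the Jordan parts of \<open>g\<close> are right-continuous, as interval measures require.
\<close>

lemma total_variation_right_continuous:
  assumes g: "finite_variation_on a b g" and t: "a \<le> t" "t < b"
    and cont: "(g \<longlongrightarrow> g t) (at_right t)"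
  shows "((\<lambda>s. total_variation a s g) \<longlongrightarrow> total_variation a t g) (at_right t)"
proof -
  define V where "V s = total_variation a s g" for s
  have inc: "norm (g s - g r) \<le> V s - V r" if "a \<le> r" "r \<le> s" "s \<le> b" for r s
    using total_variation_increment[OF g that] by (simp add: V_def)
  have mono: "V r \<le> V s" if "a \<le> r" "r \<le> s" "s \<le> b" for r s
    using inc[OF that] by (smt (verit) norm_ge_zero)
  have ex: "\<exists>s\<in>{t<..b}. V s < V t + e" if e: "e > 0" for e
  proof (rule ccontr)
    assume "\<not> ?thesis"
    then have jump: "V s \<ge> V t + e" if "t < s" "s \<le> b" for s
      using that by (meson greaterThanAtMost_iff not_le)
    \<comment> \<open>This function dominates the increments of \<open>g\<close> and ends below \<open>V\<close>.\<close>
    define W where "W s = V s - (if t < s then e else 0)" for s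
    have dom: "norm (g s - g r) \<le> W s - W r" if rs: "a \<le> r" "r \<le> s" "s \<le> b" for r s
    proof (cases "r \<le> t \<and> t < s")
      case False
      then show ?thesis using inc[OF rs] rs by (auto simp: W_def)
    next
      case True
      have "eventually (\<lambda>u. norm (g s - g r) \<le> V s - e - V r + norm (g u - g t)) (at_right t)"
        unfolding eventually_at_right[of t s, OF conjunct2[OF True]]
      proof (intro exI[of _ s] conjI allI impI)
        fix u assume u: "t < u" "u < s"
        have "norm (g s - g r) \<le> norm (g s - g u) + norm (g u - g t) + norm (g t - g r)"
          by (smt (verit) norm_triangle_ineq norm_diff_triangle_ineq norm_diff_triangle_le diff_add_cancel)
        also have "\<dots> \<le> (V s - V u) + norm (g u - g t) + (V t - V r)"
          using inc[of u s] inc[of r t] u True rs t by (intro add_mono) auto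
        finally show "norm (g s - g r) \<le> V s - e - V r + norm (g u - g t)"
          using jump[of u] u rs by simp
      qed (use True in simp)
      moreover have "((\<lambda>u. V s - e - V r + norm (g u - g t)) \<longlongrightarrow> V s - e - V r + norm (g t - g t)) (at_right t)"
        by (intro tendsto_intros cont)
      ultimately have "norm (g s - g r) \<le> V s - e - V r + norm (g t - g t)"
        by (intro tendsto_lowerbound) (auto simp: trivial_limit_at_right_real)
      then show ?thesis
        using True by (simp add: W_def)
    qed
    have "total_variation a b g \<le> W b - W a"
      by (rule total_variation_le_dominating[OF dom]) (use t in auto)
    moreover have "V a \<ge> 0"
      using zero_in_variation_sums[of a a g] variation_sum_le_total_variation[OF g, of 0 a] t
      by (auto simp: V_def)
    ultimately show False
      using e t by (simp add: W_def V_def)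
  qed
  have "(V \<longlongrightarrow> V t) (at_right t)"
  proof (rule tendstoI)
    fix e :: real assume "e > 0"
    then obtain s where s: "t < s" "s \<le> b" "V s < V t + e"
      using ex[of e] by auto
    show "\<forall>\<^sub>F u in at_right t. dist (V u) (V t) < e"
      unfolding eventually_at_right[OF s(1)]
    proof (intro exI[of _ s] conjI allI impI s(1))
      fix u assume "t < u" "u < s"
      then show "dist (V u) (V t) < e"
        using s t mono[of t u] mono[of u s] by (simp add: dist_real_def)
    qed
  qed
  then show ?thesis by (simp add: V_def[abs_def])
qed

text \<open>
These are the distribution functions of finite measures on \<open>{0..T}\<close>; an atom at \<open>0\<close> of mass \<open>F 0\<close>
is possible.
\<close>

definition distribution_fun :: "real \<Rightarrow> (real \<Rightarrow> real) \<Rightarrow> bool" where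
  "distribution_fun T F \<longleftrightarrow> mono F \<and> (\<forall>t. continuous (at_right t) F) \<and> (\<forall>t<0. F t = 0)
     \<and> (\<forall>t>T. F t = F T)"

lemma distribution_fun_jordan_pos:
  assumes T: "0 < T" and g: "finite_variation_on 0 T g"
    and cont: "\<And>t. t \<in> {0..<T} \<Longrightarrow> (g \<longlongrightarrow> g t) (at_right t)"
  shows "distribution_fun T (jordan_pos T g)"
proof -
  have pos: "jordan_pos T g t \<ge> 0" if "t \<ge> 0" for t
    using total_variation_increment[OF g, of 0 "min t T"] that T
      variation_sum_le_total_variation[OF g zero_in_variation_sums[of 0 0 g]]
    by (simp add: jordan_pos_def)
  have "mono (jordan_pos T g)"
  proof
    fix s t :: real assume st: "s \<le> t"
    consider "t < 0" | "s < 0" "0 \<le> t" | "0 \<le> s" "s \<le> t" using st by linarith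
    then show "jordan_pos T g s \<le> jordan_pos T g t"
    proof cases
      case 2 then show ?thesis using pos[of t] by (simp add: jordan_pos_def)
    next
      case 3
      then show ?thesis
        using total_variation_increment[OF g, of "min s T" "min t T"] st T
        by (simp add: jordan_pos_def min_le_iff_disj)
    qed (use st in \<open>simp add: jordan_pos_def\<close>)
  qed
  moreover have "continuous (at_right t) (jordan_pos T g)" for t
  proof -
    consider "t < 0" | "0 \<le> t" "t < T" | "T \<le> t" by linarith
    then show ?thesis
    proof cases
      case 1
      have "((\<lambda>_. 0) \<longlongrightarrow> (0::real)) (at_right t)" by simp
      moreover have "\<forall>\<^sub>F s in at_right t. 0 = jordan_pos T g s"
        unfolding eventually_at_right[OF 1] using 1 by (intro exI[of _ 0]) (auto simp: jordan_pos_def)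
      ultimately have "(jordan_pos T g \<longlongrightarrow> 0) (at_right t)"
        by (rule Lim_transform_eventually)
      then show ?thesis
        using 1 by (simp add: continuous_within jordan_pos_def[of T g t])
    next
      case 2
      have "((\<lambda>s. (\<bar>g 0\<bar> + total_variation 0 s g + g s) / 2) \<longlongrightarrow> (\<bar>g 0\<bar> + total_variation 0 t g + g t) / 2) (at_right t)"
        using 2 by (intro tendsto_intros total_variation_right_continuous[OF g] cont) auto
      moreover have "\<forall>\<^sub>F s in at_right t. (\<bar>g 0\<bar> + total_variation 0 s g + g s) / 2 = jordan_pos T g s"
        unfolding eventually_at_right[OF 2(2)] using 2 by (intro exI[of _ T]) (auto simp: jordan_pos_def)
      ultimately show ?thesis
        using 2 Lim_transform_eventually by (fastforce simp: continuous_within jordan_pos_def[of T g t])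
    next
      case 3
      have lim: "((\<lambda>_. jordan_pos T g t) \<longlongrightarrow> jordan_pos T g t) (at_right t)" by simp
      have "\<forall>\<^sub>F s in at_right t. jordan_pos T g t = jordan_pos T g s"
        unfolding eventually_at_right[of t "t + 1", simplified] using 3 T
        by (intro exI[of _ "t + 1"]) (auto simp: jordan_pos_def)
      then show ?thesis
        using Lim_transform_eventually[OF lim] by (simp add: continuous_within)
    qed
  qed
  ultimately show ?thesis
    using T by (auto simp: distribution_fun_def jordan_pos_def)
qed

lemma emeasure_distribution_fun:
  assumes F: "distribution_fun T F" and u: "0 \<le> u"
  shows "emeasure (interval_measure F) {0..u} = ennreal (F u)"
proof -
  let ?M = "interval_measure F"
  have Ioc: "emeasure ?M {a<..b} = ennreal (F b - F a)" if "a \<le> b" for a b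
    using F that by (intro emeasure_interval_measure_Ioc) (auto simp: distribution_fun_def dest: monoD)
  have "emeasure ?M (\<Union>n. {-1<..- 1 / real (Suc n)}) = 0"
  proof (rule emeasure_UN_eq_0)
    show "emeasure ?M {-1<..- 1 / real (Suc n)} = 0" for n
      using F by (subst Ioc) (auto simp: distribution_fun_def field_simps)
  qed auto
  also have "(\<Union>n. {-1<..- 1 / real (Suc n)}) = {-1<..<0::real}"
  proof safe
    fix x :: real assume "x \<in> {-1<..<0}"
    moreover obtain n where "inverse (real (Suc n)) < - x"
      using reals_Archimedean[of "- x"] calculation by auto
    ultimately show "x \<in> (\<Union>n. {-1<..- 1 / real (Suc n)})"
      by (auto simp: inverse_eq_divide intro!: exI[of _ n])
  next
    fix x :: real and n assume "x \<in> {-1<..- 1 / real (Suc n)}"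
    moreover have "- 1 / real (Suc n) < 0" by simp
    ultimately show "x \<in> {-1<..<0}"
      unfolding greaterThanAtMost_iff greaterThanLessThan_iff by linarith
  qed
  finally have null: "emeasure ?M {-1<..<0} = 0" .
  have "ennreal (F u) = emeasure ?M {-1<..u}"
    using F u by (subst Ioc) (auto simp: distribution_fun_def)
  also have "{-1<..u} = {-1<..<0} \<union> {0..u}"
    using u by auto
  also have "emeasure ?M \<dots> = emeasure ?M {-1<..<0} + emeasure ?M {0..u}"
    by (intro plus_emeasure[symmetric]) auto
  finally show ?thesis
    by (simp add: null)
qed

text \<open>
The trapezoid is the layer-cake integral of \<open>1 {t \<le> s + r}\<close> over \<open>r\<close> in \<open>{0..d}\<close>, so Tonelli's
theorem turns its integral into that of the distribution function over a window. This is how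
Stieltjes integrals of continuous functions recover local averages of a path.
\<close>

lemma integral_trapezoid_distribution_fun:
  assumes F: "distribution_fun T F" and T: "0 < T" and s: "0 \<le> s" and d: "0 \<le> d"
  shows "(LINT t:{0..T}|interval_measure F. max 0 (min d (s + d - t))) =
         (LINT r:{0..d}|lborel. F (min (s + r) T))"
proof -
  let ?M = "interval_measure F"
  have mono: "mono F" and cont: "\<And>t. continuous (at_right t) F"
    using F by (auto simp: distribution_fun_def)
  have [measurable]: "F \<in> borel_measurable borel"
    by (rule borel_measurable_mono[OF mono])
  have Fpos: "0 \<le> F u" if "0 \<le> u" for u
    using monoD[OF mono, of "-1" u] F that by (simp add: distribution_fun_def)
  have "sigma_finite_measure ?M"
    by (rule sigma_finite_interval_measure) (auto intro: monoD[OF mono] cont)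
  then interpret pair_sigma_finite ?M "lborel :: real measure"
    by (simp add: pair_sigma_finite_def lborel.sigma_finite_measure_axioms)
  define f :: "real \<Rightarrow> real \<Rightarrow> ennreal"
    where "f t r = indicator {0..T} t * (indicator {0..d} r * (if t \<le> s + r then 1 else 0))" for t r
  have meas: "case_prod f \<in> borel_measurable (?M \<Otimes>\<^sub>M lborel)"
    unfolding f_def by measurable
  have inner: "(\<integral>\<^sup>+ r. f t r \<partial>lborel) = ennreal (indicator {0..T} t *\<^sub>R max 0 (min d (s + d - t)))" for t
  proof (cases "t \<in> {0..T}")
    case True
    have "(\<integral>\<^sup>+ r. f t r \<partial>lborel) = (\<integral>\<^sup>+ r. indicator {max 0 (t - s)..d} r \<partial>lborel)"
      using True by (intro nn_integral_cong) (auto simp: f_def split: split_indicator)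
    also have "\<dots> = ennreal (if max 0 (t - s) \<le> d then d - max 0 (t - s) else 0)"
      by (simp only: nn_integral_indicator sets_lborel borel_closed closed_atLeastAtMost emeasure_lborel_Icc_eq)
    also have "\<dots> = ennreal (max 0 (min d (s + d - t)))"
      using d by (intro arg_cong[of _ _ ennreal]) (auto simp: max_def min_def)
    finally show ?thesis using True by simp
  qed (simp add: f_def)
  have outer: "(\<integral>\<^sup>+ t. f t r \<partial>?M) = ennreal (indicator {0..d} r *\<^sub>R F (min (s + r) T))" for r
  proof (cases "r \<in> {0..d}")
    case True
    have "(\<integral>\<^sup>+ t. f t r \<partial>?M) = (\<integral>\<^sup>+ t. indicator {0..min (s + r) T} t \<partial>?M)"
      using True by (intro nn_integral_cong) (auto simp: f_def split: split_indicator)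
    also have "\<dots> = emeasure ?M {0..min (s + r) T}"
      by (rule nn_integral_indicator) simp
    also have "\<dots> = ennreal (F (min (s + r) T))"
      using True s T by (intro emeasure_distribution_fun[OF F]) auto
    finally show ?thesis using True by simp
  qed (simp add: f_def)
  have "(LINT t:{0..T}|?M. max 0 (min d (s + d - t))) =
      enn2real (\<integral>\<^sup>+ t. ennreal (indicator {0..T} t *\<^sub>R max 0 (min d (s + d - t))) \<partial>?M)"
    unfolding set_lebesgue_integral_def by (rule integral_eq_nn_integral) auto
  also have "\<dots> = enn2real (\<integral>\<^sup>+ t. (\<integral>\<^sup>+ r. f t r \<partial>lborel) \<partial>?M)"
    by (simp only: inner)
  also have "\<dots> = enn2real (\<integral>\<^sup>+ r. (\<integral>\<^sup>+ t. f t r \<partial>?M) \<partial>lborel)"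
    by (subst Fubini'[OF meas]) simp
  also have "\<dots> = enn2real (\<integral>\<^sup>+ r. ennreal (indicator {0..d} r *\<^sub>R F (min (s + r) T)) \<partial>lborel)"
    by (simp only: outer)
  also have "\<dots> = (LINT r:{0..d}|lborel. F (min (s + r) T))"
    unfolding set_lebesgue_integral_def using s T
    by (intro integral_eq_nn_integral[symmetric]) (auto intro!: AE_I2 Fpos split: split_indicator)
  finally show ?thesis .
qed

lemma finite_variation_on_uminus: "finite_variation_on a b (\<lambda>t. - g t) = finite_variation_on a b g"
  and total_variation_uminus: "total_variation a b (\<lambda>t. - g t) = total_variation a b g"
proof -
  have "variation_sums a b (\<lambda>t. - g t) = variation_sums a b g"
    unfolding variation_sums_def by (simp add: norm_minus_commute)
  then show "finite_variation_on a b (\<lambda>t. - g t) = finite_variation_on a b g"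
    and "total_variation a b (\<lambda>t. - g t) = total_variation a b g"
    by (simp_all add: finite_variation_on_def total_variation_def)
qed

lemma jordan_pos_diff:
  assumes "0 \<le> t"
  shows "jordan_pos T g t - jordan_pos T (\<lambda>s. - g s) t = g (min t T)"
  using assms by (simp add: jordan_pos_def total_variation_uminus field_simps)

lemma stieltjes_integral_trapezoid:
  assumes T: "0 < T" and g: "finite_variation_on 0 T g"
    and cont: "\<And>t. t \<in> {0..<T} \<Longrightarrow> (g \<longlongrightarrow> g t) (at_right t)" and s: "0 \<le> s" and d: "0 \<le> d"
  shows "stieltjes_integral T (\<lambda>t. max 0 (min d (s + d - t))) g = (LINT r:{0..d}|lborel. g (min (s + r) T))"
proof -
  have P: "distribution_fun T (jordan_pos T g)"
    by (rule distribution_fun_jordan_pos[OF T g cont])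
  have N: "distribution_fun T (jordan_pos T (\<lambda>s. - g s))"
    by (rule distribution_fun_jordan_pos[OF T]) (auto simp: finite_variation_on_uminus g intro!: tendsto_minus cont)
  have int: "set_integrable lborel {0..d} (\<lambda>r. F (min (s + r) T))" if "distribution_fun T F" for F
  proof -
    have F: "mono F" using that by (simp add: distribution_fun_def)
    have [measurable]: "F \<in> borel_measurable borel"
      by (rule borel_measurable_mono[OF F])
    have F0: "F (-1) = 0" using that by (simp add: distribution_fun_def)
    show ?thesis
      unfolding set_integrable_def
    proof (rule integrableI_bounded_set[where A="{0..d}" and B="F T"])
      show "AE x in lborel. x \<in> {0..d} \<longrightarrow> norm (indicator {0..d} x *\<^sub>R F (min (s + x) T)) \<le> F T"
      proof (intro AE_I2 impI)
        fix x assume x: "x \<in> {0..d}"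
        have "F (min (s + x) T) \<le> F T" "F (-1) \<le> F (min (s + x) T)"
          using x s T by (auto intro!: monoD[OF F])
        then show "norm (indicator {0..d} x *\<^sub>R F (min (s + x) T)) \<le> F T"
          using x F0 by simp
      qed
    qed (use d in \<open>auto simp: emeasure_lborel_Icc_eq split: split_indicator\<close>)
  qed
  show ?thesis
    unfolding stieltjes_integral_def integral_trapezoid_distribution_fun[OF P T s d]
      integral_trapezoid_distribution_fun[OF N T s d] set_integral_diff(2)[OF int[OF P] int[OF N], symmetric]
    by (rule set_lebesgue_integral_cong) (use s T in \<open>auto simp: jordan_pos_diff\<close>)
qed

definition grid :: "real \<Rightarrow> nat \<Rightarrow> nat \<Rightarrow> real" where
  "grid T n k = real k * T / real (Suc n)"

lemma grid_0 [simp]: "grid T n 0 = 0"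
  and grid_Suc_self [simp]: "grid T n (Suc n) = T"
  by (simp_all add: grid_def del: of_nat_Suc)

lemma grid_mono: "0 \<le> T \<Longrightarrow> i \<le> j \<Longrightarrow> grid T n i \<le> grid T n j"
  by (auto simp: grid_def intro!: divide_right_mono mult_right_mono)

lemma grid_mem: "0 \<le> T \<Longrightarrow> k \<le> Suc n \<Longrightarrow> grid T n k \<in> {0..T}"
  using grid_mono[of T 0 k n] grid_mono[of T k "Suc n" n] by simp

lemma grid_step: "grid T n (Suc k) - grid T n k = T / real (Suc n)"
  by (simp add: grid_def add_divide_distrib distrib_right)

lemma grid_step_less:
  assumes "0 < T" "0 < d" "T / d < real N" "N \<le> n"
  shows "grid T n (Suc k) - grid T n k < d"
proof -
  have "T < real N * d" using assms by (simp add: pos_divide_less_eq)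
  also have "\<dots> \<le> real (Suc n) * d" using assms by (intro mult_right_mono) auto
  finally show ?thesis unfolding grid_step by (simp add: pos_divide_less_eq mult.commute del: of_nat_Suc)
qed

text \<open>
Left-endpoint Riemann--Stieltjes sums; the first term is the mass at \<open>0\<close>. They are linear in \<open>g\<close>,
which is not apparent for the Stieltjes integral, whose definition goes through the total
variation of \<open>g\<close>.
\<close>

definition Riemann_sum :: "real \<Rightarrow> (real \<Rightarrow> real) \<Rightarrow> (real \<Rightarrow> real) \<Rightarrow> nat \<Rightarrow> real" where
  "Riemann_sum T f g n = f 0 * g 0 + (\<Sum>k<Suc n. f (grid T n k) * (g (grid T n (Suc k)) - g (grid T n k)))"

lemma integral_cell_approx:
  fixes f :: "real \<Rightarrow> real"
  assumes A: "A \<in> sets M" "emeasure M A < \<infinity>" and f: "set_integrable M A f"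
    and bound: "\<And>t. t \<in> A \<Longrightarrow> \<bar>f t - c\<bar> \<le> e"
  shows "\<bar>(LINT t:A|M. f t) - c * measure M A\<bar> \<le> e * measure M A"
proof -
  have const: "set_integrable M A (\<lambda>_. k)" for k :: real
    using A by (simp add: set_integrable_def integrable_indicator_iff)
  have lint: "(LINT t:A|M. k) = k * measure M A" for k :: real
    using A by (simp add: set_lebesgue_integral_def measure_def)
  have "(LINT t:A|M. f t) \<le> (LINT t:A|M. c + e)" "(LINT t:A|M. c - e) \<le> (LINT t:A|M. f t)"
    using bound by (auto intro!: set_integral_mono f const simp: abs_le_iff algebra_simps)
  then show ?thesis
    by (simp add: lint algebra_simps abs_le_iff)
qed

lemma Riemann_sums_distribution_fun:
  fixes f :: "real \<Rightarrow> real" and T :: real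
  assumes F: "distribution_fun T F" and T: "0 < T" and f: "continuous_on {0..T} f"
  shows "(\<lambda>n. Riemann_sum T f F n)
    \<longlonglongrightarrow> (LINT t:{0..T}|interval_measure F. f t)"
proof (rule LIMSEQ_I)
  fix e' :: real assume e': "e' > 0"
  let ?M = "interval_measure F"
  have mono: "mono F" and Fneg: "F (-1) = 0"
    using F by (auto simp: distribution_fun_def)
  have Fpos: "0 \<le> F u" if "0 \<le> u" for u
    using monoD[OF mono, of "-1" u] Fneg that by simp
  define e where "e = e' / (2 * (F T + 1))"
  have "0 \<le> e' * F T"
    using e' Fpos[of T] T by simp
  then have e: "e > 0" "e * F T < e'"
    using e' Fpos[of T] T by (auto simp: e_def field_simps intro: add_nonneg_pos)
  have "uniformly_continuous_on {0..T} f"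
    by (rule compact_uniformly_continuous[OF f]) simp
  then obtain d where d: "d > 0" "\<And>s t. s \<in> {0..T} \<Longrightarrow> t \<in> {0..T} \<Longrightarrow> dist t s < d \<Longrightarrow> dist (f t) (f s) < e"
    using e(1) unfolding uniformly_continuous_on_def by metis
  obtain N :: nat where N: "T / d < N" using reals_Archimedean2 by blast
  have "emeasure ?M {0..T} < \<infinity>"
    using emeasure_distribution_fun[OF F, of T] T by simp
  have int: "set_integrable ?M {0..T} f"
    unfolding set_integrable_def
  proof -
    obtain B where B: "\<And>t. t \<in> {0..T} \<Longrightarrow> norm (f t) \<le> B"
      using compact_imp_bounded[OF compact_continuous_image[OF f compact_Icc]]
      unfolding bounded_iff by blast
    have "(\<lambda>t. indicator {0..T} t *\<^sub>R f t) \<in> borel_measurable ?M"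
      using borel_measurable_continuous_on_indicator[OF _ f] by simp
    then show "integrable ?M (\<lambda>t. indicator {0..T} t *\<^sub>R f t)"
      using B \<open>emeasure ?M {0..T} < \<infinity>\<close>
      by (intro integrableI_bounded_set[where A="{0..T}" and B=B]) auto
  qed
  have "norm (Riemann_sum T f F n
      - (LINT t:{0..T}|?M. f t)) < e'" if n: "n \<ge> N" for n
  proof -
    define g where "g k = grid T n k" for k
    have g0: "g 0 = 0" and gn: "g (Suc n) = T" by (simp_all add: g_def)
    have gm: "g i \<le> g j" if "i \<le> j" for i j
      using T that by (simp add: g_def grid_mono)
    have gpos: "0 \<le> g i" for i using gm[of 0 i] g0 by simp
    have gd: "g (Suc k) - g k < d" for k
      unfolding g_def by (rule grid_step_less[OF T d(1) N n])
    have fin: "emeasure ?M {0..g k} < \<infinity>" for k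
      using emeasure_distribution_fun[OF F gpos, of k] by simp
    have meas: "measure ?M {0..g k} = F (g k)" for k
      using emeasure_distribution_fun[OF F gpos, of k] Fpos[OF gpos] by (simp add: measure_def)
    have split: "{0..g (Suc k)} = {0..g k} \<union> {g k<..g (Suc k)}" for k
      using gpos[of k] gm[of k "Suc k"] by auto
    have fin': "emeasure ?M {g k<..g (Suc k)} < \<infinity>" for k
      by (rule le_less_trans[OF emeasure_mono fin[of "Suc k"]]) (auto simp: split)
    have meas': "measure ?M {g k<..g (Suc k)} = F (g (Suc k)) - F (g k)" for k
    proof -
      have "measure ?M {0..g (Suc k)} = measure ?M {0..g k} + measure ?M {g k<..g (Suc k)}"
        unfolding split using fin[of k] fin'[of k] by (intro measure_Union) auto
      then show ?thesis by (simp add: meas)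
    qed
    have sub: "set_integrable ?M A f" if "A \<subseteq> {0..g k}" "k \<le> Suc n" "A \<in> sets borel" for A k
      using that gm[of k "Suc n"] gn by (intro set_integrable_subset[OF int]) auto
    have "\<bar>(f 0 * F 0 + (\<Sum>i<k. f (g i) * (F (g (Suc i)) - F (g i)))) - (LINT t:{0..g k}|?M. f t)\<bar> \<le> e * F (g k)"
      if "k \<le> Suc n" for k
      using that
    proof (induction k)
      case 0
      have "\<bar>(LINT t:{0..g 0}|?M. f t) - f 0 * measure ?M {0..g 0}\<bar> \<le> e * measure ?M {0..g 0}"
        using e by (intro integral_cell_approx fin sub) (auto simp: g0)
      then show ?case
        by (simp add: meas) (simp add: g0)
    next
      case (Suc k)
      have "(LINT t:{0..g (Suc k)}|?M. f t) = (LINT t:{0..g k}|?M. f t) + (LINT t:{g k<..g (Suc k)}|?M. f t)"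
        unfolding split using Suc.prems split[of k]
        by (intro set_integral_Un sub[of _ "Suc k"]) auto
      moreover have "\<bar>(LINT t:{g k<..g (Suc k)}|?M. f t) - f (g k) * measure ?M {g k<..g (Suc k)}\<bar>
          \<le> e * measure ?M {g k<..g (Suc k)}"
      proof (intro integral_cell_approx fin')
        show "set_integrable ?M {g k<..g (Suc k)} f"
          using Suc.prems gpos[of k] by (intro sub[of _ "Suc k"]) auto
        fix t assume "t \<in> {g k<..g (Suc k)}"
        then have "dist (f t) (f (g k)) < e"
          using gpos[of k] gd[of k] gm[of "Suc k" "Suc n"] gn Suc.prems
          by (intro d) (auto simp: dist_real_def)
        then show "\<bar>f t - f (g k)\<bar> \<le> e" by (simp add: dist_real_def)
      qed simp
      moreover have "\<bar>(f 0 * F 0 + (\<Sum>i<k. f (g i) * (F (g (Suc i)) - F (g i)))) - (LINT t:{0..g k}|?M. f t)\<bar> \<le> e * F (g k)"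
        using Suc by simp
      ultimately show ?case
        unfolding meas' sum.lessThan_Suc right_diff_distrib by linarith
    qed
    from this[of "Suc n"] show ?thesis
      using e(2) gn unfolding g_def Riemann_sum_def by simp
  qed
  then show "\<exists>N. \<forall>n\<ge>N. norm (Riemann_sum T f F n
      - (LINT t:{0..T}|?M. f t)) < e'" by blast
qed

text \<open>
Since the difference of the two Jordan parts of \<open>g\<close> is \<open>g\<close> itself, the total variation cancels
from the sums.
\<close>

lemma Riemann_sums_stieltjes_integral:
  fixes f :: "real \<Rightarrow> real" and T :: real
  assumes T: "0 < T" and g: "finite_variation_on 0 T g"
    and cont: "\<And>t. t \<in> {0..<T} \<Longrightarrow> (g \<longlongrightarrow> g t) (at_right t)" and f: "continuous_on {0..T} f"
  shows "(\<lambda>n. Riemann_sum T f g n)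
    \<longlonglongrightarrow> stieltjes_integral T f g"
proof -
  let ?P = "jordan_pos T g" and ?N = "jordan_pos T (\<lambda>s. - g s)"
  have P: "distribution_fun T ?P"
    by (rule distribution_fun_jordan_pos[OF T g cont])
  have N: "distribution_fun T ?N"
    by (rule distribution_fun_jordan_pos[OF T]) (auto simp: finite_variation_on_uminus g intro!: tendsto_minus cont)
  have "(\<lambda>n. Riemann_sum T f ?P n - Riemann_sum T f ?N n) \<longlonglongrightarrow> stieltjes_integral T f g"
    unfolding stieltjes_integral_def
    by (intro tendsto_diff Riemann_sums_distribution_fun T f P N)
  moreover have "Riemann_sum T f ?P n - Riemann_sum T f ?N n = Riemann_sum T f g n" for n
  proof -
    have grid: "0 \<le> grid T n k" "min (grid T n k) T = grid T n k" if "k \<le> Suc n" for k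
      using grid_mem[of T k n] that T by auto
    have diff: "?P (grid T n k) - ?N (grid T n k) = g (grid T n k)" if "k \<le> Suc n" for k
      using jordan_pos_diff[OF grid(1)[OF that], of T g] by (simp only: grid(2)[OF that])
    have "f 0 * ?P 0 - f 0 * ?N 0 = f 0 * g 0"
      using diff[of 0] by (simp add: grid_def algebra_simps flip: right_diff_distrib)
    moreover have "(\<Sum>k<Suc n. f (grid T n k) * (?P (grid T n (Suc k)) - ?P (grid T n k)))
      - (\<Sum>k<Suc n. f (grid T n k) * (?N (grid T n (Suc k)) - ?N (grid T n k)))
      = (\<Sum>k<Suc n. f (grid T n k) * (g (grid T n (Suc k)) - g (grid T n k)))"
      unfolding sum_subtractf[symmetric]
    proof (intro sum.cong refl)
      fix k assume "k \<in> {..<Suc n}"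
      then show "f (grid T n k) * (?P (grid T n (Suc k)) - ?P (grid T n k))
        - f (grid T n k) * (?N (grid T n (Suc k)) - ?N (grid T n k))
        = f (grid T n k) * (g (grid T n (Suc k)) - g (grid T n k))"
        using diff[of k] diff[of "Suc k"] by (simp only: lessThan_iff flip: right_diff_distrib) (simp add: algebra_simps)
    qed
    ultimately show ?thesis
      unfolding Riemann_sum_def by linarith
  qed
  ultimately show ?thesis
    by simp
qed

section \<open>Local averages of paths\<close>

lemma norm_set_integral_le:
  fixes h :: "real \<Rightarrow> 'a::{banach, second_countable_topology}"
  assumes h: "set_integrable lborel {a..b} h" and le: "\<And>r. r \<in> {a..b} \<Longrightarrow> norm (h r) \<le> e" and "a \<le> b"
  shows "norm (LINT r:{a..b}|lborel. h r) \<le> e * (b - a)"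
proof -
  have e: "set_integrable lborel {a..b} (\<lambda>_. e)"
    by (simp add: set_integrable_def integrable_indicator_iff emeasure_lborel_Icc_eq)
  have "norm (LINT r:{a..b}|lborel. h r) \<le> (LINT r:{a..b}|lborel. norm (h r))"
    using integral_norm_bound[of lborel "\<lambda>r. indicator {a..b} r *\<^sub>R h r"]
    by (simp add: set_lebesgue_integral_def)
  also have "\<dots> \<le> (LINT r:{a..b}|lborel. e)"
    by (intro set_integral_mono set_integrable_norm h e le)
  also have "\<dots> = e * (b - a)"
    using \<open>a \<le> b\<close> by (simp add: set_lebesgue_integral_def)
  finally show ?thesis .
qed

lemma borel_measurable_right_continuous:
  fixes h :: "real \<Rightarrow> 'a::metric_space"
  assumes "\<And>t. (h \<longlongrightarrow> h t) (at_right t)"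
  shows "h \<in> borel_measurable borel"
proof (rule borel_measurable_LIMSEQ_metric)
  fix n :: nat
  define u where "u t = (real_of_int \<lfloor>real (Suc n) * t\<rfloor> + 1) / real (Suc n)" for t :: real
  have "(\<lambda>t. \<lfloor>real (Suc n) * t\<rfloor>) \<in> borel \<rightarrow>\<^sub>M count_space UNIV"
    by measurable
  then have "(\<lambda>t. (\<lambda>k. h ((real_of_int k + 1) / real (Suc n))) \<lfloor>real (Suc n) * t\<rfloor>) \<in> borel_measurable borel"
    by (rule measurable_compose) simp
  then show "(\<lambda>t. h ((real_of_int \<lfloor>real (Suc n) * t\<rfloor> + 1) / real (Suc n))) \<in> borel_measurable borel"
    by simp
next
  fix t :: real
  define u where "u n = (real_of_int \<lfloor>real (Suc n) * t\<rfloor> + 1) / real (Suc n)" for n :: nat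
  have scale: "t < (real_of_int \<lfloor>c * t\<rfloor> + 1) / c" "(real_of_int \<lfloor>c * t\<rfloor> + 1) / c \<le> t + 1 / c" if "c > 0" for c
  proof -
    have "c * t < real_of_int \<lfloor>c * t\<rfloor> + 1" "real_of_int \<lfloor>c * t\<rfloor> \<le> c * t"
      by linarith+
    then show "t < (real_of_int \<lfloor>c * t\<rfloor> + 1) / c" "(real_of_int \<lfloor>c * t\<rfloor> + 1) / c \<le> t + 1 / c"
      using that by (simp_all add: field_simps)
  qed
  have u: "t < u n" "u n \<le> t + 1 / real (Suc n)" for n
    unfolding u_def by (rule scale, simp)+
  have "(\<lambda>n. t + 1 / real (Suc n)) \<longlonglongrightarrow> t + 0"
    by (intro tendsto_intros LIMSEQ_Suc[OF lim_1_over_n])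
  moreover have "t \<le> u n" for n
    using u(1)[of n] by simp
  ultimately have "u \<longlonglongrightarrow> t"
    using u(2) by (intro tendsto_sandwich[of "\<lambda>_. t" u _ "\<lambda>n. t + 1 / real (Suc n)"]) simp_all
  then have "filterlim u (at_right t) sequentially"
    using u(1) by (simp add: filterlim_at order_less_imp_not_eq2)
  then show "(\<lambda>n. h ((real_of_int \<lfloor>real (Suc n) * t\<rfloor> + 1) / real (Suc n))) \<longlonglongrightarrow> h t"
    using filterlim_compose[OF assms] by (simp add: u_def[abs_def])
qed

text \<open>
A path is continued by its last value after \<open>T\<close>. Then it is right-continuous at all times, and
averages over windows to the right of a time make sense at \<open>T\<close> as well.
\<close>

lemma skorokhod_right_limit:
  assumes w: "\<omega> \<in> skorokhod_space T" and s: "0 \<le> s"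
  shows "((\<lambda>u. \<omega> (min u T)) \<longlongrightarrow> \<omega> (min s T)) (at_right s)"
proof (cases "s < T")
  case True
  then have "(\<omega> \<longlongrightarrow> \<omega> s) (at_right s)"
    using w s by (simp add: skorokhod_space_def)
  moreover have "\<forall>\<^sub>F u in at_right s. \<omega> u = \<omega> (min u T)"
    unfolding eventually_at_right[OF True] using True by (intro exI[of _ T]) auto
  ultimately show ?thesis
    using True Lim_transform_eventually by fastforce
next
  case False
  have lim: "((\<lambda>_. \<omega> T) \<longlongrightarrow> \<omega> T) (at_right s)" by simp
  have "\<forall>\<^sub>F u in at_right s. \<omega> T = \<omega> (min u T)"
    unfolding eventually_at_right[of s "s + 1", simplified] using False by (intro exI[of _ "s + 1"]) auto
  then have "((\<lambda>u. \<omega> (min u T)) \<longlongrightarrow> \<omega> T) (at_right s)"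
    by (rule Lim_transform_eventually[OF lim])
  moreover have "min s T = T" using False by simp
  ultimately show ?thesis by (simp only:)
qed

text \<open>
The one-sided limits bound the path near each time, and finitely many neighbourhoods cover the
interval.
\<close>

lemma skorokhod_bounded:
  fixes \<omega> :: "'d::finite path"
  assumes w: "\<omega> \<in> skorokhod_space T"
  shows "bounded (\<omega> ` {0..T})"
proof -
  define P where "P U \<longleftrightarrow> open U \<and> bounded (\<omega> ` (U \<inter> {0..T}))" for U
  have "\<exists>U. t \<in> U \<and> P U" if t: "t \<in> {0..T}" for t
  proof -
    have one_sided: "\<exists>B. eventually (\<lambda>u. norm (\<omega> u) \<le> B) F" if "(\<omega> \<longlongrightarrow> l) F" for l F
    proof
      show "\<forall>\<^sub>F u in F. norm (\<omega> u) \<le> norm l + 1"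
        using tendstoD[OF tendsto_norm[OF that], of 1]
        by (auto elim!: eventually_mono simp: dist_real_def)
    qed
    have "\<exists>B. \<exists>b>t. \<forall>u>t. u < b \<longrightarrow> u \<in> {0..T} \<longrightarrow> norm (\<omega> u) \<le> B"
    proof (cases "t < T")
      case True
      then have "(\<omega> \<longlongrightarrow> \<omega> t) (at_right t)"
        using w t by (simp add: skorokhod_space_def)
      from one_sided[OF this] show ?thesis
        unfolding eventually_at_right[OF True] by blast
    next
      case False
      then show ?thesis using t by (intro exI[of _ 0] exI[of _ "t + 1"]) auto
    qed
    then obtain B b where b: "b > t" "\<And>u. t < u \<Longrightarrow> u < b \<Longrightarrow> u \<in> {0..T} \<Longrightarrow> norm (\<omega> u) \<le> B"
      by blast
    have "\<exists>B. \<exists>b<t. \<forall>u>b. u < t \<longrightarrow> u \<in> {0..T} \<longrightarrow> norm (\<omega> u) \<le> B"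
    proof (cases "0 < t")
      case True
      then have "\<exists>l. (\<omega> \<longlongrightarrow> l) (at_left t)"
        using w t by (simp add: skorokhod_space_def)
      then obtain l where "(\<omega> \<longlongrightarrow> l) (at_left t)" ..
      from one_sided[OF this] show ?thesis
        unfolding eventually_at_left[OF True] by blast
    next
      case False
      then show ?thesis using t by (intro exI[of _ 0] exI[of _ "t - 1"]) auto
    qed
    then obtain B' b' where b': "b' < t" "\<And>u. b' < u \<Longrightarrow> u < t \<Longrightarrow> u \<in> {0..T} \<Longrightarrow> norm (\<omega> u) \<le> B'"
      by blast
    have "norm (\<omega> u) \<le> max (max B B') (norm (\<omega> t))" if "u \<in> {b'<..<b} \<inter> {0..T}" for u
      using that b(2)[of u] b'(2)[of u] by (cases u t rule: linorder_cases) auto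
    then have "P {b'<..<b}"
      unfolding P_def bounded_iff
      by (intro conjI open_greaterThanLessThan exI[of _ "max (max B B') (norm (\<omega> t))"]) auto
    then show ?thesis
      using b b' by (intro exI[of _ "{b'<..<b}"]) auto
  qed
  then obtain U where U: "\<And>t. t \<in> {0..T} \<Longrightarrow> t \<in> U t \<and> P (U t)"
    by metis
  obtain C where C: "C \<subseteq> {0..T}" "finite C" "{0..T} \<subseteq> (\<Union>t\<in>C. U t)"
    using compactE_image[OF compact_Icc[of 0 T], of "{0..T}" U] U unfolding P_def by blast
  have "bounded (\<Union>t\<in>C. \<omega> ` (U t \<inter> {0..T}))"
    using C U unfolding P_def by (intro bounded_UN) auto
  then show ?thesis
    by (rule bounded_subset) (use C in blast)
qed

lemma norm_le_sup_norm:
  assumes "bounded (\<omega> ` {0..T})" "t \<in> {0..T}"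
  shows "norm (\<omega> t) \<le> sup_norm T \<omega>"
  unfolding sup_norm_def using assms
  by (intro cSUP_upper) (auto simp: bounded_iff bdd_above_def)

text \<open>
The integral of the continued path over the window from \<open>s\<close> to \<open>s + d\<close>. These functionals are
\<open>S\<close>-continuous, determine the path, and generate enough Borel sets, so they replace the
evaluations, which are not continuous in general.
\<close>

definition path_mass :: "real \<Rightarrow> real \<Rightarrow> real \<Rightarrow> 'd::finite path \<Rightarrow> real^'d" where
  "path_mass T s d \<omega> = (LINT r:{0..d}|lborel. \<omega> (min (s + r) T))"

lemma path_integrable:
  fixes \<omega> :: "'d::finite path"
  assumes T: "0 < T" and w: "\<omega> \<in> skorokhod_space T" and s: "0 \<le> s"
  shows "set_integrable lborel {0..d} (\<lambda>r. \<omega> (min (s + r) T))"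
proof -
  define h where "h r = (if r < 0 then 0 else \<omega> (min (s + r) T))" for r
  have "(h \<longlongrightarrow> h t) (at_right t)" for t
  proof (cases "t < 0")
    case True
    have lim: "((\<lambda>_. 0) \<longlongrightarrow> (0 :: real^'d)) (at_right t)" by simp
    have "\<forall>\<^sub>F u in at_right t. 0 = h u"
      unfolding eventually_at_right[OF True] by (intro exI[of _ 0]) (simp add: True h_def)
    from Lim_transform_eventually[OF lim this] show ?thesis
      using True by (simp add: h_def[of t])
  next
    case False
    have "filterlim (\<lambda>r. s + r) (at_right (s + t)) (at_right t)"
      by (auto simp: filterlim_at eventually_at_filter intro!: tendsto_eq_intros)
    with skorokhod_right_limit[OF w, of "s + t"] s False
    have lim: "((\<lambda>r. \<omega> (min (s + r) T)) \<longlongrightarrow> h t) (at_right t)"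
      by (auto simp: h_def intro: filterlim_compose)
    have "\<forall>\<^sub>F u in at_right t. \<omega> (min (s + u) T) = h u"
      using False by (auto simp: h_def eventually_at_filter)
    from Lim_transform_eventually[OF lim this] show ?thesis .
  qed
  then have h: "h \<in> borel_measurable borel"
    by (rule borel_measurable_right_continuous)
  obtain B where B: "\<And>t. t \<in> {0..T} \<Longrightarrow> norm (\<omega> t) \<le> B"
    using skorokhod_bounded[OF w] unfolding bounded_iff by blast
  have eq: "indicator {0..d} r *\<^sub>R \<omega> (min (s + r) T) = indicator {0..d} r *\<^sub>R h r" for r
    by (simp add: h_def indicator_def)
  have "norm (h r) \<le> B" if "0 \<le> r" for r
    using that s T B[of "min (s + r) T"] by (simp add: h_def)
  then show ?thesis
    unfolding set_integrable_def eq using h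
    by (intro integrableI_bounded_set[where A="{0..d}" and B=B])
      (auto simp: emeasure_lborel_Icc_eq split: split_indicator)
qed

lemma path_mass_component:
  assumes "0 < T" "\<omega> \<in> skorokhod_space T" "0 \<le> s"
  shows "path_mass T s d \<omega> $ i = (LINT r:{0..d}|lborel. \<omega> (min (s + r) T) $ i)"
  unfolding path_mass_def set_lebesgue_integral_def
  using integral_bounded_linear[OF bounded_linear_vec_nth
      path_integrable[OF assms, of d, unfolded set_integrable_def], of i]
  by simp

lemma path_mass_diff_le:
  fixes \<omega> \<omega>' :: "'d::finite path"
  assumes T: "0 < T" and w: "\<omega> \<in> skorokhod_space T" "\<omega>' \<in> skorokhod_space T" and s: "0 \<le> s" "0 \<le> s'" and d: "0 \<le> d"
    and le: "\<And>r. r \<in> {0..d} \<Longrightarrow> norm (\<omega> (min (s + r) T) - \<omega>' (min (s' + r) T)) \<le> e"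
  shows "norm (path_mass T s d \<omega> - path_mass T s' d \<omega>') \<le> e * d"
proof -
  note int = path_integrable[OF T w(1) s(1), of d] path_integrable[OF T w(2) s(2), of d]
  have "path_mass T s d \<omega> - path_mass T s' d \<omega>'
      = (LINT r:{0..d}|lborel. \<omega> (min (s + r) T) - \<omega>' (min (s' + r) T))"
    unfolding path_mass_def by (rule set_integral_diff(2)[OF int, symmetric])
  then show ?thesis
    using norm_set_integral_le[OF set_integral_diff(1)[OF int] le d] by simp
qed

lemma path_average_limit:
  fixes \<omega> :: "'d::finite path"
  assumes T: "0 < T" and w: "\<omega> \<in> skorokhod_space T" and s: "0 \<le> s"
  shows "((\<lambda>d. (1 / d) *\<^sub>R path_mass T s d \<omega>) \<longlongrightarrow> \<omega> (min s T)) (at_right 0)"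
proof (rule tendstoI)
  fix e :: real assume e: "e > 0"
  have "\<forall>\<^sub>F u in at_right s. dist (\<omega> (min u T)) (\<omega> (min s T)) < e / 2"
    using tendstoD[OF skorokhod_right_limit[OF w s], of "e / 2"] e by simp
  then obtain b where b: "b > s" "\<And>u. s < u \<Longrightarrow> u < b \<Longrightarrow> dist (\<omega> (min u T)) (\<omega> (min s T)) < e / 2"
    unfolding eventually_at_right[of s "s + 1", simplified] by blast
  have "dist ((1 / d) *\<^sub>R path_mass T s d \<omega>) (\<omega> (min s T)) < e" if d: "0 < d" "d < b - s" for d
  proof -
    note int = path_integrable[OF T w s, of d]
    have const: "set_integrable lborel {0..d} (\<lambda>r. \<omega> (min s T))"
      unfolding set_integrable_def
      by (intro integrable_scaleR_left) (simp add: integrable_indicator_iff emeasure_lborel_Icc_eq)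
    have "norm (LINT r:{0..d}|lborel. \<omega> (min (s + r) T) - \<omega> (min s T)) \<le> e / 2 * (d - 0)"
    proof (intro norm_set_integral_le set_integral_diff(1)[OF int const])
      fix r assume "r \<in> {0..d}"
      then show "norm (\<omega> (min (s + r) T) - \<omega> (min s T)) \<le> e / 2"
        using b(2)[of "s + r"] d e by (cases "r = 0") (auto simp: dist_norm intro: less_imp_le)
    qed (use d in simp)
    also have "(LINT r:{0..d}|lborel. \<omega> (min (s + r) T) - \<omega> (min s T)) = path_mass T s d \<omega> - d *\<^sub>R \<omega> (min s T)"
      unfolding set_integral_diff(2)[OF int const] path_mass_def
      using d by (simp add: set_lebesgue_integral_def)
    finally have "norm (path_mass T s d \<omega> - d *\<^sub>R \<omega> (min s T)) / d \<le> e / 2"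
      using d by (simp add: pos_divide_le_eq)
    moreover have "(1 / d) *\<^sub>R path_mass T s d \<omega> - \<omega> (min s T) = (1 / d) *\<^sub>R (path_mass T s d \<omega> - d *\<^sub>R \<omega> (min s T))"
      using d by (simp add: algebra_simps)
    ultimately have "norm ((1 / d) *\<^sub>R path_mass T s d \<omega> - \<omega> (min s T)) \<le> e / 2"
      using d by simp
    then show ?thesis using e by (simp add: dist_norm)
  qed
  then show "\<forall>\<^sub>F d in at_right 0. dist ((1 / d) *\<^sub>R path_mass T s d \<omega>) (\<omega> (min s T)) < e"
    using b(1) by (subst eventually_at_right[of 0 "b - s"])
      (simp, intro exI[of _ "b - s"], auto)
qed

lemma path_average_sequence:
  fixes \<omega> :: "'d::finite path"
  assumes T: "0 < T" and w: "\<omega> \<in> skorokhod_space T" and s: "0 \<le> s"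
  shows "(\<lambda>n. (1 / (1 / real (Suc n))) *\<^sub>R path_mass T s (1 / real (Suc n)) \<omega>) \<longlonglongrightarrow> \<omega> (min s T)"
proof -
  have "filterlim (\<lambda>n. 1 / real (Suc n)) (at_right 0) sequentially"
    using LIMSEQ_Suc[OF lim_1_over_n[where 'a=real]] by (simp add: filterlim_at)
  from filterlim_compose[OF path_average_limit[OF T w s] this] show ?thesis .
qed

lemma finite_variation_on_component:
  fixes g :: "real \<Rightarrow> real^'d::finite"
  assumes g: "finite_variation_on a b g"
  shows "finite_variation_on a b (\<lambda>t. g t $ i)"
proof -
  have "x \<le> total_variation a b g - total_variation a a g" if "x \<in> variation_sums a b (\<lambda>t. g t $ i)" for x
  proof (rule variation_sums_le_dominating[OF _ that])
    fix s t assume st: "a \<le> s" "s \<le> t" "t \<le> b"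
    have "norm (g t $ i - g s $ i) \<le> norm (g t - g s)"
      using component_le_norm_cart[of "g t - g s" i] by simp
    then show "norm (g t $ i - g s $ i) \<le> total_variation a t g - total_variation a s g"
      using total_variation_increment[OF g st] by simp
  qed
  then show ?thesis
    unfolding finite_variation_on_def by (meson bdd_aboveI)
qed

lemma vec_stieltjes_integral_trapezoid:
  fixes \<nu> :: "'d::finite path"
  assumes T: "0 < T" and w: "\<nu> \<in> skorokhod_space T" "finite_variation_on 0 T \<nu>" and s: "0 \<le> s" "0 \<le> d"
  shows "vec_stieltjes_integral T (\<lambda>t. axis i (max 0 (min d (s + d - t)))) \<nu> = path_mass T s d \<nu> $ i"
proof -
  have zero: "stieltjes_integral T (\<lambda>t. 0) g = 0" for g
    by (simp add: stieltjes_integral_def)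
  have "vec_stieltjes_integral T (\<lambda>t. axis i (max 0 (min d (s + d - t)))) \<nu>
      = stieltjes_integral T (\<lambda>t. axis i (max 0 (min d (s + d - t))) $ i) (\<lambda>t. \<nu> t $ i)"
    unfolding vec_stieltjes_integral_def
    by (rule sum.remove[of UNIV i, THEN trans]) (auto simp: axis_def zero intro!: sum.neutral)
  also have "\<dots> = path_mass T s d \<nu> $ i"
    unfolding path_mass_component[OF T w(1) s(1)] axis_nth
    by (intro stieltjes_integral_trapezoid T finite_variation_on_component w s tendsto_vec_nth)
      (use w in \<open>auto simp: skorokhod_space_def\<close>)
  finally show ?thesis .
qed

text \<open>
The window integral is the Stieltjes integral of a trapezoid up to the error of the approximating
paths of finite variation, and trapezoids are admissible test functions.
\<close>

lemma S_converges_path_mass: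
  fixes \<nu> :: "nat \<Rightarrow> 'd::finite path"
  assumes T: "0 < T" and conv: "S_converges T \<nu> \<mu>" and s: "0 \<le> s" "0 \<le> d"
  shows "(\<lambda>n. path_mass T s d (\<nu> n)) \<longlonglongrightarrow> path_mass T s d \<mu>"
proof (rule vec_tendstoI, rule LIMSEQ_I)
  fix i :: 'd and e :: real assume e: "e > 0"
  define \<epsilon> where "\<epsilon> = e / 3 / (d + 1)"
  have "\<epsilon> * (d + 1) = e / 3"
    unfolding \<epsilon>_def by (rule nonzero_eq_divide_eq[THEN iffD1, OF _ refl]) (use s in simp)
  moreover have "\<epsilon> > 0"
    using e s by (simp add: \<epsilon>_def)
  ultimately have \<epsilon>: "\<epsilon> > 0" "\<epsilon> * d < e / 3"
    by (simp_all add: distrib_left)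
  obtain \<nu>' \<mu>' where a': "\<forall>n. \<nu>' n \<in> skorokhod_space T \<and> finite_variation_on 0 T (\<nu>' n)"
    "\<mu>' \<in> skorokhod_space T" "finite_variation_on 0 T \<mu>'"
    "sup_norm T (\<lambda>t. \<mu> t - \<mu>' t) \<le> \<epsilon>" "\<forall>n. sup_norm T (\<lambda>t. \<nu> n t - \<nu>' n t) \<le> \<epsilon>"
    "\<forall>f. continuous_on {0..T} f \<and> bounded (f ` {0..T}) \<longrightarrow>
       (\<lambda>n. vec_stieltjes_integral T f (\<nu>' n)) \<longlonglongrightarrow> vec_stieltjes_integral T f \<mu>'"
    using conv \<epsilon>(1) unfolding S_converges_def by meson
  then have a: "\<nu>' n \<in> skorokhod_space T" "finite_variation_on 0 T (\<nu>' n)"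
    "sup_norm T (\<lambda>t. \<nu> n t - \<nu>' n t) \<le> \<epsilon>" for n
    by simp_all
  have b: "\<And>n. \<nu> n \<in> skorokhod_space T" "\<mu> \<in> skorokhod_space T"
    using conv by (auto simp: S_converges_def)
  have close: "\<bar>path_mass T s d \<omega> $ i - path_mass T s d \<omega>' $ i\<bar> < e / 3"
    if w: "\<omega> \<in> skorokhod_space T" "\<omega>' \<in> skorokhod_space T" "sup_norm T (\<lambda>t. \<omega> t - \<omega>' t) \<le> \<epsilon>" for \<omega> \<omega>'
  proof -
    have "bounded ((\<lambda>t. \<omega> t - \<omega>' t) ` {0..T})"
      using skorokhod_bounded[OF w(1)] skorokhod_bounded[OF w(2)] by (rule bounded_minus_comp)
    then have "norm (\<omega> t - \<omega>' t) \<le> \<epsilon>" if "t \<in> {0..T}" for t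
      using norm_le_sup_norm[of "\<lambda>t. \<omega> t - \<omega>' t" T t] w that by simp
    then have "norm (path_mass T s d \<omega> - path_mass T s d \<omega>') \<le> \<epsilon> * d"
      using T s by (intro path_mass_diff_le w) auto
    then show ?thesis
      using \<epsilon>(2) component_le_norm_cart[of "path_mass T s d \<omega> - path_mass T s d \<omega>'" i] by simp
  qed
  let ?f = "\<lambda>t. axis i (max 0 (min d (s + d - t))) :: real^'d"
  have "?f = (\<lambda>t. max 0 (min d (s + d - t)) *\<^sub>R axis i 1)"
    by (auto simp: vec_eq_iff axis_def)
  moreover have "continuous_on {0..T} (\<lambda>t. max 0 (min d (s + d - t)) *\<^sub>R (axis i 1 :: real^'d))"
    by (intro continuous_intros)
  ultimately have f: "continuous_on {0..T} ?f"
    by (simp only:)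
  then have "bounded (?f ` {0..T})"
    by (intro compact_imp_bounded compact_continuous_image) auto
  with f have "(\<lambda>n. vec_stieltjes_integral T ?f (\<nu>' n)) \<longlonglongrightarrow> vec_stieltjes_integral T ?f \<mu>'"
    using a'(6)[rule_format, of ?f] by simp
  then have "(\<lambda>n. path_mass T s d (\<nu>' n) $ i) \<longlonglongrightarrow> path_mass T s d \<mu>' $ i"
    by (simp only: vec_stieltjes_integral_trapezoid[OF T a(1) a(2) s] vec_stieltjes_integral_trapezoid[OF T a'(2,3) s])
  then obtain N where N: "\<And>n. n \<ge> N \<Longrightarrow> \<bar>path_mass T s d (\<nu>' n) $ i - path_mass T s d \<mu>' $ i\<bar> < e / 3"
    using LIMSEQ_D[of _ _ "e / 3"] e by fastforce
  have "norm (path_mass T s d (\<nu> n) $ i - path_mass T s d \<mu> $ i) < e" if "n \<ge> N" for n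
    using N[OF that] close[OF b(1) a(1) a(3), of n] close[OF b(2) a'(2) a'(4)]
    unfolding real_norm_def by linarith
  then show "\<exists>N. \<forall>n\<ge>N. norm (path_mass T s d (\<nu> n) $ i - path_mass T s d \<mu> $ i) < e"
    by blast
qed

section \<open>Paths with controlled size and oscillation\<close>

text \<open>
The path has \<open>m\<close> disjoint time pairs, each with an oscillation of more than \<open>e\<close>. The oscillations
are counted by pairs and not by consecutive increments, because pairs are stable under averaging.
\<close>

definition oscillates :: "real \<Rightarrow> real \<Rightarrow> nat \<Rightarrow> 'd::finite path \<Rightarrow> bool" where
  "oscillates T e m \<omega> \<longleftrightarrow> (\<exists>s t :: nat \<Rightarrow> real.
     (\<forall>k<m. 0 \<le> s k \<and> s k < t k \<and> t k \<le> T \<and> e < norm (\<omega> (t k) - \<omega> (s k))) \<and>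
     (\<forall>k. Suc k < m \<longrightarrow> t k < s (Suc k)))"

definition tame_paths :: "real \<Rightarrow> 'd::finite path set \<Rightarrow> real \<Rightarrow> (nat \<Rightarrow> nat) \<Rightarrow> 'd path set" where
  "tame_paths T \<Omega> R m = {\<omega> \<in> \<Omega>. (\<forall>t\<in>{0..T}. norm (\<omega> t) \<le> R) \<and>
     (\<forall>j. \<not> oscillates T (1 / real (Suc j)) (m j) \<omega>)}"

lemma oscillates_antimono:
  assumes "oscillates T e m' \<omega>" "m \<le> m'"
  shows "oscillates T e m \<omega>"
proof -
  obtain s t where "\<forall>k<m'. 0 \<le> s k \<and> s k < t k \<and> t k \<le> T \<and> e < norm (\<omega> (t k) - \<omega> (s k))"
    "\<forall>k. Suc k < m' \<longrightarrow> t k < s (Suc k)"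
    using assms(1) unfolding oscillates_def by blast
  with assms(2) show ?thesis
    unfolding oscillates_def by (intro exI[of _ s] exI[of _ t]) simp
qed

text \<open>
An oscillation of the limit over a pair \<open>s < t\<close> is inherited by averages over short windows to the
right of \<open>s\<close> and \<open>t\<close>, hence by the averages of the approximating paths, and a difference of
averages over windows of equal length cannot exceed all differences of values.
\<close>

lemma oscillates_S_limit:
  fixes \<nu> :: "nat \<Rightarrow> 'd::finite path"
  assumes T: "0 < T" and conv: "S_converges T \<nu> \<mu>" and osc: "oscillates T e m \<mu>"
  shows "\<exists>n. oscillates T e m (\<nu> n)"
proof -
  have sk: "\<nu> n \<in> skorokhod_space T" "\<mu> \<in> skorokhod_space T" for n
    using conv by (auto simp: S_converges_def)
  obtain s t where st: "\<And>k. k < m \<Longrightarrow> 0 \<le> s k" "\<And>k. k < m \<Longrightarrow> s k < t k" "\<And>k. k < m \<Longrightarrow> t k \<le> T"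
    "\<And>k. k < m \<Longrightarrow> e < norm (\<mu> (t k) - \<mu> (s k))" "\<And>k. Suc k < m \<Longrightarrow> t k < s (Suc k)"
    using osc unfolding oscillates_def by blast
  have t0: "0 \<le> t k" if "k < m" for k
    using st(1,2)[OF that] by simp
  have small: "\<forall>\<^sub>F d in at_right 0. c + d < c'" if "c < c'" for c c' :: real
    unfolding eventually_at_right[of 0 "c' - c", simplified, OF that]
    using that by (intro exI[of _ "c' - c"]) auto
  have pairs: "\<forall>\<^sub>F d in at_right 0. e * d < norm (path_mass T (t k) d \<mu> - path_mass T (s k) d \<mu>) \<and> s k + d < t k" if k: "k < m" for k
  proof -
    have "((\<lambda>d. norm ((1 / d) *\<^sub>R path_mass T (t k) d \<mu> - (1 / d) *\<^sub>R path_mass T (s k) d \<mu>))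
        \<longlongrightarrow> norm (\<mu> (min (t k) T) - \<mu> (min (s k) T))) (at_right 0)"
      using st(1)[OF k] t0[OF k] by (intro tendsto_intros path_average_limit T sk)
    moreover have "min (t k) T = t k" "min (s k) T = s k"
      using st(2,3)[OF k] by auto
    ultimately have "\<forall>\<^sub>F d in at_right 0. e < norm ((1 / d) *\<^sub>R path_mass T (t k) d \<mu> - (1 / d) *\<^sub>R path_mass T (s k) d \<mu>)"
      using st(4)[OF k] by (intro order_tendstoD) auto
    moreover have "\<forall>\<^sub>F d in at_right (0::real). d > 0"
      by (simp add: eventually_at_filter)
    moreover have "\<forall>\<^sub>F d in at_right 0. s k + d < t k"
      by (rule small[OF st(2)[OF k]])
    ultimately show ?thesis
    proof eventually_elim
      case (elim d)
      have "norm ((1 / d) *\<^sub>R path_mass T (t k) d \<mu> - (1 / d) *\<^sub>R path_mass T (s k) d \<mu>)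
          = norm (path_mass T (t k) d \<mu> - path_mass T (s k) d \<mu>) / d"
        using elim(2) by (simp flip: scaleR_right_diff_distrib)
      with elim show ?case by (simp add: pos_less_divide_eq)
    qed
  qed
  have gaps: "\<forall>\<^sub>F d in at_right 0. Suc k < m \<longrightarrow> t k + d < s (Suc k)" for k
    using small[OF st(5)[of k]] by (cases "Suc k < m") auto
  have "\<forall>\<^sub>F d in at_right 0. \<forall>k\<in>{..<m}. (e * d < norm (path_mass T (t k) d \<mu> - path_mass T (s k) d \<mu>) \<and>
      s k + d < t k) \<and> (Suc k < m \<longrightarrow> t k + d < s (Suc k))"
    by (intro eventually_ball_finite ballI eventually_conj[OF pairs gaps]) auto
  moreover have "\<forall>\<^sub>F d in at_right (0::real). d > 0"
    by (simp add: eventually_at_filter)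
  ultimately have "\<forall>\<^sub>F d in at_right 0. d > 0 \<and> (\<forall>k\<in>{..<m}. (e * d < norm (path_mass T (t k) d \<mu> - path_mass T (s k) d \<mu>) \<and>
      s k + d < t k) \<and> (Suc k < m \<longrightarrow> t k + d < s (Suc k)))"
    by (rule eventually_conj[rotated])
  from eventually_happens'[OF _ this] obtain d where d: "d > 0"
    "\<And>k. k < m \<Longrightarrow> e * d < norm (path_mass T (t k) d \<mu> - path_mass T (s k) d \<mu>)"
    "\<And>k. k < m \<Longrightarrow> s k + d < t k" "\<And>k. Suc k < m \<Longrightarrow> t k + d < s (Suc k)"
    by (auto simp: trivial_limit_at_right_real dest: Suc_lessD)
  have "\<forall>\<^sub>F n in sequentially. \<forall>k\<in>{..<m}. e * d < norm (path_mass T (t k) d (\<nu> n) - path_mass T (s k) d (\<nu> n))"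
  proof (intro eventually_ball_finite ballI)
    fix k assume "k \<in> {..<m}"
    then have k: "k < m" by simp
    have "(\<lambda>n. norm (path_mass T (t k) d (\<nu> n) - path_mass T (s k) d (\<nu> n)))
        \<longlonglongrightarrow> norm (path_mass T (t k) d \<mu> - path_mass T (s k) d \<mu>)"
      using st(1)[OF k] t0[OF k] d(1) by (intro tendsto_intros S_converges_path_mass T conv) auto
    then show "\<forall>\<^sub>F n in sequentially. e * d < norm (path_mass T (t k) d (\<nu> n) - path_mass T (s k) d (\<nu> n))"
      by (rule order_tendstoD(1)[OF _ d(2)[OF k]])
  qed simp
  then obtain n where n: "\<And>k. k < m \<Longrightarrow> e * d < norm (path_mass T (t k) d (\<nu> n) - path_mass T (s k) d (\<nu> n))"
    unfolding eventually_sequentially by auto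
  \<comment> \<open>The same shift \<open>r\<close> serves both ends of a pair, so the shifted pair keeps its order.\<close>
  have "\<exists>r. r \<in> {0..d} \<and> e < norm (\<nu> n (min (t k + r) T) - \<nu> n (min (s k + r) T))" if k: "k < m" for k
  proof (rule ccontr)
    assume "\<not> ?thesis"
    then have "norm (path_mass T (t k) d (\<nu> n) - path_mass T (s k) d (\<nu> n)) \<le> e * d"
      using st(1)[OF k] t0[OF k] d(1) by (intro path_mass_diff_le T sk) (auto simp: not_less)
    then show False using n[OF k] by simp
  qed
  then obtain r where r: "\<And>k. k < m \<Longrightarrow> r k \<in> {0..d}"
    "\<And>k. k < m \<Longrightarrow> e < norm (\<nu> n (min (t k + r k) T) - \<nu> n (min (s k + r k) T))"
    by metis
  define s' t' where "s' k = s k + r k" and "t' k = min (t k + r k) T" for k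
  have shifted: "0 \<le> s' k \<and> s' k < t' k \<and> t' k \<le> T \<and> e < norm (\<nu> n (t' k) - \<nu> n (s' k))" if k: "k < m" for k
  proof -
    have "s k + r k < T" using r(1)[OF k] d(3)[OF k] st(3)[OF k] by auto
    then show ?thesis
      using r[OF k] st(1,2)[OF k] by (auto simp: s'_def t'_def min_absorb1)
  qed
  have "t' k < s' (Suc k)" if k: "Suc k < m" for k
    using r(1)[of k] r(1)[OF k] d(4)[OF k] k by (auto simp: s'_def t'_def)
  with shifted have "oscillates T e m (\<nu> n)"
    unfolding oscillates_def by (intro exI[of _ s'] exI[of _ t']) simp
  then show ?thesis ..
qed

lemma bound_S_limit:
  fixes \<nu> :: "nat \<Rightarrow> 'd::finite path"
  assumes T: "0 < T" and conv: "S_converges T \<nu> \<mu>"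
    and le: "\<And>n t. t \<in> {0..T} \<Longrightarrow> norm (\<nu> n t) \<le> R" and t: "t \<in> {0..T}"
  shows "norm (\<mu> t) \<le> R"
proof -
  have sk: "\<nu> n \<in> skorokhod_space T" "\<mu> \<in> skorokhod_space T" for n
    using conv by (auto simp: S_converges_def)
  have "norm (path_mass T t d \<mu>) \<le> R * d" if d: "d > 0" for d
  proof (rule LIMSEQ_le_const2)
    show "(\<lambda>n. norm (path_mass T t d (\<nu> n))) \<longlonglongrightarrow> norm (path_mass T t d \<mu>)"
      using t d by (intro tendsto_norm S_converges_path_mass T conv) auto
    have "norm (path_mass T t d (\<nu> n)) \<le> R * (d - 0)" for n
      unfolding path_mass_def using t d T
      by (intro norm_set_integral_le path_integrable sk le) auto
    then show "\<exists>N. \<forall>n\<ge>N. norm (path_mass T t d (\<nu> n)) \<le> R * d"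
      by simp
  qed
  then have "\<forall>\<^sub>F d in at_right 0. norm ((1 / d) *\<^sub>R path_mass T t d \<mu>) \<le> R"
    by (auto simp: eventually_at_filter field_simps)
  moreover have "((\<lambda>d. norm ((1 / d) *\<^sub>R path_mass T t d \<mu>)) \<longlongrightarrow> norm (\<mu> (min t T))) (at_right 0)"
    using t by (intro tendsto_norm path_average_limit T sk) auto
  ultimately have "norm (\<mu> (min t T)) \<le> R"
    by (intro tendsto_upperbound) (auto simp: trivial_limit_at_right_real)
  then show ?thesis using t by simp
qed

lemma tame_paths_S_closed:
  fixes \<nu> :: "nat \<Rightarrow> 'd::finite path"
  assumes T: "0 < T" and \<Omega>: "S_closed T \<Omega>" and conv: "S_converges T \<nu> \<mu>" and \<nu>: "\<And>n. \<nu> n \<in> tame_paths T \<Omega> R m"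
  shows "\<mu> \<in> tame_paths T \<Omega> R m"
proof -
  have "\<mu> \<in> \<Omega>"
    using \<Omega> conv \<nu> unfolding S_closed_def tame_paths_def by blast
  then show ?thesis
    using bound_S_limit[OF T conv, of R] oscillates_S_limit[OF T conv] \<nu> unfolding tame_paths_def by blast
qed

section \<open>Step approximations\<close>

text \<open>
Start a new step whenever the path has moved by more than \<open>e\<close> from its value at the start of the
current step. The infimum of the times of such a move need not be such a time itself, but the
following step has positive length by right-continuity and so contains one. Every second step
therefore contributes a disjoint pair, so \<open>T\<close> is reached after \<open>2 * m\<close> steps.
\<close>

lemma greedy_steps:
  fixes \<omega> :: "'d::finite path"
  assumes T: "0 < T" and w: "\<omega> \<in> skorokhod_space T" and e: "0 < e" and osc: "\<not> oscillates T e m \<omega>"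
  shows "\<exists>\<tau> :: nat \<Rightarrow> real. mono \<tau> \<and> \<tau> 0 = 0 \<and> (\<forall>k. \<tau> k \<in> {0..T}) \<and> \<tau> (2 * m) = T \<and>
    (\<forall>k t. \<tau> k \<le> t \<and> t < \<tau> (Suc k) \<longrightarrow> norm (\<omega> t - \<omega> (\<tau> k)) \<le> e)"
proof -
  define A where "A t = {u. t < u \<and> u \<le> T \<and> e < norm (\<omega> u - \<omega> t)}" for t
  define nxt where "nxt t = Inf (insert T (A t))" for t
  define \<tau> where "\<tau> k = (nxt ^^ k) 0" for k
  have bdd: "bdd_below (insert T (A t))" for t
    by (rule bdd_belowI[of _ "min t T"]) (auto simp: A_def)
  have nxt: "t \<le> nxt t" "nxt t \<le> T" if "t \<le> T" for t
    unfolding nxt_def using that by (auto intro!: cInf_greatest cInf_lower bdd simp: A_def)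
  have in_A: "nxt t \<le> u" if "u \<in> A t" for t u
    unfolding nxt_def using that by (intro cInf_lower bdd) auto
  have less: "t < nxt t" if t: "0 \<le> t" "t < T" for t
  proof -
    have "(\<omega> \<longlongrightarrow> \<omega> t) (at_right t)"
      using w t by (simp add: skorokhod_space_def)
    then have "\<forall>\<^sub>F u in at_right t. dist (\<omega> u) (\<omega> t) < e"
      using e by (rule tendstoD)
    then obtain b where b: "b > t" "\<And>u. t < u \<Longrightarrow> u < b \<Longrightarrow> norm (\<omega> u - \<omega> t) < e"
      unfolding eventually_at_right[OF t(2)] dist_norm by blast
    have "min b T \<le> nxt t"
      unfolding nxt_def
    proof (rule cInf_greatest)
      fix u assume "u \<in> insert T (A t)"
      then show "min b T \<le> u"
        using b(2)[of u] by (cases "u < b") (auto simp: A_def)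
    qed simp
    then show ?thesis using b(1) t by simp
  qed
  have \<tau>0: "\<tau> 0 = 0" and \<tau>S: "\<tau> (Suc k) = nxt (\<tau> k)" for k
    by (simp_all add: \<tau>_def)
  have range: "\<tau> k \<in> {0..T}" for k
  proof (induction k)
    case 0 then show ?case using T by (simp add: \<tau>0)
  next
    case (Suc k) then show ?case using nxt[of "\<tau> k"] by (auto simp: \<tau>S)
  qed
  have mono: "mono \<tau>"
    unfolding mono_iff_le_Suc using nxt(1) range by (auto simp: \<tau>S)
  have "\<tau> (2 * m) = T"
  proof (rule ccontr)
    assume "\<tau> (2 * m) \<noteq> T"
    then have "\<tau> (2 * m) < T" using range[of "2 * m"] by auto
    then have below: "\<tau> k < T" if "k \<le> 2 * m" for k
      using monoD[OF mono that] by simp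
    \<comment> \<open>The partner of \<open>\<tau> (2 * k)\<close> lies in the following step, before the next pair starts.\<close>
    have "\<exists>u. u \<in> A (\<tau> (2 * k)) \<and> \<tau> (Suc (2 * k)) \<le> u \<and> u < \<tau> (2 * Suc k)" if k: "k < m" for k
    proof -
      have "nxt (\<tau> (2 * k)) < \<tau> (2 * Suc k)"
        using less[of "\<tau> (Suc (2 * k))"] range[of "Suc (2 * k)"] below[of "Suc (2 * k)"] k by (simp add: \<tau>S)
      then obtain u where u: "u \<in> insert T (A (\<tau> (2 * k)))" "u < \<tau> (2 * Suc k)"
        unfolding nxt_def using cInf_lessD[of "insert T (A (\<tau> (2 * k)))" "\<tau> (2 * Suc k)"] by auto
      then have "u \<in> A (\<tau> (2 * k))"
        using range[of "2 * Suc k"] by auto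
      then show ?thesis
        using in_A[of u "\<tau> (2 * k)"] u(2) by (auto simp: \<tau>S)
    qed
    then obtain t where t: "\<And>k. k < m \<Longrightarrow> t k \<in> A (\<tau> (2 * k))" "\<And>k. k < m \<Longrightarrow> t k < \<tau> (2 * Suc k)"
      by metis
    have pair: "0 \<le> \<tau> (2 * k) \<and> \<tau> (2 * k) < t k \<and> t k \<le> T \<and> e < norm (\<omega> (t k) - \<omega> (\<tau> (2 * k)))"
      if "k < m" for k
      using t(1)[OF that] range[of "2 * k"] by (simp add: A_def)
    have "oscillates T e m \<omega>"
      unfolding oscillates_def using pair t(2) by (intro exI[of _ "\<lambda>k. \<tau> (2 * k)"] exI[of _ t]) simp
    with osc show False by simp
  qed
  moreover have "norm (\<omega> t - \<omega> (\<tau> k)) \<le> e" if t: "\<tau> k \<le> t" "t < \<tau> (Suc k)" for k t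
  proof (cases "t = \<tau> k")
    case False
    then have "t \<notin> A (\<tau> k)"
      using in_A[of t "\<tau> k"] t by (auto simp: \<tau>S)
    then show ?thesis
      using t False range[of "Suc k"] by (auto simp: A_def)
  qed (use e in simp)
  ultimately show ?thesis
    using mono \<tau>0 range by blast
qed

definition step_path :: "real \<Rightarrow> nat \<Rightarrow> (nat \<Rightarrow> real) \<Rightarrow> (nat \<Rightarrow> real^'d::finite) \<Rightarrow> 'd path" where
  "step_path T M \<tau> v = restrict (\<lambda>t. v 0 + (\<Sum>k<M. if \<tau> (Suc k) \<le> t then v (Suc k) - v k else 0)) {0..T}"

text \<open>
The sum telescopes, so a step path takes only the values \<open>v k\<close>; in particular it inherits their
signs.
\<close>

lemma step_path_value:
  assumes \<tau>: "mono \<tau>" "\<tau> 0 = 0" and t: "t \<in> {0..T}"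
  shows "\<exists>k\<le>M. step_path T M \<tau> v t = v k \<and> \<tau> k \<le> t \<and> (k < M \<longrightarrow> t < \<tau> (Suc k))"
proof (induction M)
  case 0
  then show ?case using t \<tau> by (simp add: step_path_def)
next
  case (Suc M)
  show ?case
  proof (cases "\<tau> (Suc M) \<le> t")
    case True
    have "\<tau> (Suc k) \<le> t" if "k < Suc M" for k
      using True monoD[OF \<tau>(1), of "Suc k" "Suc M"] that by simp
    then have "(\<Sum>k<Suc M. if \<tau> (Suc k) \<le> t then v (Suc k) - v k else 0) = (\<Sum>k<Suc M. v (Suc k) - v k)"
      by (intro sum.cong) auto
    then have "step_path T (Suc M) \<tau> v t = v (Suc M)"
      using t unfolding step_path_def sum_lessThan_telescope by simp
    with True show ?thesis by blast
  next
    case False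
    then have "step_path T (Suc M) \<tau> v t = step_path T M \<tau> v t"
      using t by (simp add: step_path_def)
    moreover obtain k where "k \<le> M" "step_path T M \<tau> v t = v k" "\<tau> k \<le> t" "k < M \<longrightarrow> t < \<tau> (Suc k)"
      using Suc by blast
    ultimately show ?thesis
      using False by (intro exI[of _ k]) (auto simp: not_le le_less)
  qed
qed

lemma step_path_near:
  assumes \<tau>: "mono \<tau>" "\<tau> 0 = 0" "\<tau> M = T" and t: "t \<in> {0..T}" and e: "0 \<le> e"
    and near: "\<And>k t. \<tau> k \<le> t \<Longrightarrow> t < \<tau> (Suc k) \<Longrightarrow> norm (\<omega> t - \<omega> (\<tau> k)) \<le> e"
  shows "norm (\<omega> t - step_path T M \<tau> (\<lambda>k. \<omega> (\<tau> k)) t) \<le> e"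
proof -
  obtain k where k: "k \<le> M" "step_path T M \<tau> (\<lambda>k. \<omega> (\<tau> k)) t = \<omega> (\<tau> k)" "\<tau> k \<le> t" "k < M \<longrightarrow> t < \<tau> (Suc k)"
    using step_path_value[OF \<tau>(1,2) t] by blast
  show ?thesis
  proof (cases "k < M")
    case False
    then have "t = \<tau> k" using k t \<tau> by simp
    then show ?thesis using k e by simp
  qed (use k near in simp)
qed

lemma restrict_tendsto_right:
  fixes t T :: real
  assumes "(g \<longlongrightarrow> l) (at_right t)" "0 \<le> t" "t < T"
  shows "(restrict g {0..T} \<longlongrightarrow> l) (at_right t)"
proof (rule Lim_transform_eventually[OF assms(1)])
  show "\<forall>\<^sub>F u in at_right t. g u = restrict g {0..T} u"
    unfolding eventually_at_right[OF assms(3)] using assms by (intro exI[of _ T]) auto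
qed

lemma restrict_tendsto_left:
  fixes t T :: real
  assumes "(g \<longlongrightarrow> l) (at_left t)" "0 < t" "t \<le> T"
  shows "(restrict g {0..T} \<longlongrightarrow> l) (at_left t)"
proof (rule Lim_transform_eventually[OF assms(1)])
  show "\<forall>\<^sub>F u in at_left t. g u = restrict g {0..T} u"
    unfolding eventually_at_left[OF assms(2)] using assms by (intro exI[of _ 0]) auto
qed

lemma step_path_skorokhod:
  assumes \<tau>: "mono \<tau>" "\<tau> 0 = 0" and v: "\<And>k i. 0 \<le> v k $ i"
  shows "step_path T M \<tau> v \<in> skorokhod_space T"
  unfolding skorokhod_space_def mem_Collect_eq
proof (intro conjI ballI allI)
  show "step_path T M \<tau> v \<in> extensional {0..T}"
    by (simp add: step_path_def)
  show "0 \<le> step_path T M \<tau> v t $ i" if "t \<in> {0..T}" for t i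
    using step_path_value[OF \<tau> that, of M v] v by metis
next
  fix t assume t: "t \<in> {0..<T}"
  have "((\<lambda>u. if c \<le> u then a else 0) \<longlongrightarrow> (if c \<le> t then a else 0)) (at_right t)" for c and a :: "real^'d"
  proof (rule Lim_transform_eventually[OF tendsto_const])
    show "\<forall>\<^sub>F u in at_right t. (if c \<le> t then a else 0) = (if c \<le> u then a else 0)"
    proof (cases "c \<le> t")
      case False
      then show ?thesis
        unfolding eventually_at_right[of t c, OF False[unfolded not_le]] by (intro exI[of _ c]) auto
    next
      case True then show ?thesis
        unfolding eventually_at_right[of t "t + 1", simplified] by (intro exI[of _ "t + 1"]) auto
    qed
  qed
  then have "((\<lambda>t. v 0 + (\<Sum>k<M. if \<tau> (Suc k) \<le> t then v (Suc k) - v k else 0)) \<longlongrightarrow>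
      v 0 + (\<Sum>k<M. if \<tau> (Suc k) \<le> t then v (Suc k) - v k else 0)) (at_right t)"
    by (intro tendsto_intros)
  then show "(step_path T M \<tau> v \<longlongrightarrow> step_path T M \<tau> v t) (at_right t)"
    using t restrict_tendsto_right[of _ _ t T] by (auto simp: step_path_def)
next
  fix t assume t: "t \<in> {0<..T}"
  have "((\<lambda>u. if c \<le> u then a else 0) \<longlongrightarrow> (if c < t then a else 0)) (at_left t)" for c and a :: "real^'d"
  proof (rule Lim_transform_eventually[OF tendsto_const])
    show "\<forall>\<^sub>F u in at_left t. (if c < t then a else 0) = (if c \<le> u then a else 0)"
    proof (cases "c < t")
      case True
      then show ?thesis
        unfolding eventually_at_left[OF True] by (intro exI[of _ c]) auto
    next
      case False then show ?thesis
        unfolding eventually_at_left[of "t - 1" t, simplified] by (intro exI[of _ "t - 1"]) auto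
    qed
  qed
  then have "((\<lambda>t. v 0 + (\<Sum>k<M. if \<tau> (Suc k) \<le> t then v (Suc k) - v k else 0)) \<longlongrightarrow>
      v 0 + (\<Sum>k<M. if \<tau> (Suc k) < t then v (Suc k) - v k else 0)) (at_left t)"
    by (intro tendsto_intros)
  then show "\<exists>l. (step_path T M \<tau> v \<longlongrightarrow> l) (at_left t)"
    using t restrict_tendsto_left[of _ _ t T] by (auto simp: step_path_def)
qed

lemma step_path_finite_variation: "finite_variation_on 0 T (step_path T M \<tau> v)"
proof -
  define W where "W t = (\<Sum>k<M. if \<tau> (Suc k) \<le> t then norm (v (Suc k) - v k) else 0)" for t
  have "x \<le> W T - W 0" if "x \<in> variation_sums 0 T (step_path T M \<tau> v)" for x
  proof (rule variation_sums_le_dominating[OF _ that])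
    fix s t assume st: "0 \<le> s" "s \<le> t" "t \<le> T"
    have "step_path T M \<tau> v t - step_path T M \<tau> v s
        = (\<Sum>k<M. (if \<tau> (Suc k) \<le> t then v (Suc k) - v k else 0) - (if \<tau> (Suc k) \<le> s then v (Suc k) - v k else 0))"
      using st by (simp add: step_path_def sum_subtractf)
    also have "norm \<dots> \<le> (\<Sum>k<M. (if \<tau> (Suc k) \<le> t then norm (v (Suc k) - v k) else 0)
        - (if \<tau> (Suc k) \<le> s then norm (v (Suc k) - v k) else 0))"
      using st by (intro sum_norm_le) auto
    also have "\<dots> = W t - W s"
      by (simp add: W_def sum_subtractf)
    finally show "norm (step_path T M \<tau> v t - step_path T M \<tau> v s) \<le> W t - W s" .
  qed
  then show ?thesis
    unfolding finite_variation_on_def by (meson bdd_aboveI)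
qed

lemma Riemann_sum_cong:
  assumes "0 \<le> T" "\<And>t. t \<in> {0..T} \<Longrightarrow> g t = g' t"
  shows "Riemann_sum T f g n = Riemann_sum T f g' n"
  unfolding Riemann_sum_def
  using assms grid_mem[OF assms(1), of _ n] by (intro arg_cong2[where f="(+)"] sum.cong) auto

lemma Riemann_sum_linear:
  "Riemann_sum T f (\<lambda>t. a + (\<Sum>j\<in>J. c j * g j t)) n = f 0 * a + (\<Sum>j\<in>J. c j * Riemann_sum T f (g j) n)"
proof -
  have "(\<Sum>k<Suc n. f (grid T n k) * ((a + (\<Sum>j\<in>J. c j * g j (grid T n (Suc k)))) - (a + (\<Sum>j\<in>J. c j * g j (grid T n k)))))
      = (\<Sum>k<Suc n. \<Sum>j\<in>J. c j * (f (grid T n k) * (g j (grid T n (Suc k)) - g j (grid T n k))))"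
    by (intro sum.cong refl) (simp add: sum_subtractf[symmetric] sum_distrib_left algebra_simps)
  also have "\<dots> = (\<Sum>j\<in>J. \<Sum>k<Suc n. c j * (f (grid T n k) * (g j (grid T n (Suc k)) - g j (grid T n k))))"
    by (rule sum.swap)
  finally show ?thesis
    unfolding Riemann_sum_def
    by (simp add: sum_distrib_left sum.distrib algebra_simps del: sum.lessThan_Suc)
qed

text \<open>
The increments of the jump function sum up to \<open>1\<close>, apart from a jump at \<open>0\<close>, and they sit within
one mesh of \<open>\<tau>\<close>.
\<close>

lemma Riemann_sum_jump:
  assumes T: "0 < T" and f: "continuous_on {0..T} f" and \<tau>: "\<tau> \<in> {0..T}"
  shows "Riemann_sum T f (\<lambda>t. if \<tau> \<le> t then 1 else 0) \<longlonglongrightarrow> f \<tau>"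
proof (rule LIMSEQ_I)
  fix e :: real assume e: "e > 0"
  have "\<exists>d>0. \<forall>t\<in>{0..T}. dist t \<tau> < d \<longrightarrow> dist (f t) (f \<tau>) < e / 2"
    using f \<tau> e unfolding continuous_on_iff by (meson half_gt_zero)
  then obtain d where d: "d > 0" "\<And>t. t \<in> {0..T} \<Longrightarrow> dist t \<tau> < d \<Longrightarrow> dist (f t) (f \<tau>) < e / 2"
    by blast
  obtain N :: nat where N: "T / d < N" using reals_Archimedean2 by blast
  have "norm (Riemann_sum T f (\<lambda>t. if \<tau> \<le> t then 1 else 0) n - f \<tau>) < e" if n: "n \<ge> N" for n
  proof -
    define h :: "nat \<Rightarrow> real" where "h k = (if \<tau> \<le> grid T n k then 1 else 0)" for k
    have h_end: "h (Suc n) = 1" using \<tau> by (simp add: h_def)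
    have "f \<tau> = f \<tau> * h 0 + f \<tau> * (\<Sum>k<Suc n. h (Suc k) - h k)"
      unfolding sum_lessThan_telescope h_end by (simp add: algebra_simps)
    moreover have "Riemann_sum T f (\<lambda>t. if \<tau> \<le> t then 1 else 0) n
        = f 0 * h 0 + (\<Sum>k<Suc n. f (grid T n k) * (h (Suc k) - h k))"
      by (simp add: Riemann_sum_def h_def)
    moreover have "(\<Sum>k<Suc n. (f (grid T n k) - f \<tau>) * (h (Suc k) - h k))
        = (\<Sum>k<Suc n. f (grid T n k) * (h (Suc k) - h k)) - f \<tau> * (\<Sum>k<Suc n. h (Suc k) - h k)"
      by (simp only: left_diff_distrib sum_distrib_left sum_subtractf[symmetric])
    ultimately have "Riemann_sum T f (\<lambda>t. if \<tau> \<le> t then 1 else 0) n - f \<tau>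
        = (f 0 - f \<tau>) * h 0 + (\<Sum>k<Suc n. (f (grid T n k) - f \<tau>) * (h (Suc k) - h k))"
      unfolding left_diff_distrib[of "f 0"] by linarith
    also have "(f 0 - f \<tau>) * h 0 = 0"
      using \<tau> by (auto simp: h_def)
    also have "norm (0 + (\<Sum>k<Suc n. (f (grid T n k) - f \<tau>) * (h (Suc k) - h k))) \<le> (\<Sum>k<Suc n. e / 2 * (h (Suc k) - h k))"
      unfolding add_0
    proof (rule sum_norm_le)
      fix k assume "k \<in> {..<Suc n}"
      then have mem: "grid T n k \<in> {0..T}" using grid_mem[of T k n] T by simp
      have step: "grid T n k \<le> grid T n (Suc k)" "grid T n (Suc k) - grid T n k < d"
        using grid_mono[of T k "Suc k" n] grid_step_less[OF T d(1) N n, of k] T by auto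
      show "norm ((f (grid T n k) - f \<tau>) * (h (Suc k) - h k)) \<le> e / 2 * (h (Suc k) - h k)"
      proof (cases "grid T n k < \<tau> \<and> \<tau> \<le> grid T n (Suc k)")
        case True
        then have "dist (f (grid T n k)) (f \<tau>) < e / 2"
          using step by (intro d mem) (auto simp: dist_real_def)
        then show ?thesis using True by (simp add: h_def dist_real_def)
      qed (use step in \<open>auto simp: h_def\<close>)
    qed
    also have "\<dots> = e / 2 * (h (Suc n) - h 0)"
      unfolding sum_distrib_left[symmetric] sum_lessThan_telescope ..
    also have "\<dots> < e" using e by (simp add: h_def)
    finally show ?thesis .
  qed
  then show "\<exists>N. \<forall>n\<ge>N. norm (Riemann_sum T f (\<lambda>t. if \<tau> \<le> t then 1 else 0) n - f \<tau>) < e"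
    by blast
qed

lemma vec_stieltjes_integral_step_path:
  fixes v :: "nat \<Rightarrow> real^'d::finite"
  assumes T: "0 < T" and \<tau>: "mono \<tau>" "\<tau> 0 = 0" "\<And>k. \<tau> k \<in> {0..T}" and v: "\<And>k i. 0 \<le> v k $ i"
    and f: "continuous_on {0..T} f"
  shows "vec_stieltjes_integral T f (step_path T M \<tau> v) = f 0 \<bullet> v 0 + (\<Sum>k<M. f (\<tau> (Suc k)) \<bullet> (v (Suc k) - v k))"
proof -
  note sk = step_path_skorokhod[OF \<tau>(1,2) v, where T=T and M=M]
  have "stieltjes_integral T (\<lambda>t. f t $ i) (\<lambda>t. step_path T M \<tau> v t $ i)
      = f 0 $ i * v 0 $ i + (\<Sum>k<M. (v (Suc k) $ i - v k $ i) * f (\<tau> (Suc k)) $ i)" for i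
  proof (rule LIMSEQ_unique)
    have fi: "continuous_on {0..T} (\<lambda>t. f t $ i)"
      by (intro continuous_intros f)
    show "Riemann_sum T (\<lambda>t. f t $ i) (\<lambda>t. step_path T M \<tau> v t $ i) \<longlonglongrightarrow>
        stieltjes_integral T (\<lambda>t. f t $ i) (\<lambda>t. step_path T M \<tau> v t $ i)"
      by (rule Riemann_sums_stieltjes_integral[OF T finite_variation_on_component[OF step_path_finite_variation] _ fi])
        (use sk in \<open>auto simp: skorokhod_space_def intro!: tendsto_vec_nth\<close>)
    have eq: "Riemann_sum T (\<lambda>t. f t $ i) (\<lambda>t. step_path T M \<tau> v t $ i) n
        = Riemann_sum T (\<lambda>t. f t $ i) (\<lambda>t. v 0 $ i + (\<Sum>k<M. (v (Suc k) $ i - v k $ i) * (if \<tau> (Suc k) \<le> t then 1 else 0))) n" for n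
      using T by (intro Riemann_sum_cong) (auto simp: step_path_def intro!: sum.cong)
    have "(\<lambda>n. Riemann_sum T (\<lambda>t. f t $ i) (\<lambda>t. v 0 $ i + (\<Sum>k<M. (v (Suc k) $ i - v k $ i) * (if \<tau> (Suc k) \<le> t then 1 else 0))) n)
        \<longlonglongrightarrow> f 0 $ i * v 0 $ i + (\<Sum>k<M. (v (Suc k) $ i - v k $ i) * f (\<tau> (Suc k)) $ i)"
      unfolding Riemann_sum_linear by (intro tendsto_intros Riemann_sum_jump T fi \<tau>)
    then show "Riemann_sum T (\<lambda>t. f t $ i) (\<lambda>t. step_path T M \<tau> v t $ i) \<longlonglongrightarrow>
        f 0 $ i * v 0 $ i + (\<Sum>k<M. (v (Suc k) $ i - v k $ i) * f (\<tau> (Suc k)) $ i)"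
      unfolding eq[symmetric] .
  qed
  then have "vec_stieltjes_integral T f (step_path T M \<tau> v)
      = (\<Sum>i\<in>UNIV. f 0 $ i * v 0 $ i) + (\<Sum>i\<in>UNIV. \<Sum>k<M. (v (Suc k) $ i - v k $ i) * f (\<tau> (Suc k)) $ i)"
    by (simp add: vec_stieltjes_integral_def sum.distrib)
  also have "(\<Sum>i\<in>UNIV. \<Sum>k<M. (v (Suc k) $ i - v k $ i) * f (\<tau> (Suc k)) $ i)
      = (\<Sum>k<M. \<Sum>i\<in>UNIV. (v (Suc k) $ i - v k $ i) * f (\<tau> (Suc k)) $ i)"
    by (rule sum.swap)
  finally show ?thesis
    by (simp add: inner_vec_def mult.commute)
qed

text \<open>
Step paths converge pointwise with their data except at the limiting jump times. The final time is
no exception, because jump times do not exceed it.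
\<close>

lemma step_path_tendsto:
  fixes v :: "nat \<Rightarrow> nat \<Rightarrow> real^'d::finite"
  assumes \<tau>: "\<And>k. (\<lambda>n. \<tau> n k) \<longlonglongrightarrow> \<tau>' k" "\<And>n k. \<tau> n k \<le> T" and v: "\<And>k. (\<lambda>n. v n k) \<longlonglongrightarrow> v' k"
    and t: "t \<in> {0..T}" "t = T \<or> (\<forall>k\<le>M. \<tau>' k \<noteq> t)"
  shows "(\<lambda>n. step_path T M (\<tau> n) (v n) t) \<longlonglongrightarrow> step_path T M \<tau>' v' t"
proof -
  have "(\<lambda>n. if \<tau> n (Suc k) \<le> t then v n (Suc k) - v n k else 0) \<longlonglongrightarrow> (if \<tau>' (Suc k) \<le> t then v' (Suc k) - v' k else 0)"
    if k: "k < M" for k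
  proof -
    have lim: "(\<lambda>n. v n (Suc k) - v n k) \<longlonglongrightarrow> v' (Suc k) - v' k"
      by (intro tendsto_intros v)
    have \<tau>'T: "\<tau>' (Suc k) \<le> T"
      using \<tau> by (intro LIMSEQ_le_const2[OF \<tau>(1)]) auto
    consider "t = T" | "\<tau>' (Suc k) < t" | "t < \<tau>' (Suc k)"
      using t(2) k by (metis Suc_leI linorder_neqE_linordered_idom)
    then show ?thesis
    proof cases
      case 1 then show ?thesis using lim \<tau>(2) \<tau>'T by simp
    next
      case 2
      have "\<forall>\<^sub>F n in sequentially. v n (Suc k) - v n k = (if \<tau> n (Suc k) \<le> t then v n (Suc k) - v n k else 0)"
        using order_tendstoD(2)[OF \<tau>(1) 2] by eventually_elim simp
      from Lim_transform_eventually[OF lim this] show ?thesis using 2 by simp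
    next
      case 3
      have "\<forall>\<^sub>F n in sequentially. 0 = (if \<tau> n (Suc k) \<le> t then v n (Suc k) - v n k else 0)"
        using order_tendstoD(1)[OF \<tau>(1) 3] by eventually_elim simp
      from Lim_transform_eventually[OF tendsto_const this] show ?thesis using 3 by simp
    qed
  qed
  then show ?thesis
    using t(1) unfolding step_path_def by (simp, intro tendsto_intros v) auto
qed

lemma vec_stieltjes_integral_step_path_tendsto:
  fixes v :: "nat \<Rightarrow> nat \<Rightarrow> real^'d::finite"
  assumes T: "0 < T" and \<tau>: "\<And>k. (\<lambda>n. \<tau> n k) \<longlonglongrightarrow> \<tau>' k" "\<And>n. mono (\<tau> n)" "\<And>n. \<tau> n 0 = 0" "\<And>n k. \<tau> n k \<in> {0..T}"
    and \<tau>': "mono \<tau>'" "\<tau>' 0 = 0" "\<And>k. \<tau>' k \<in> {0..T}"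
    and v: "\<And>k. (\<lambda>n. v n k) \<longlonglongrightarrow> v' k" "\<And>n k i. 0 \<le> v n k $ i" "\<And>k i. 0 \<le> v' k $ i"
    and f: "continuous_on {0..T} f"
  shows "(\<lambda>n. vec_stieltjes_integral T f (step_path T M (\<tau> n) (v n))) \<longlonglongrightarrow> vec_stieltjes_integral T f (step_path T M \<tau>' v')"
proof -
  have "(\<lambda>n. f (\<tau> n k)) \<longlonglongrightarrow> f (\<tau>' k)" for k
    by (rule continuous_on_tendsto_compose[OF f \<tau>(1)]) (use \<tau> \<tau>' in auto)
  then show ?thesis
    unfolding vec_stieltjes_integral_step_path[OF T \<tau>(2,3,4) v(2) f] vec_stieltjes_integral_step_path[OF T \<tau>' v(3) f]
    by (intro tendsto_intros v)
qed

lemma fun_tendsto_iff: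
  fixes f :: "nat \<Rightarrow> 'a::countable \<Rightarrow> 'b::metric_space"
  shows "(f \<longlonglongrightarrow> l) \<longleftrightarrow> (\<forall>i. (\<lambda>n. f n i) \<longlonglongrightarrow> l i)"
proof -
  have "(f \<longlonglongrightarrow> l) \<longleftrightarrow> limitin (product_topology (\<lambda>i. euclidean) UNIV) f l sequentially"
    by (simp only: euclidean_product_topology limitin_canonical_iff)
  then show ?thesis
    by (simp add: limitin_componentwise)
qed

section \<open>Compactness\<close>

text \<open>
Diagonal extraction, in the form of Tychonoff's theorem for a countable and hence metrizable
product.
\<close>

lemma bounded_fun_seq_compact:
  fixes x :: "nat \<Rightarrow> 'i::countable \<Rightarrow> 'a::metric_space"
  assumes C: "\<And>i. compact (C i)" and x: "\<And>n i. x n i \<in> C i"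
  shows "\<exists>l r. strict_mono (r :: nat \<Rightarrow> nat) \<and> (\<forall>i. l i \<in> C i \<and> (\<lambda>n. x (r n) i) \<longlonglongrightarrow> l i)"
proof -
  have "compactin (product_topology (\<lambda>i. euclidean) UNIV) (PiE UNIV C)"
    using C by (simp add: compactin_PiE)
  then have "seq_compact (PiE UNIV C)"
    by (simp only: euclidean_product_topology compactin_euclidean_iff compact_eq_seq_compact_metric)
  moreover have "\<forall>n. x n \<in> PiE UNIV C"
    using x by (simp add: PiE_UNIV_domain)
  ultimately obtain l r where "l \<in> PiE UNIV C" "strict_mono (r :: nat \<Rightarrow> nat)" "(x \<circ> r) \<longlonglongrightarrow> l"
    by (rule seq_compactE)
  then show ?thesis
    unfolding fun_tendsto_iff by (intro exI[of _ l] exI[of _ r]) (simp add: PiE_UNIV_domain Pi_iff)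
qed

text \<open>
A closed condition that holds off a finite set of times carries over to these times by
right-continuity.
\<close>

lemma closed_at_right_limit:
  fixes \<phi> :: "real \<Rightarrow> 'a::topological_space"
  assumes \<phi>: "(\<phi> \<longlongrightarrow> \<phi> t) (at_right t)" and t: "t < T" and F: "finite F" and C: "closed C"
    and mem: "\<And>u. t < u \<Longrightarrow> u < T \<Longrightarrow> u \<notin> F \<Longrightarrow> \<phi> u \<in> C"
  shows "\<phi> t \<in> C"
proof -
  have "\<forall>\<^sub>F u in at_right t. u \<notin> F"
    using islimpt_finite[OF F, of t] unfolding islimpt_iff_eventually not_not
    by (auto simp: eventually_at_filter elim: eventually_mono)
  moreover have "\<forall>\<^sub>F u in at_right t. t < u \<and> u < T"
    unfolding eventually_at_right[OF t] using t by (intro exI[of _ T]) auto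
  ultimately have "\<forall>\<^sub>F u in at_right t. \<phi> u \<in> C"
    by eventually_elim (use mem in auto)
  then show ?thesis
    by (rule Lim_in_closed_set[OF C _ _ \<phi>]) (simp add: trivial_limit_at_right_real)
qed

text \<open>
The one-sided limits of the paths form Cauchy sequences as well, so limits in time and along the
sequence may be interchanged.
\<close>

lemma skorokhod_uniform_limit:
  fixes \<phi> :: "nat \<Rightarrow> 'd::finite path"
  assumes T: "0 < T" and sk: "\<And>j. \<phi> j \<in> skorokhod_space T"
    and cauchy: "\<And>i j t. t \<in> {0..T} \<Longrightarrow> norm (\<phi> i t - \<phi> j t) \<le> e i + e j" and e: "e \<longlonglongrightarrow> 0"
  shows "\<exists>\<mu>\<in>skorokhod_space T. \<forall>j. \<forall>t\<in>{0..T}. norm (\<mu> t - \<phi> j t) \<le> e j"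
proof -
  have conv: "convergent x" if x: "\<And>i j. norm (x i - x j) \<le> e i + e j" for x :: "nat \<Rightarrow> real^'d"
  proof -
    have "Cauchy x"
    proof (rule metric_CauchyI)
      fix \<epsilon> :: real assume "\<epsilon> > 0"
      then have "\<forall>\<^sub>F n in sequentially. e n < \<epsilon> / 2"
        using order_tendstoD(2)[OF e, of "\<epsilon> / 2"] by simp
      then obtain N where N: "\<And>n. n \<ge> N \<Longrightarrow> e n < \<epsilon> / 2"
        unfolding eventually_sequentially by auto
      have "dist (x i) (x j) < \<epsilon>" if "i \<ge> N" "j \<ge> N" for i j
        using x[of i j] N[OF that(1)] N[OF that(2)] by (simp add: dist_norm)
      then show "\<exists>M. \<forall>m\<ge>M. \<forall>n\<ge>M. dist (x m) (x n) < \<epsilon>" by blast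
    qed
    then show ?thesis by (simp add: Cauchy_convergent_iff)
  qed
  define \<mu> where "\<mu> = restrict (\<lambda>t. lim (\<lambda>j. \<phi> j t)) {0..T}"
  have lim: "(\<lambda>j. \<phi> j t) \<longlonglongrightarrow> \<mu> t" if t: "t \<in> {0..T}" for t
    using conv[of "\<lambda>j. \<phi> j t", OF cauchy[OF t]] t by (simp add: \<mu>_def convergent_LIMSEQ_iff)
  have close: "norm (\<mu> t - \<phi> j t) \<le> e j" if t: "t \<in> {0..T}" for j t
  proof (rule LIMSEQ_le)
    show "(\<lambda>i. norm (\<phi> i t - \<phi> j t)) \<longlonglongrightarrow> norm (\<mu> t - \<phi> j t)"
      by (intro tendsto_intros lim t)
    show "(\<lambda>i. e i + e j) \<longlonglongrightarrow> e j"
      using tendsto_add[OF e tendsto_const[of "e j"]] by simp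
  qed (use cauchy[OF t] in auto)
  have unif: "uniform_limit {0..T} \<phi> \<mu> sequentially"
  proof (rule uniform_limitI)
    fix \<epsilon> :: real assume "\<epsilon> > 0"
    from order_tendstoD(2)[OF e this] show "\<forall>\<^sub>F n in sequentially. \<forall>t\<in>{0..T}. dist (\<phi> n t) (\<mu> t) < \<epsilon>"
    proof eventually_elim
      case (elim n)
      show ?case
      proof
        fix t assume "t \<in> {0..T}"
        from close[OF this, of n] elim show "dist (\<phi> n t) (\<mu> t) < \<epsilon>"
          by (simp add: dist_norm norm_minus_commute)
      qed
    qed
  qed
  have "\<mu> \<in> skorokhod_space T"
    unfolding skorokhod_space_def mem_Collect_eq
  proof (intro conjI ballI allI)
    show "\<mu> \<in> extensional {0..T}" by (simp add: \<mu>_def)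
    show "0 \<le> \<mu> t $ i" if "t \<in> {0..T}" for t i
      by (rule LIMSEQ_le_const[OF tendsto_vec_nth[OF lim[OF that]]])
        (use sk that in \<open>auto simp: skorokhod_space_def\<close>)
  next
    fix t assume t: "t \<in> {0..<T}"
    show "(\<mu> \<longlongrightarrow> \<mu> t) (at_right t)"
    proof (rule swap_uniform_limit'[OF _ lim unif])
      show "\<forall>\<^sub>F j in sequentially. (\<phi> j \<longlongrightarrow> \<phi> j t) (at_right t)"
        using sk t by (auto simp: skorokhod_space_def)
      show "\<forall>\<^sub>F u in at_right t. u \<in> {0..T}"
        using t eventually_at_right[of t T] by (auto intro!: exI[of _ T])
    qed (use t in auto)
  next
    fix t assume t: "t \<in> {0<..T}"
    then have ev: "\<forall>\<^sub>F u in at_left t. u \<in> {0..T}"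
      using eventually_at_left[of 0 t] by (auto intro!: exI[of _ 0])
    have "\<forall>j. \<exists>l. (\<phi> j \<longlongrightarrow> l) (at_left t)"
      using sk t by (simp add: skorokhod_space_def)
    then obtain l where l: "\<And>j. (\<phi> j \<longlongrightarrow> l j) (at_left t)"
      by metis
    have "norm (l i - l j) \<le> e i + e j" for i j
    proof (rule tendsto_upperbound)
      show "((\<lambda>u. norm (\<phi> i u - \<phi> j u)) \<longlongrightarrow> norm (l i - l j)) (at_left t)"
        by (intro tendsto_intros l)
      show "\<forall>\<^sub>F u in at_left t. norm (\<phi> i u - \<phi> j u) \<le> e i + e j"
        using ev by eventually_elim (rule cauchy)
    qed (simp add: trivial_limit_at_left_real)
    from conv[OF this] obtain l' where l': "l \<longlonglongrightarrow> l'"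
      by (auto simp: convergent_def)
    have "(\<mu> \<longlongrightarrow> l') (at_left t)"
      by (rule swap_uniform_limit'[OF _ l' unif ev]) (use l in auto)
    then show "\<exists>l. (\<mu> \<longlongrightarrow> l) (at_left t)" ..
  qed
  with close show ?thesis by blast
qed

text \<open>
For every level \<open>e j\<close> the greedy step approximation of a tame path has \<open>2 * m j\<close> steps, whose
times and values lie in a compact set. Along a diagonal subsequence all these data converge, for
all levels at once. The limiting step paths \<open>\<phi> j\<close> are at distance at most \<open>e i + e j\<close> from each
other, because they are pointwise limits of approximations of the same paths, and their uniform
limit is the \<open>S\<close>-limit: at precision \<open>e j\<close> the step approximations of level \<open>j\<close> serve as the paths
of finite variation, whose Stieltjes integrals converge since the test function is continuous.
\<close>

lemma tame_paths_seq_compact: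
  fixes \<nu> :: "nat \<Rightarrow> 'd::finite path"
  assumes T: "0 < T" and \<Omega>: "S_closed T \<Omega>" and \<nu>: "\<And>n. \<nu> n \<in> tame_paths T \<Omega> R m"
  shows "\<exists>r \<mu>. strict_mono r \<and> \<mu> \<in> tame_paths T \<Omega> R m \<and> S_converges T (\<nu> \<circ> r) \<mu>"
proof -
  define e where "e j = 1 / real (Suc j)" for j
  have e_pos: "e j > 0" for j by (simp add: e_def)
  have sk: "\<nu> n \<in> skorokhod_space T" and bound: "\<And>t. t \<in> {0..T} \<Longrightarrow> norm (\<nu> n t) \<le> R"
    and osc: "\<not> oscillates T (e j) (m j) (\<nu> n)" for n j
    using \<nu>[of n] \<Omega> by (auto simp: tame_paths_def S_closed_def e_def)
  have "\<forall>n j. \<exists>\<tau> :: nat \<Rightarrow> real. mono \<tau> \<and> \<tau> 0 = 0 \<and> (\<forall>k. \<tau> k \<in> {0..T}) \<and> \<tau> (2 * m j) = T \<and>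
      (\<forall>k t. \<tau> k \<le> t \<and> t < \<tau> (Suc k) \<longrightarrow> norm (\<nu> n t - \<nu> n (\<tau> k)) \<le> e j)"
    by (intro allI greedy_steps[OF T sk e_pos osc])
  from this[unfolded choice_iff] obtain \<tau> :: "nat \<Rightarrow> nat \<Rightarrow> nat \<Rightarrow> real" where all: "\<forall>n j. mono (\<tau> n j) \<and> \<tau> n j 0 = 0 \<and> (\<forall>k. \<tau> n j k \<in> {0..T}) \<and>
      \<tau> n j (2 * m j) = T \<and> (\<forall>k t. \<tau> n j k \<le> t \<and> t < \<tau> n j (Suc k) \<longrightarrow> norm (\<nu> n t - \<nu> n (\<tau> n j k)) \<le> e j)"
    ..
  then have \<tau>: "mono (\<tau> n j)" "\<tau> n j 0 = 0" "\<tau> n j k \<in> {0..T}" "\<tau> n j (2 * m j) = T"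
    "\<And>t. \<tau> n j k \<le> t \<Longrightarrow> t < \<tau> n j (Suc k) \<Longrightarrow> norm (\<nu> n t - \<nu> n (\<tau> n j k)) \<le> e j" for n j k
    by simp_all
  define v where "v n j k = \<nu> n (\<tau> n j k)" for n j k
  have v_pos: "0 \<le> v n j k $ i" for n j k i
    using sk[of n] \<tau>(3)[of n j k] by (simp add: v_def skorokhod_space_def)
  define approx where "approx n j = step_path T (2 * m j) (\<tau> n j) (v n j)" for n j
  have approx: "norm (\<nu> n t - approx n j t) \<le> e j" if "t \<in> {0..T}" for n j t
    unfolding approx_def v_def using e_pos[of j] that
    by (intro step_path_near \<tau>) auto
  define x where "x n i = (case i of (j, k) \<Rightarrow> (\<tau> n j k, v n j k))" for n and i :: "nat \<times> nat"
  have "\<exists>l r. strict_mono (r :: nat \<Rightarrow> nat) \<and> (\<forall>i. l i \<in> {0..T} \<times> cball 0 R \<and> (\<lambda>n. x (r n) i) \<longlonglongrightarrow> l i)"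
    using \<tau>(3) bound by (intro bounded_fun_seq_compact compact_Times) (auto simp: x_def v_def)
  then obtain l and r :: "nat \<Rightarrow> nat" where r: "strict_mono r"
    and l: "\<And>i. l i \<in> {0..T} \<times> cball 0 R" "\<And>i. (\<lambda>n. x (r n) i) \<longlonglongrightarrow> l i"
    by blast
  define \<tau>' v' where "\<tau>' j k = fst (l (j, k))" and "v' j k = snd (l (j, k))" for j k
  have \<tau>'_lim: "(\<lambda>n. \<tau> (r n) j k) \<longlonglongrightarrow> \<tau>' j k" and v'_lim: "(\<lambda>n. v (r n) j k) \<longlonglongrightarrow> v' j k" for j k
    using tendsto_fst[OF l(2)[of "(j, k)"]] tendsto_snd[OF l(2)[of "(j, k)"]] by (simp_all add: x_def \<tau>'_def v'_def)
  have \<tau>': "\<tau>' j k \<in> {0..T}" for j k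
    using l(1)[of "(j, k)"] by (auto simp: \<tau>'_def mem_Times_iff)
  have \<tau>'_0: "\<tau>' j 0 = 0" for j
    using LIMSEQ_unique[OF \<tau>'_lim[of j 0]] by (simp add: \<tau>(2))
  have \<tau>'_mono: "mono (\<tau>' j)" for j
    by (intro monoI LIMSEQ_le[OF \<tau>'_lim \<tau>'_lim]) (auto intro: monoD[OF \<tau>(1)])
  have v'_pos: "0 \<le> v' j k $ i" for j k i
    by (rule LIMSEQ_le_const[OF tendsto_vec_nth[OF v'_lim]]) (use v_pos in auto)
  define \<phi> where "\<phi> j = step_path T (2 * m j) (\<tau>' j) (v' j)" for j
  have \<phi>: "\<phi> j \<in> skorokhod_space T" for j
    unfolding \<phi>_def by (rule step_path_skorokhod[OF \<tau>'_mono \<tau>'_0 v'_pos])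
  have \<phi>_lim: "(\<lambda>n. approx (r n) j t) \<longlonglongrightarrow> \<phi> j t" if "t \<in> {0..T}" "t = T \<or> t \<notin> \<tau>' j ` {..2 * m j}" for j t
    unfolding approx_def \<phi>_def using \<tau>(3) that
    by (intro step_path_tendsto \<tau>'_lim v'_lim) auto
  have close: "norm (\<phi> i t - \<phi> j t) \<le> e i + e j"
    if t: "t \<in> {0..T}" "t = T \<or> t \<notin> \<tau>' i ` {..2 * m i} \<union> \<tau>' j ` {..2 * m j}" for i j t
  proof (rule LIMSEQ_le_const2)
    show "(\<lambda>n. norm (approx (r n) i t - approx (r n) j t)) \<longlonglongrightarrow> norm (\<phi> i t - \<phi> j t)"
      using t by (intro tendsto_intros \<phi>_lim) auto
    have "norm (approx (r n) i t - approx (r n) j t) \<le> e i + e j" for n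
      using norm_triangle_ineq4[of "\<nu> (r n) t - approx (r n) j t" "\<nu> (r n) t - approx (r n) i t"]
        approx[OF t(1), of "r n" i] approx[OF t(1), of "r n" j] by simp
    then show "\<exists>N. \<forall>n\<ge>N. norm (approx (r n) i t - approx (r n) j t) \<le> e i + e j"
      by blast
  qed
  have close: "norm (\<phi> i t - \<phi> j t) \<le> e i + e j" if t: "t \<in> {0..T}" for i j t
  proof (cases "t = T")
    case False
    have "\<phi> i t - \<phi> j t \<in> cball 0 (e i + e j)"
    proof (rule closed_at_right_limit[where \<phi> = "\<lambda>t. \<phi> i t - \<phi> j t" and T = T])
      show "((\<lambda>t. \<phi> i t - \<phi> j t) \<longlongrightarrow> \<phi> i t - \<phi> j t) (at_right t)"
        using \<phi>[of i] \<phi>[of j] t False by (intro tendsto_diff) (auto simp: skorokhod_space_def)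
      show "\<phi> i u - \<phi> j u \<in> cball 0 (e i + e j)"
        if "t < u" "u < T" "u \<notin> \<tau>' i ` {..2 * m i} \<union> \<tau>' j ` {..2 * m j}" for u
        using close[of u i j] that t by simp
    qed (use t False in auto)
    then show ?thesis by simp
  qed (use close[of t] t in simp)
  have "e \<longlonglongrightarrow> 0"
    unfolding e_def by (rule LIMSEQ_Suc[OF lim_1_over_n])
  from skorokhod_uniform_limit[OF T \<phi> close this]
  obtain \<mu> where \<mu>: "\<mu> \<in> skorokhod_space T" "\<And>j t. t \<in> {0..T} \<Longrightarrow> norm (\<mu> t - \<phi> j t) \<le> e j"
    by blast
  have sup_norm: "sup_norm T \<omega> \<le> c" if "\<And>t. t \<in> {0..T} \<Longrightarrow> norm (\<omega> t) \<le> c" for \<omega> :: "'d path" and c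
    unfolding sup_norm_def using that T by (intro cSUP_least) auto
  have "S_converges T (\<nu> \<circ> r) \<mu>"
    unfolding S_converges_def
  proof (intro conjI allI impI)
    show "(\<nu> \<circ> r) n \<in> skorokhod_space T" for n by (simp add: sk)
    show "\<mu> \<in> skorokhod_space T" by (rule \<mu>)
    fix \<epsilon> :: real assume "\<epsilon> > 0"
    then obtain j where j: "e j < \<epsilon>"
      using reals_Archimedean[of \<epsilon>] by (auto simp: e_def inverse_eq_divide)
    show "\<exists>\<nu>' \<mu>'.
        (\<forall>n. \<nu>' n \<in> skorokhod_space T \<and> finite_variation_on 0 T (\<nu>' n)) \<and>
        \<mu>' \<in> skorokhod_space T \<and> finite_variation_on 0 T \<mu>' \<and>
        sup_norm T (\<lambda>t. \<mu> t - \<mu>' t) \<le> \<epsilon> \<and>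
        (\<forall>n. sup_norm T (\<lambda>t. (\<nu> \<circ> r) n t - \<nu>' n t) \<le> \<epsilon>) \<and>
        (\<forall>f. continuous_on {0..T} f \<and> bounded (f ` {0..T}) \<longrightarrow>
          (\<lambda>n. vec_stieltjes_integral T f (\<nu>' n)) \<longlonglongrightarrow> vec_stieltjes_integral T f \<mu>')"
    proof (intro exI[of _ "\<lambda>n. approx (r n) j"] exI[of _ "\<phi> j"] conjI allI impI)
      show "approx (r n) j \<in> skorokhod_space T" "finite_variation_on 0 T (approx (r n) j)" for n
        unfolding approx_def by (rule step_path_skorokhod[OF \<tau>(1,2) v_pos], rule step_path_finite_variation)
      show "\<phi> j \<in> skorokhod_space T" "finite_variation_on 0 T (\<phi> j)"
        by (rule \<phi>, unfold \<phi>_def, rule step_path_finite_variation)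
      show "sup_norm T (\<lambda>t. \<mu> t - \<phi> j t) \<le> \<epsilon>"
        using \<mu>(2)[of _ j] j by (intro sup_norm) force
      show "sup_norm T (\<lambda>t. (\<nu> \<circ> r) n t - approx (r n) j t) \<le> \<epsilon>" for n
        using approx[of _ "r n" j] j by (intro sup_norm) force
      show "(\<lambda>n. vec_stieltjes_integral T f (approx (r n) j)) \<longlonglongrightarrow> vec_stieltjes_integral T f (\<phi> j)"
        if "continuous_on {0..T} f \<and> bounded (f ` {0..T})" for f
        unfolding approx_def \<phi>_def using that
        by (intro vec_stieltjes_integral_step_path_tendsto T \<tau>'_lim v'_lim \<tau> \<tau>' \<tau>'_mono \<tau>'_0 v_pos v'_pos) auto
    qed
  qed
  moreover have "\<mu> \<in> tame_paths T \<Omega> R m"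
    by (rule tame_paths_S_closed[OF T \<Omega> calculation]) (simp add: \<nu>)
  ultimately show ?thesis
    using r by (intro exI conjI)
qed

text \<open>
Averages over shrinking windows recover the values at rational times, and these determine the path
by right-continuity.
\<close>

lemma path_mass_separates:
  fixes \<omega> \<omega>' :: "'d::finite path"
  assumes T: "0 < T" and w: "\<omega> \<in> skorokhod_space T" "\<omega>' \<in> skorokhod_space T"
    and eq: "\<And>s d :: rat. path_mass T \<bar>of_rat s\<bar> \<bar>of_rat d\<bar> \<omega> = path_mass T \<bar>of_rat s\<bar> \<bar>of_rat d\<bar> \<omega>'"
  shows "\<omega> = \<omega>'"
proof -
  have rat: "\<omega> (min \<bar>of_rat s\<bar> T) = \<omega>' (min \<bar>of_rat s\<bar> T)" for s
  proof (rule LIMSEQ_unique)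
    have lim: "(\<lambda>n. (1 / (1 / real (Suc n))) *\<^sub>R path_mass T \<bar>of_rat s\<bar> (1 / real (Suc n)) \<psi>) \<longlonglongrightarrow> \<psi> (min \<bar>of_rat s\<bar> T)"
      if "\<psi> \<in> skorokhod_space T" for \<psi> :: "'d path"
      by (rule path_average_sequence[OF T that]) simp
    have "1 / real (Suc n) = \<bar>of_rat (1 / of_nat (Suc n))\<bar>" for n
      by (simp add: of_rat_divide of_rat_add)
    then have "path_mass T \<bar>of_rat s\<bar> (1 / real (Suc n)) \<omega> = path_mass T \<bar>of_rat s\<bar> (1 / real (Suc n)) \<omega>'" for n
      using eq by metis
    with lim[OF w(1)] show "(\<lambda>n. (1 / (1 / real (Suc n))) *\<^sub>R path_mass T \<bar>of_rat s\<bar> (1 / real (Suc n)) \<omega>') \<longlonglongrightarrow> \<omega> (min \<bar>of_rat s\<bar> T)"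
      by simp
    show "(\<lambda>n. (1 / (1 / real (Suc n))) *\<^sub>R path_mass T \<bar>of_rat s\<bar> (1 / real (Suc n)) \<omega>') \<longlonglongrightarrow> \<omega>' (min \<bar>of_rat s\<bar> T)"
      by (rule lim[OF w(2)])
  qed
  have "\<omega> t = \<omega>' t" if t: "t \<in> {0..T}" for t
  proof (rule ccontr)
    assume "\<omega> t \<noteq> \<omega>' t"
    then have "0 < norm (\<omega> (min t T) - \<omega>' (min t T))" using t by simp
    moreover have "((\<lambda>u. norm (\<omega> (min u T) - \<omega>' (min u T))) \<longlongrightarrow> norm (\<omega> (min t T) - \<omega>' (min t T))) (at_right t)"
      using t by (intro tendsto_intros skorokhod_right_limit w) auto
    ultimately have "\<forall>\<^sub>F u in at_right t. 0 < norm (\<omega> (min u T) - \<omega>' (min u T))"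
      by (intro order_tendstoD)
    then obtain b where b: "b > t" "\<And>u. t < u \<Longrightarrow> u < b \<Longrightarrow> \<omega> (min u T) \<noteq> \<omega>' (min u T)"
      unfolding eventually_at_right[of t "t + 1", simplified] by auto
    obtain q :: rat where q: "t < of_rat q" "of_rat q < b"
      using of_rat_dense[OF b(1)] by blast
    have "0 \<le> t" using t by simp
    then have "\<bar>of_rat q\<bar> = (of_rat q :: real)"
      using less_imp_le[OF q(1)] by (intro abs_of_nonneg) (rule order_trans)
    with rat[of q] have "\<omega> (min (of_rat q) T) = \<omega>' (min (of_rat q) T)"
      by (simp only:)
    with b(2)[OF q] show False ..
  qed
  then show ?thesis
    using w by (intro extensionalityI[of _ "{0..T}"]) (auto simp: skorokhod_space_def)
qed

lemma S_star_open_imp_S_open: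
  assumes "openin (S_star_topology T \<Omega>) U"
  shows "openin (subtopology (S_topology T) \<Omega>) (U \<inter> skorokhod_space T)"
proof -
  let ?X = "subtopology (S_topology T) \<Omega>"
  have "openin ?X (U \<inter> topspace ?X)"
  proof (rule generate_topology_on_coarsest[where T="\<lambda>U. openin ?X (U \<inter> topspace ?X)"])
    show "istopology (\<lambda>U. openin ?X (U \<inter> topspace ?X))"
      unfolding istopology_def
    proof (intro conjI allI impI)
      fix A B assume "openin ?X (A \<inter> topspace ?X)" "openin ?X (B \<inter> topspace ?X)"
      from openin_Int[OF this] show "openin ?X (A \<inter> B \<inter> topspace ?X)"
        by (simp add: Int_ac)
    next
      fix \<K> assume "\<forall>K\<in>\<K>. openin ?X (K \<inter> topspace ?X)"
      then have "openin ?X (\<Union>K\<in>\<K>. K \<inter> topspace ?X)" by blast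
      then show "openin ?X (\<Union>\<K> \<inter> topspace ?X)" by (simp add: Int_commute Int_Union)
    qed
    show "generate_topology_on {{\<omega> \<in> \<Omega>. f \<omega> \<in> U} | f U. continuous_map ?X euclideanreal f \<and> open U} U"
      using assms by (simp add: S_star_topology_def openin_topology_generated_by_iff)
    fix S assume "S \<in> {{\<omega> \<in> \<Omega>. f \<omega> \<in> U} | f U. continuous_map ?X euclideanreal f \<and> open U}"
    then obtain f V where f: "continuous_map ?X euclideanreal f" "open V" "S = {\<omega> \<in> \<Omega>. f \<omega> \<in> V}"
      by blast
    have "S \<inter> topspace ?X = {\<omega> \<in> topspace ?X. f \<omega> \<in> V}"
      using f by auto
    then show "openin ?X (S \<inter> topspace ?X)"
      using openin_continuous_map_preimage[OF f(1)] f(2) by simp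
  qed
  then have "openin ?X (U \<inter> (skorokhod_space T \<inter> \<Omega>))"
    by simp
  moreover have "U \<subseteq> \<Omega>"
    using openin_subset[OF assms] by simp
  then have "U \<inter> (skorokhod_space T \<inter> \<Omega>) = U \<inter> skorokhod_space T"
    by blast
  ultimately show ?thesis
    by (simp only:)
qed

text \<open>
Sequential compactness alone does not give compactness. But countably many window integrals embed
the tame paths into a metrizable space, and the trace \<open>K - U\<close> of the complement of an open set is
sequentially compact again, so its image is compact and therefore closed. Hence the embedding
carries open covers to open covers of a compact metric space.
\<close>

lemma compactin_tame_paths:
  fixes \<Omega> :: "'d::finite path set"
  assumes T: "0 < T" and \<Omega>: "S_closed T \<Omega>"
  shows "compactin (S_star_topology T \<Omega>) (tame_paths T \<Omega> R m)"
proof -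
  let ?K = "tame_paths T \<Omega> R m"
  have \<Omega>_sub: "\<Omega> \<subseteq> skorokhod_space T" using \<Omega> by (simp add: S_closed_def)
  have K_sub: "?K \<subseteq> \<Omega>" by (auto simp: tame_paths_def)
  define \<Psi> :: "'d path \<Rightarrow> rat \<times> rat \<Rightarrow> real^'d" where
    "\<Psi> \<omega> p = path_mass T \<bar>of_rat (fst p)\<bar> \<bar>of_rat (snd p)\<bar> \<omega>" for \<omega> p
  have inj: "\<omega> = \<omega>'" if "\<Psi> \<omega> = \<Psi> \<omega>'" "\<omega> \<in> \<Omega>" "\<omega>' \<in> \<Omega>" for \<omega> \<omega>'
  proof (rule path_mass_separates[OF T])
    show "path_mass T \<bar>of_rat s\<bar> \<bar>of_rat d\<bar> \<omega> = path_mass T \<bar>of_rat s\<bar> \<bar>of_rat d\<bar> \<omega>'" for s d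
      using fun_cong[OF that(1), of "(s, d)"] by (simp add: \<Psi>_def)
  qed (use that \<Omega>_sub in auto)
  have compact: "compact (\<Psi> ` (?K - U))" if U: "openin (S_star_topology T \<Omega>) U" for U
    unfolding compact_eq_seq_compact_metric
  proof (rule seq_compactI)
    fix x :: "nat \<Rightarrow> rat \<times> rat \<Rightarrow> real^'d" assume "\<forall>n. x n \<in> \<Psi> ` (?K - U)"
    then have "\<forall>n. \<exists>\<omega>. \<omega> \<in> ?K - U \<and> x n = \<Psi> \<omega>" by blast
    then obtain \<nu> where \<nu>: "\<And>n. \<nu> n \<in> ?K - U" "\<And>n. x n = \<Psi> (\<nu> n)" by metis
    obtain r \<mu> where r: "strict_mono r" "\<mu> \<in> ?K" "S_converges T (\<nu> \<circ> r) \<mu>"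
      using tame_paths_seq_compact[OF T \<Omega>, of \<nu> R m] \<nu>(1) by (metis DiffD1)
    obtain V where V: "openin (S_topology T) V" "U \<inter> skorokhod_space T = V \<inter> \<Omega>"
      using S_star_open_imp_S_open[OF U] by (auto simp: openin_subtopology)
    have UV: "\<omega> \<in> U \<longleftrightarrow> \<omega> \<in> V" if "\<omega> \<in> \<Omega>" for \<omega>
      using set_eq_iff[THEN iffD1, OF V(2), rule_format, of \<omega>] that \<Omega>_sub by auto
    have closed: "\<forall>\<nu> \<mu>. (\<forall>n. \<nu> n \<in> skorokhod_space T - V) \<and> S_converges T \<nu> \<mu> \<longrightarrow> \<mu> \<in> skorokhod_space T - V"
      using V(1) unfolding openin_S_topology S_closed_def by (elim conjE)
    have "(\<nu> \<circ> r) n \<in> skorokhod_space T - V" for n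
      using \<nu>(1)[of "r n"] UV[of "\<nu> (r n)"] K_sub \<Omega>_sub by auto
    then have "\<mu> \<in> skorokhod_space T - V"
      using closed[rule_format, of "\<nu> \<circ> r" \<mu>] r(3) by simp
    then have "\<mu> \<in> ?K - U"
      using r(2) UV[of \<mu>] K_sub by auto
    moreover have "(x \<circ> r) \<longlonglongrightarrow> \<Psi> \<mu>"
      unfolding fun_tendsto_iff
    proof
      fix p
      show "(\<lambda>n. (x \<circ> r) n p) \<longlonglongrightarrow> \<Psi> \<mu> p"
        using S_converges_path_mass[OF T r(3), of "\<bar>of_rat (fst p)\<bar>" "\<bar>of_rat (snd p)\<bar>"]
        by (simp add: \<Psi>_def \<nu>(2))
    qed
    ultimately show "\<exists>l\<in>\<Psi> ` (?K - U). \<exists>r. strict_mono r \<and> (x \<circ> r) \<longlonglongrightarrow> l"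
      using r(1) by (intro bexI[of _ "\<Psi> \<mu>"] exI[of _ r] conjI imageI)
  qed
  show ?thesis
    unfolding compactin_def
  proof (intro conjI allI impI)
    show "?K \<subseteq> topspace (S_star_topology T \<Omega>)" using K_sub by simp
    fix \<U> assume "(\<forall>U\<in>\<U>. openin (S_star_topology T \<Omega>) U) \<and> ?K \<subseteq> \<Union>\<U>"
    then have \<U>: "\<And>U. U \<in> \<U> \<Longrightarrow> openin (S_star_topology T \<Omega>) U" "?K \<subseteq> \<Union>\<U>" by auto
    have "compact (\<Psi> ` ?K)" using compact[of "{}"] by simp
    moreover have "open (- \<Psi> ` (?K - U))" if "U \<in> \<U>" for U
      by (rule open_Compl[OF compact_imp_closed[OF compact[OF \<U>(1)[OF that]]]])
    moreover have "\<Psi> ` ?K \<subseteq> (\<Union>U\<in>\<U>. - \<Psi> ` (?K - U))"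
    proof
      fix y assume "y \<in> \<Psi> ` ?K"
      then obtain \<omega> where \<omega>: "\<omega> \<in> ?K" "y = \<Psi> \<omega>" by blast
      then obtain U where U: "U \<in> \<U>" "\<omega> \<in> U" using \<U>(2) by blast
      have "y \<notin> \<Psi> ` (?K - U)"
      proof
        assume "y \<in> \<Psi> ` (?K - U)"
        then obtain \<omega>' where \<omega>': "y = \<Psi> \<omega>'" "\<omega>' \<in> ?K - U"
          by (rule imageE)
        have "\<omega> = \<omega>'"
          by (rule inj[OF trans[OF \<omega>(2)[symmetric] \<omega>'(1)]]) (use \<omega>(1) \<omega>'(2) K_sub in blast)+
        with \<omega>'(2) U(2) show False by blast
      qed
      with U(1) show "y \<in> (\<Union>U\<in>\<U>. - \<Psi> ` (?K - U))" by blast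
    qed
    ultimately obtain \<F> where \<F>: "\<F> \<subseteq> \<U>" "finite \<F>" "\<Psi> ` ?K \<subseteq> (\<Union>U\<in>\<F>. - \<Psi> ` (?K - U))"
      by (rule compactE_image)
    have "?K \<subseteq> \<Union>\<F>"
    proof
      fix \<omega> assume \<omega>: "\<omega> \<in> ?K"
      then have "\<Psi> \<omega> \<in> (\<Union>U\<in>\<F>. - \<Psi> ` (?K - U))" using \<F>(3) by auto
      then obtain U where "U \<in> \<F>" "\<Psi> \<omega> \<notin> \<Psi> ` (?K - U)" by auto
      then show "\<omega> \<in> \<Union>\<F>" using \<omega> by auto
    qed
    with \<F> show "\<exists>\<F>. finite \<F> \<and> \<F> \<subseteq> \<U> \<and> ?K \<subseteq> \<Union>\<F>" by blast
  qed
qed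

section \<open>Discrete hedging of oscillations\<close>

text \<open>
The discrete counterpart of the greedy steps: the anchor is moved to the current value when this
is more than \<open>\<delta>\<close> away.
\<close>

primrec anchor :: "real \<Rightarrow> (nat \<Rightarrow> 'a::real_normed_vector) \<Rightarrow> nat \<Rightarrow> 'a" where
  "anchor \<delta> y 0 = y 0"
| "anchor \<delta> y (Suc k) = (if \<delta> < norm (y (Suc k) - anchor \<delta> y k) then y (Suc k) else anchor \<delta> y k)"

definition energy :: "real \<Rightarrow> (nat \<Rightarrow> 'a::real_normed_vector) \<Rightarrow> nat \<Rightarrow> real" where
  "energy \<delta> y n = (\<Sum>k<n. (norm (anchor \<delta> y (Suc k) - anchor \<delta> y k))\<^sup>2)"

lemma energy_mono: "i \<le> j \<Longrightarrow> energy \<delta> y i \<le> energy \<delta> y j"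
  unfolding energy_def by (intro sum_mono2) auto

lemma energy_nonneg: "0 \<le> energy \<delta> y n"
  unfolding energy_def by (intro sum_nonneg) auto

lemma anchor_near: "0 \<le> \<delta> \<Longrightarrow> norm (y k - anchor \<delta> y k) \<le> \<delta>"
  by (cases k) auto

lemma anchor_cong: "(\<And>i. i \<le> k \<Longrightarrow> y i = z i) \<Longrightarrow> anchor \<delta> y k = anchor \<delta> z k"
  by (induction k) auto

lemma norm_anchor_le: "(\<And>i. i \<le> k \<Longrightarrow> norm (y i) \<le> R) \<Longrightarrow> norm (anchor \<delta> y k) \<le> R"
  by (induction k) auto

text \<open>
Holding \<open>- 2\<close> times the anchor replicates the sum of squared moves of the anchor, up to terms at
the two ends. While the anchor stays, both sides change linearly in \<open>y\<close>; a move of the anchor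
completes the square.
\<close>

lemma anchor_gain:
  fixes y :: "nat \<Rightarrow> 'a::real_inner"
  shows "(\<Sum>k<n. - 2 * (anchor \<delta> y k \<bullet> (y (Suc k) - y k)))
    = energy \<delta> y n + (norm (y 0))\<^sup>2 + (norm (anchor \<delta> y n))\<^sup>2 - 2 * (anchor \<delta> y n \<bullet> y n)"
proof (induction n)
  case 0
  then show ?case by (simp add: energy_def power2_norm_eq_inner)
next
  case (Suc n)
  let ?a = "anchor \<delta> y n" and ?y = "y (Suc n)"
  have "(norm (?y - ?a))\<^sup>2 = (norm ?y)\<^sup>2 + (norm ?a)\<^sup>2 - 2 * (?a \<bullet> ?y)"
    by (simp add: power2_norm_eq_inner inner_diff_left inner_diff_right inner_commute)
  with Suc show ?case
    by (cases "\<delta> < norm (?y - ?a)") (simp_all add: energy_def inner_diff_right dot_square_norm)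
qed

text \<open>
The bound is linear in the last value, which may be an overshoot over \<open>R\<close>. A quadratic bound would
be easier but of no use, since integrals must be bounded below by functions of growth \<open>q\<close>, and
\<open>q < 2\<close> is possible.
\<close>

lemma anchor_gain_lower:
  fixes y :: "nat \<Rightarrow> 'a::real_inner"
  assumes "\<And>i. i < n \<Longrightarrow> norm (y i) \<le> R" "0 \<le> R"
  shows "(\<Sum>k<n. - 2 * (anchor \<delta> y k \<bullet> (y (Suc k) - y k))) \<ge> - (2 * R * norm (y n))"
proof (cases n)
  case 0
  then show ?thesis using assms by simp
next
  case (Suc j)
  let ?a = "anchor \<delta> y j"
  have "?a \<bullet> y n \<le> norm ?a * norm (y n)"
    by (rule norm_cauchy_schwarz)
  also have "\<dots> \<le> R * norm (y n)"
    using assms Suc by (intro mult_right_mono norm_anchor_le) auto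
  finally have "2 * (?a \<bullet> y n) \<le> 2 * R * norm (y n)" by simp
  moreover have "(\<Sum>k<n. - 2 * (anchor \<delta> y k \<bullet> (y (Suc k) - y k)))
      = energy \<delta> y j + (norm (y 0))\<^sup>2 + (norm ?a)\<^sup>2 - 2 * (?a \<bullet> y n)"
    using anchor_gain[of \<delta> y j] Suc by (simp add: inner_diff_right)
  ultimately show ?thesis
    using energy_nonneg[of \<delta> y j] zero_le_power2[of "norm (y 0)"] zero_le_power2[of "norm ?a"] by linarith
qed

lemma anchor_gain_energy:
  fixes y :: "nat \<Rightarrow> 'a::real_inner"
  assumes "\<And>i. i \<le> n \<Longrightarrow> norm (y i) \<le> R"
  shows "(\<Sum>k<n. - 2 * (anchor \<delta> y k \<bullet> (y (Suc k) - y k))) \<ge> energy \<delta> y n - 2 * R * norm (y n)"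
proof -
  let ?a = "anchor \<delta> y n"
  have "?a \<bullet> y n \<le> norm ?a * norm (y n)"
    by (rule norm_cauchy_schwarz)
  also have "\<dots> \<le> R * norm (y n)"
    using assms by (intro mult_right_mono norm_anchor_le) auto
  finally have "2 * (?a \<bullet> y n) \<le> 2 * R * norm (y n)" by simp
  then show ?thesis
    using zero_le_power2[of "norm (y 0)"] zero_le_power2[of "norm ?a"] unfolding anchor_gain by linarith
qed

lemma energy_jump:
  assumes \<delta>: "0 \<le> \<delta>" and ij: "i < j" and far: "2 * \<delta> < norm (y j - y i)"
  shows "energy \<delta> y i + \<delta>\<^sup>2 \<le> energy \<delta> y j"
proof -
  have "\<exists>k. i \<le> k \<and> k < j \<and> anchor \<delta> y (Suc k) \<noteq> anchor \<delta> y k"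
  proof (rule ccontr)
    assume "\<not> ?thesis"
    then have same: "anchor \<delta> y (Suc k) = anchor \<delta> y k" if "i \<le> k" "k < j" for k using that by blast
    have const: "k \<le> j \<longrightarrow> anchor \<delta> y k = anchor \<delta> y i" if "i \<le> k" for k
      using that by (induction k rule: dec_induct) (auto simp: same simp del: anchor.simps)
    have "anchor \<delta> y j = anchor \<delta> y i" using const[of j] ij by simp
    then have "norm (y j - y i) \<le> norm (y j - anchor \<delta> y j) + norm (y i - anchor \<delta> y i)"
      using norm_triangle_ineq4[of "y j - anchor \<delta> y j" "y i - anchor \<delta> y i"] by simp
    with anchor_near[OF \<delta>, of y j] anchor_near[OF \<delta>, of y i] far show False by simp
  qed
  then obtain k where k: "i \<le> k" "k < j" "anchor \<delta> y (Suc k) \<noteq> anchor \<delta> y k" by blast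
  then have "\<delta> < norm (anchor \<delta> y (Suc k) - anchor \<delta> y k)"
    by (auto split: if_splits)
  then have "\<delta>\<^sup>2 \<le> (norm (anchor \<delta> y (Suc k) - anchor \<delta> y k))\<^sup>2"
    using \<delta> by (intro power_mono) auto
  then have "energy \<delta> y i + \<delta>\<^sup>2 \<le> energy \<delta> y (Suc k)"
    using energy_mono[OF k(1), of \<delta> y] by (simp add: energy_def)
  also have "\<dots> \<le> energy \<delta> y j"
    using k by (intro energy_mono) auto
  finally show ?thesis .
qed

text \<open>
If the anchor did not move between two values, both would be within \<open>\<delta>\<close> of it. So every pair at
distance more than \<open>2 * \<delta>\<close> forces a move.
\<close>

lemma energy_pairs:
  assumes \<delta>: "0 \<le> \<delta>" and pair: "\<And>k. k < m \<Longrightarrow> i k < j k \<and> j k \<le> n \<and> 2 * \<delta> < norm (y (j k) - y (i k))"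
    and gap: "\<And>k. Suc k < m \<Longrightarrow> j k \<le> i (Suc k)"
  shows "real m * \<delta>\<^sup>2 \<le> energy \<delta> y n"
proof -
  have "real (Suc k) * \<delta>\<^sup>2 \<le> energy \<delta> y (j k)" if "k < m" for k
    using that
  proof (induction k)
    case 0
    then show ?case using energy_jump[OF \<delta>, of "i 0" "j 0" y] energy_nonneg[of \<delta> y "i 0"] pair[of 0] by simp
  next
    case (Suc k)
    have "energy \<delta> y (j k) \<le> energy \<delta> y (i (Suc k))"
      using gap Suc.prems by (intro energy_mono) auto
    moreover have "energy \<delta> y (i (Suc k)) + \<delta>\<^sup>2 \<le> energy \<delta> y (j (Suc k))"
      using pair[OF Suc.prems] by (intro energy_jump \<delta>) auto
    ultimately show ?case
      using Suc by (simp add: distrib_right)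
  qed
  note last = this
  show ?thesis
  proof (cases m)
    case 0
    then show ?thesis using energy_nonneg[of \<delta> y n] by simp
  next
    case (Suc l)
    then have "real m * \<delta>\<^sup>2 \<le> energy \<delta> y (j l)" using last[of l] by simp
    also have "\<dots> \<le> energy \<delta> y n" using pair[of l] Suc by (intro energy_mono) auto
    finally show ?thesis .
  qed
qed

text \<open>
As long as the path has norm at most \<open>R\<close>, hold a weighted mixture of \<open>n\<close> anchor strategies. After
the first exit, hold \<open>- \<kappa>\<close> in every component. Together with a claim on \<open>\<kappa>\<close> times the sum of the
final components, this freezes the value of that claim at the exit time.
\<close>

definition position :: "real \<Rightarrow> real \<Rightarrow> (nat \<Rightarrow> real) \<Rightarrow> (nat \<Rightarrow> real) \<Rightarrow> nat \<Rightarrow> (nat \<Rightarrow> real^'d::finite) \<Rightarrow> nat \<Rightarrow> real^'d" where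
  "position R \<kappa> w \<delta> n y k =
    (if \<forall>i\<le>k. norm (y i) \<le> R then (\<Sum>j<n. (- 2 * w j) *\<^sub>R anchor (\<delta> j) y k) else - \<kappa> *\<^sub>R 1)"

definition gain :: "(nat \<Rightarrow> 'a::real_inner) \<Rightarrow> (nat \<Rightarrow> 'a) \<Rightarrow> nat \<Rightarrow> real" where
  "gain h y n = (\<Sum>k<n. h k \<bullet> (y (Suc k) - y k))"

lemma position_cong: "(\<And>i. i \<le> k \<Longrightarrow> y i = z i) \<Longrightarrow> position R \<kappa> w \<delta> n y k = position R \<kappa> w \<delta> n z k"
proof -
  assume eq: "\<And>i. i \<le> k \<Longrightarrow> y i = z i"
  then have "(\<forall>i\<le>k. norm (y i) \<le> R) = (\<forall>i\<le>k. norm (z i) \<le> R)" by simp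
  then show ?thesis
    unfolding position_def using anchor_cong[of k y z, OF eq] by (simp only:)
qed

lemma norm_le_inner_one:
  fixes v :: "real^'d::finite"
  assumes "\<And>i. 0 \<le> v $ i"
  shows "norm v \<le> 1 \<bullet> v" "1 \<bullet> v \<le> real CARD('d) * norm v"
proof -
  have eq: "1 \<bullet> v = (\<Sum>i\<in>UNIV. v $ i)" by (simp add: inner_vec_def)
  have "norm v \<le> (\<Sum>i\<in>UNIV. \<bar>v $ i\<bar>)" by (rule norm_le_l1_cart)
  then show "norm v \<le> 1 \<bullet> v" unfolding eq using assms by simp
  have "(\<Sum>i\<in>UNIV. v $ i) \<le> (\<Sum>i\<in>(UNIV::'d set). norm v)"
    by (intro sum_mono abs_le_D1[OF component_le_norm_cart])
  then show "1 \<bullet> v \<le> real CARD('d) * norm v" unfolding eq by simp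
qed

text \<open>
The claim \<open>\<kappa> * (1 \<bullet> y N)\<close> dominates \<open>\<kappa> * norm (y N)\<close>, since the components are nonnegative. A part
\<open>norm (y N) / R\<close> of it pays \<open>1\<close> upon exit, as in Doob's maximal inequality; the rest covers the
linear lower bounds of the anchor strategies, which include the overshoot at the exit.
\<close>

context
  fixes R \<kappa> :: real and w \<delta> :: "nat \<Rightarrow> real" and y :: "nat \<Rightarrow> real^'d::finite" and n :: nat
  assumes R: "0 < R" and w: "\<And>j. 0 \<le> w j" and \<kappa>: "1 / R + (\<Sum>j<n. 2 * R * w j) \<le> \<kappa>"
    and y: "\<And>k i. 0 \<le> y k $ i"
begin

lemma gain_alive:
  assumes "\<And>i. i < N \<Longrightarrow> norm (y i) \<le> R"
  shows "gain (position R \<kappa> w \<delta> n y) y N = (\<Sum>j<n. w j * (\<Sum>k<N. - 2 * (anchor (\<delta> j) y k \<bullet> (y (Suc k) - y k))))"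
proof -
  have "position R \<kappa> w \<delta> n y k \<bullet> (y (Suc k) - y k) = (\<Sum>j<n. w j * (- 2 * (anchor (\<delta> j) y k \<bullet> (y (Suc k) - y k))))"
    if "k < N" for k
    using assms that by (auto simp: position_def inner_sum_left intro!: sum.cong)
  then have "gain (position R \<kappa> w \<delta> n y) y N = (\<Sum>k<N. \<Sum>j<n. w j * (- 2 * (anchor (\<delta> j) y k \<bullet> (y (Suc k) - y k))))"
    by (simp add: gain_def)
  also have "\<dots> = (\<Sum>j<n. \<Sum>k<N. w j * (- 2 * (anchor (\<delta> j) y k \<bullet> (y (Suc k) - y k))))"
    by (rule sum.swap)
  finally show ?thesis
    by (simp add: sum_distrib_left)
qed

lemma compensated_norm: "norm (y N) / R + (\<Sum>j<n. 2 * R * w j) * norm (y N) \<le> \<kappa> * (1 \<bullet> y N)"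
proof -
  have "norm (y N) / R + (\<Sum>j<n. 2 * R * w j) * norm (y N) = (1 / R + (\<Sum>j<n. 2 * R * w j)) * norm (y N)"
    by (simp add: distrib_right)
  also have "\<dots> \<le> \<kappa> * norm (y N)"
    using \<kappa> by (intro mult_right_mono) auto
  also have "\<dots> \<le> \<kappa> * (1 \<bullet> y N)"
  proof (intro mult_left_mono norm_le_inner_one y)
    have "0 \<le> 1 / R + (\<Sum>j<n. 2 * R * w j)"
      using R w by (intro add_nonneg_nonneg sum_nonneg) auto
    then show "0 \<le> \<kappa>" using \<kappa> by simp
  qed
  finally show ?thesis .
qed

lemma gain_alive_ge:
  assumes "\<And>i. i < N \<Longrightarrow> norm (y i) \<le> R"
  shows "norm (y N) / R \<le> gain (position R \<kappa> w \<delta> n y) y N + \<kappa> * (1 \<bullet> y N)"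
proof -
  have "(\<Sum>j<n. w j * - (2 * R * norm (y N))) \<le> gain (position R \<kappa> w \<delta> n y) y N"
  proof (subst gain_alive)
    show "norm (y i) \<le> R" if "i < N" for i by (rule assms[OF that])
    show "(\<Sum>j<n. w j * - (2 * R * norm (y N))) \<le> (\<Sum>j<n. w j * (\<Sum>k<N. - 2 * (anchor (\<delta> j) y k \<bullet> (y (Suc k) - y k))))"
      by (intro sum_mono mult_left_mono w anchor_gain_lower assms less_imp_le[OF R])
  qed
  moreover have "(\<Sum>j<n. w j * - (2 * R * norm (y N))) = - ((\<Sum>j<n. 2 * R * w j) * norm (y N))"
    by (simp add: sum_distrib_left sum_distrib_right sum_negf algebra_simps)
  ultimately show ?thesis
    using compensated_norm[of N] by simp
qed

lemma gain_exit:
  assumes "\<exists>i\<le>N. R < norm (y i)"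
  shows "1 \<le> gain (position R \<kappa> w \<delta> n y) y N + \<kappa> * (1 \<bullet> y N)"
  using assms
proof (induction N)
  case 0
  then have "1 \<le> norm (y 0) / R" using R by simp
  also have "\<dots> \<le> gain (position R \<kappa> w \<delta> n y) y 0 + \<kappa> * (1 \<bullet> y 0)"
    by (rule gain_alive_ge) simp
  finally show ?case .
next
  case (Suc N)
  show ?case
  proof (cases "\<exists>i\<le>N. R < norm (y i)")
    case True
    then have "position R \<kappa> w \<delta> n y N = - \<kappa> *\<^sub>R 1"
      by (auto simp: position_def not_le)
    then show ?thesis
      using Suc.IH[OF True] by (simp add: gain_def inner_diff_right right_diff_distrib)
  next
    case False
    then have "norm (y i) \<le> R" if "i < Suc N" for i
      using that by (auto simp: not_less less_Suc_eq_le)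
    note gain_alive_ge[OF this]
    moreover have "R < norm (y (Suc N))"
      using Suc.prems False by (auto simp: le_Suc_eq)
    then have "1 \<le> norm (y (Suc N)) / R" using R by simp
    ultimately show ?thesis by (rule order_trans[rotated])
  qed
qed

lemma gain_energy:
  assumes "j < n" "1 \<le> w j * energy (\<delta> j) y N"
  shows "1 \<le> gain (position R \<kappa> w \<delta> n y) y N + \<kappa> * (1 \<bullet> y N)"
proof (cases "\<exists>i\<le>N. R < norm (y i)")
  case False
  then have le: "norm (y i) \<le> R" if "i \<le> N" for i using that by (auto simp: not_less)
  have "(\<Sum>i<n. w i * (energy (\<delta> i) y N - 2 * R * norm (y N))) \<le> gain (position R \<kappa> w \<delta> n y) y N"
  proof (subst gain_alive)
    show "norm (y i) \<le> R" if "i < N" for i using that by (intro le) simp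
    show "(\<Sum>i<n. w i * (energy (\<delta> i) y N - 2 * R * norm (y N)))
        \<le> (\<Sum>j<n. w j * (\<Sum>k<N. - 2 * (anchor (\<delta> j) y k \<bullet> (y (Suc k) - y k))))"
      by (intro sum_mono mult_left_mono w anchor_gain_energy le)
  qed
  moreover have "(\<Sum>i<n. w i * (energy (\<delta> i) y N - 2 * R * norm (y N)))
      = (\<Sum>i<n. w i * energy (\<delta> i) y N) - (\<Sum>i<n. 2 * R * w i) * norm (y N)"
    by (simp add: sum_distrib_left sum_distrib_right sum_subtractf algebra_simps)
  moreover have "w j * energy (\<delta> j) y N \<le> (\<Sum>i<n. w i * energy (\<delta> i) y N)"
    using assms w by (intro member_le_sum) (auto intro!: mult_nonneg_nonneg energy_nonneg)
  moreover have "0 \<le> norm (y N) / R" using R by simp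
  ultimately show ?thesis
    using compensated_norm[of N] assms(2) by linarith
qed (rule gain_exit)

lemma gain_nonneg: "0 \<le> gain (position R \<kappa> w \<delta> n y) y N + \<kappa> * (1 \<bullet> y N)"
proof (cases "\<exists>i\<le>N. R < norm (y i)")
  case True
  from gain_exit[OF this] show ?thesis by simp
next
  case False
  then have "norm (y i) \<le> R" if "i < N" for i using that by (auto simp: not_less dest: less_imp_le)
  from gain_alive_ge[OF this] have "norm (y N) / R \<le> gain (position R \<kappa> w \<delta> n y) y N + \<kappa> * (1 \<bullet> y N)" .
  moreover have "0 \<le> norm (y N) / R" using R by simp
  ultimately show ?thesis by linarith
qed

end

lemma norm_position_le:
  fixes y :: "nat \<Rightarrow> real^'d::finite"
  assumes "0 \<le> R" "\<And>j. 0 \<le> w j" "0 \<le> \<kappa>"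
  shows "norm (position R \<kappa> w \<delta> n y k) \<le> (\<Sum>j<n. 2 * w j * R) + \<kappa> * norm (1 :: real^'d)"
proof (cases "\<forall>i\<le>k. norm (y i) \<le> R")
  case True
  have "norm (\<Sum>j<n. (- 2 * w j) *\<^sub>R anchor (\<delta> j) y k) \<le> (\<Sum>j<n. 2 * w j * R)"
    using True assms by (intro sum_norm_le) (auto simp: abs_mult intro!: mult_left_mono norm_anchor_le)
  with True assms show ?thesis
    by (simp add: position_def add_increasing2)
next
  case False
  then have "norm (position R \<kappa> w \<delta> n y k) = \<kappa> * norm (1 :: real^'d)"
    using assms by (auto simp: position_def)
  moreover have "0 \<le> (\<Sum>j<n. 2 * w j * R)"
    using assms by (intro sum_nonneg) auto
  ultimately show ?thesis by simp
qed

lemma borel_measurable_anchor: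
  fixes Y :: "nat \<Rightarrow> 'a \<Rightarrow> real^'d::finite"
  assumes "\<And>i. i \<le> k \<Longrightarrow> Y i \<in> borel_measurable M"
  shows "(\<lambda>\<omega>. anchor \<delta> (\<lambda>i. Y i \<omega>) k) \<in> borel_measurable M"
  using assms
proof (induction k)
  case (Suc k)
  have [measurable]: "(\<lambda>\<omega>. anchor \<delta> (\<lambda>i. Y i \<omega>) k) \<in> borel_measurable M"
    using Suc by simp
  have [measurable]: "Y (Suc k) \<in> borel_measurable M" using Suc.prems by simp
  show ?case unfolding anchor.simps by measurable
qed simp

lemma borel_measurable_position:
  fixes Y :: "nat \<Rightarrow> 'a \<Rightarrow> real^'d::finite"
  assumes Y: "\<And>i. i \<le> k \<Longrightarrow> Y i \<in> borel_measurable M"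
  shows "(\<lambda>\<omega>. position R \<kappa> w \<delta> n (\<lambda>i. Y i \<omega>) k) \<in> borel_measurable M"
proof -
  have anchor: "(\<lambda>\<omega>. anchor (\<delta> j) (\<lambda>i. Y i \<omega>) k) \<in> borel_measurable M" for j
    by (rule borel_measurable_anchor[OF Y])
  have "Measurable.pred M (\<lambda>\<omega>. \<forall>i\<in>{..k}. norm (Y i \<omega>) \<le> R)"
  proof (rule pred_intros_countable_bounded)
    fix i assume "i \<in> {..k}"
    then have [measurable]: "Y i \<in> borel_measurable M" using Y by simp
    show "Measurable.pred M (\<lambda>\<omega>. norm (Y i \<omega>) \<le> R)" by measurable
  qed
  then have "Measurable.pred M (\<lambda>\<omega>. \<forall>i\<le>k. norm (Y i \<omega>) \<le> R)"
    by (simp only: Ball_def atMost_iff)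
  then have "{\<omega> \<in> space M. \<forall>i\<le>k. norm (Y i \<omega>) \<le> R} \<in> sets M"
    by (simp only: pred_def)
  moreover have "(\<lambda>\<omega>. \<Sum>j<n. (- 2 * w j) *\<^sub>R anchor (\<delta> j) (\<lambda>i. Y i \<omega>) k) \<in> borel_measurable M"
    by (intro borel_measurable_sum borel_measurable_scaleR borel_measurable_const anchor)
  ultimately show ?thesis
    unfolding position_def by (intro measurable_If borel_measurable_const)
qed

section \<open>Measurability and strategies on a time grid\<close>

lemma continuous_map_path_mass:
  fixes \<Omega> :: "'d::finite path set"
  assumes T: "0 < T" and \<Omega>: "S_closed T \<Omega>" and s: "0 \<le> s" "0 \<le> d"
  shows "continuous_map (subtopology (S_topology T) \<Omega>) euclideanreal (\<lambda>\<omega>. path_mass T s d \<omega> $ i)"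
  unfolding continuous_map_closedin
proof (intro conjI allI impI)
  have \<Omega>': "closedin (S_topology T) \<Omega>" "\<Omega> \<subseteq> skorokhod_space T"
    using \<Omega> by (simp_all add: closedin_S_topology S_closed_def)
  then have top: "topspace (subtopology (S_topology T) \<Omega>) = \<Omega>" by auto
  fix C assume "closedin euclideanreal C"
  then have C: "closed C" by simp
  have "S_closed T {\<omega> \<in> \<Omega>. path_mass T s d \<omega> $ i \<in> C}"
    unfolding S_closed_def
  proof (intro conjI allI impI)
    show "{\<omega> \<in> \<Omega>. path_mass T s d \<omega> $ i \<in> C} \<subseteq> skorokhod_space T" using \<Omega>'(2) by auto
    fix \<nu> \<mu> assume *: "(\<forall>n. \<nu> n \<in> {\<omega> \<in> \<Omega>. path_mass T s d \<omega> $ i \<in> C}) \<and> S_converges T \<nu> \<mu>"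
    then have conv: "S_converges T \<nu> \<mu>" and mem: "\<And>n. \<nu> n \<in> \<Omega>" "\<And>n. path_mass T s d (\<nu> n) $ i \<in> C" by auto
    have "\<mu> \<in> \<Omega>" using \<Omega> conv mem(1) unfolding S_closed_def by (elim conjE allE[of _ \<nu>] allE[of _ \<mu>]) simp
    moreover have "path_mass T s d \<mu> $ i \<in> C"
      using tendsto_vec_nth[OF S_converges_path_mass[OF T conv s]]
      by (rule closed_sequentially[OF C mem(2)])
    ultimately show "\<mu> \<in> {\<omega> \<in> \<Omega>. path_mass T s d \<omega> $ i \<in> C}" by simp
  qed
  then show "closedin (subtopology (S_topology T) \<Omega>) {\<omega> \<in> topspace (subtopology (S_topology T) \<Omega>). path_mass T s d \<omega> $ i \<in> C}"
    unfolding top closedin_closed_subtopology[OF \<Omega>'(1)] closedin_S_topology by auto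
qed simp

lemma space_path_borel: "space (path_borel T \<Omega>) = \<Omega>"
  and sets_path_borel: "openin (S_star_topology T \<Omega>) U \<Longrightarrow> U \<in> sets (path_borel T \<Omega>)"
proof -
  have sub: "{U. openin (S_star_topology T \<Omega>) U} \<subseteq> Pow \<Omega>"
    using openin_subset[of "S_star_topology T \<Omega>"] by auto
  show "space (path_borel T \<Omega>) = \<Omega>"
    unfolding path_borel_def by (rule space_measure_of[OF sub])
  show "U \<in> sets (path_borel T \<Omega>)" if "openin (S_star_topology T \<Omega>) U"
    unfolding path_borel_def using that by (subst sets_measure_of[OF sub]) auto
qed

lemma borel_measurable_path_mass:
  fixes \<Omega> :: "'d::finite path set"
  assumes "0 < T" "S_closed T \<Omega>" "0 \<le> s" "0 \<le> d"
  shows "(\<lambda>\<omega>. path_mass T s d \<omega> $ i) \<in> borel_measurable (path_borel T \<Omega>)"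
proof (rule borel_measurableI)
  fix U :: "real set" assume "open U"
  then have "{\<omega> \<in> \<Omega>. path_mass T s d \<omega> $ i \<in> U} \<in>
    {{\<omega> \<in> \<Omega>. f \<omega> \<in> U} | f U. continuous_map (subtopology (S_topology T) \<Omega>) euclideanreal f \<and> open U}"
    by (intro CollectI exI[of _ "\<lambda>\<omega>. path_mass T s d \<omega> $ i"] exI[of _ U] conjI refl
        continuous_map_path_mass assms)
  then have "openin (S_star_topology T \<Omega>) {\<omega> \<in> \<Omega>. path_mass T s d \<omega> $ i \<in> U}"
    unfolding S_star_topology_def by (rule topology_generated_by_Basis)
  moreover have "(\<lambda>\<omega>. path_mass T s d \<omega> $ i) -` U \<inter> space (path_borel T \<Omega>) = {\<omega> \<in> \<Omega>. path_mass T s d \<omega> $ i \<in> U}"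
    by (auto simp: space_path_borel)
  ultimately show "(\<lambda>\<omega>. path_mass T s d \<omega> $ i) -` U \<inter> space (path_borel T \<Omega>) \<in> sets (path_borel T \<Omega>)"
    using sets_path_borel by (simp only:)
qed

text \<open>
Evaluations are limits of local averages, which are continuous. So they are Borel although they
are not continuous in general.
\<close>

lemma borel_measurable_evaluation:
  fixes \<Omega> :: "'d::finite path set"
  assumes T: "0 < T" and \<Omega>: "S_closed T \<Omega>" and t: "t \<in> {0..T}"
  shows "(\<lambda>\<omega>. \<omega> t) \<in> borel_measurable (path_borel T \<Omega>)"
proof -
  have comp: "(\<lambda>\<omega>. \<omega> t $ i) \<in> borel_measurable (path_borel T \<Omega>)" for i
  proof (rule borel_measurable_LIMSEQ_metric)
    show "(\<lambda>\<omega>. (1 / (1 / real (Suc n))) * path_mass T t (1 / real (Suc n)) \<omega> $ i) \<in> borel_measurable (path_borel T \<Omega>)" for n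
      using t by (intro borel_measurable_times borel_measurable_const borel_measurable_path_mass T \<Omega>) auto
    fix \<omega> assume "\<omega> \<in> space (path_borel T \<Omega>)"
    then have w: "\<omega> \<in> skorokhod_space T" using \<Omega> by (auto simp: space_path_borel S_closed_def)
    have "(\<lambda>n. (1 / (1 / real (Suc n))) *\<^sub>R path_mass T t (1 / real (Suc n)) \<omega>) \<longlonglongrightarrow> \<omega> (min t T)"
      by (rule path_average_sequence[OF T w]) (use t in simp)
    from tendsto_vec_nth[OF this, of i]
    show "(\<lambda>n. (1 / (1 / real (Suc n))) * path_mass T t (1 / real (Suc n)) \<omega> $ i) \<longlonglongrightarrow> \<omega> t $ i"
      using t by simp
  qed
  show ?thesis
    unfolding borel_measurable_euclidean_space[of "\<lambda>\<omega>. \<omega> t"]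
  proof
    fix b :: "real^'d" assume "b \<in> Basis"
    then obtain i where "b = axis i 1" by (auto simp: Basis_vec_def)
    then show "(\<lambda>\<omega>. \<omega> t \<bullet> b) \<in> borel_measurable (path_borel T \<Omega>)"
      using comp[of i] by (simp add: inner_axis)
  qed
qed

text \<open>
By right-continuity the supremum may be taken over the rational times and \<open>T\<close>.
\<close>

lemma borel_measurable_sup_norm:
  fixes \<Omega> :: "'d::finite path set"
  assumes T: "0 < T" and \<Omega>: "S_closed T \<Omega>"
  shows "sup_norm T \<in> borel_measurable (path_borel T \<Omega>)"
proof -
  define Q where "Q = insert T (range of_rat \<inter> {0..T})"
  have Q: "countable Q" "Q \<subseteq> {0..T}" "Q \<noteq> {}" using T by (auto simp: Q_def)
  have bdd: "bdd_above ((\<lambda>t. norm (\<omega> t)) ` {0..T})" if "\<omega> \<in> \<Omega>" for \<omega>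
    using skorokhod_bounded[of \<omega> T] that \<Omega> by (auto simp: S_closed_def bounded_iff bdd_above_def)
  have bddQ: "bdd_above ((\<lambda>t. norm (\<omega> t)) ` Q)" if "\<omega> \<in> \<Omega>" for \<omega>
    by (rule bdd_above_mono[OF bdd[OF that]]) (use Q in auto)
  have eq: "sup_norm T \<omega> = (SUP t\<in>Q. norm (\<omega> t))" if w: "\<omega> \<in> \<Omega>" for \<omega>
  proof (rule antisym)
    have sk: "\<omega> \<in> skorokhod_space T" using w \<Omega> by (auto simp: S_closed_def)
    show "(SUP t\<in>Q. norm (\<omega> t)) \<le> sup_norm T \<omega>"
      unfolding sup_norm_def by (rule cSUP_subset_mono[OF Q(3) bdd[OF w] Q(2)]) simp
    show "sup_norm T \<omega> \<le> (SUP t\<in>Q. norm (\<omega> t))"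
      unfolding sup_norm_def
    proof (rule cSUP_least)
      fix t assume t: "t \<in> {0..T}"
      show "norm (\<omega> t) \<le> (SUP t\<in>Q. norm (\<omega> t))"
      proof (cases "t = T")
        case True
        then show ?thesis by (intro cSUP_upper bddQ w) (simp add: Q_def)
      next
        case False
        then have tT: "t < T" using t by simp
        show ?thesis
        proof (rule ccontr)
          assume "\<not> ?thesis"
          then have "(SUP t\<in>Q. norm (\<omega> t)) < norm (\<omega> t)" by simp
          moreover have "((\<lambda>u. norm (\<omega> u)) \<longlongrightarrow> norm (\<omega> t)) (at_right t)"
            using sk t tT by (intro tendsto_norm) (simp add: skorokhod_space_def)
          ultimately have "\<forall>\<^sub>F u in at_right t. (SUP t\<in>Q. norm (\<omega> t)) < norm (\<omega> u)"
            by (intro order_tendstoD)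
          then obtain b where b: "b > t" "\<And>u. t < u \<Longrightarrow> u < b \<Longrightarrow> (SUP t\<in>Q. norm (\<omega> t)) < norm (\<omega> u)"
            unfolding eventually_at_right[OF tT] by blast
          obtain c :: rat where c: "t < of_rat c" "of_rat c < min b T"
            using of_rat_dense[of t "min b T"] b(1) tT by auto
          then have "of_rat c \<in> Q"
            using t unfolding Q_def by (intro insertI2 IntI rangeI) (simp only: atLeastAtMost_iff, linarith)
          then have "norm (\<omega> (of_rat c)) \<le> (SUP t\<in>Q. norm (\<omega> t))"
            by (intro cSUP_upper bddQ w)
          with b(2)[OF c(1)] c(2) show False by simp
        qed
      qed
    qed (use T in simp)
  qed
  have "(\<lambda>\<omega>. norm (\<omega> t)) \<in> borel_measurable (path_borel T \<Omega>)" if "t \<in> Q" for t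
    by (rule measurable_compose[OF borel_measurable_evaluation[OF T \<Omega>] borel_measurable_norm]) (use that Q(2) in auto)
  then have "(\<lambda>\<omega>. SUP t\<in>Q. norm (\<omega> t)) \<in> borel_measurable (path_borel T \<Omega>)"
    using Q(1) bddQ by (intro borel_measurable_cSUP) (simp_all add: space_path_borel)
  then show ?thesis
    by (subst measurable_cong[OF eq]) (simp_all add: space_path_borel)
qed

lemma raw_filtration_evaluation:
  assumes "s \<in> {0..t}"
  shows "(\<lambda>\<omega>. \<omega> s) \<in> borel_measurable (raw_filtration \<Omega> t)"
proof (rule measurableI)
  fix A :: "(real^'a) set" assume "A \<in> sets borel"
  then have "(\<lambda>\<omega>. \<omega> s) -` A \<inter> \<Omega> \<in> {(\<lambda>\<omega>. \<omega> s) -` A \<inter> \<Omega> | s A. s \<in> {0..t} \<and> A \<in> sets borel}"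
    using assms by blast
  then show "(\<lambda>\<omega>. \<omega> s) -` A \<inter> space (raw_filtration \<Omega> t) \<in> sets (raw_filtration \<Omega> t)"
    unfolding space_raw_filtration unfolding raw_filtration_def
    by (subst sets_measure_of) auto
qed simp

text \<open>
For deterministic stopping times, measurability with respect to the pre-sigma-algebra reduces to
measurability at a fixed time. This is why the strategies below trade on a deterministic grid.
\<close>

lemma pre_sigma_const_measurable:
  fixes \<Omega> :: "'d::finite path set" and f :: "'d path \<Rightarrow> 'a::topological_space"
  assumes T: "0 < T" and u: "0 \<le> u" and f: "f \<in> borel_measurable (raw_filtration \<Omega> (min u T))"
  shows "f \<in> borel_measurable (filtration.pre_sigma \<Omega> (path_filtration T \<Omega>) (\<lambda>_. ennreal u))"
proof -
  interpret filtration \<Omega> "path_filtration T \<Omega>" by (rule filtration_path_filtration)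
  have "sets (raw_filtration \<Omega> v) \<subseteq> sets (right_filtration T \<Omega> v)" if "v \<le> T" for v
  proof (cases "v < T")
    case True
    then show ?thesis
      unfolding sets_right_filtration[OF True] by (intro INT_greatest sets_raw_filtration_mono) simp
  next
    case False
    then show ?thesis using that by (simp add: right_filtration_def)
  qed
  then have raw: "sets (raw_filtration \<Omega> (min u T)) \<subseteq> sets (path_filtration T \<Omega> (ennreal u))"
    using T u by (simp add: path_filtration_def min_ennreal)
  have pre: "A \<in> sets (pre_sigma (\<lambda>_. ennreal u))" if A: "A \<in> sets (path_filtration T \<Omega> (ennreal u))" for A
  proof (rule sets_pre_sigmaI[OF stopping_time_const])
    show "{\<omega> \<in> A. ennreal u \<le> t} \<in> sets (path_filtration T \<Omega> t)" for t
      using sets_F_mono[of "ennreal u" t] A by (cases "ennreal u \<le> t") auto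
  qed
  show ?thesis
  proof (rule measurableI)
    fix B :: "'a set" assume "B \<in> sets borel"
    from measurable_sets[OF f this] have "f -` B \<inter> \<Omega> \<in> sets (raw_filtration \<Omega> (min u T))"
      by (simp only: space_raw_filtration)
    then show "f -` B \<inter> space (pre_sigma (\<lambda>_. ennreal u)) \<in> sets (pre_sigma (\<lambda>_. ennreal u))"
      unfolding space_pre_sigma by (intro pre subsetD[OF raw])
  qed simp
qed

text \<open>
The grid goes on beyond \<open>T\<close>, where paths have no meaningful values; therefore the times are capped
at \<open>T\<close> in the coefficients. The index \<open>n\<close> is both the fineness of the grid and the number of
anchor strategies.
\<close>

definition grid_integrand ::
  "real \<Rightarrow> real \<Rightarrow> real \<Rightarrow> (nat \<Rightarrow> real) \<Rightarrow> (nat \<Rightarrow> real) \<Rightarrow> nat \<Rightarrow> 'd::finite integrand" where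
  "grid_integrand T R \<kappa> w \<delta> n =
     (\<lambda>k \<omega>. ennreal (grid T n k), \<lambda>k \<omega>. position R \<kappa> w \<delta> n (\<lambda>i. \<omega> (min (grid T n i) T)) k)"

text \<open>
Up to time \<open>t\<close> the integral is the gain along the path stopped at \<open>t\<close>: a coefficient depends only
on the past, and where the stopped path differs from the path it no longer moves. Thus the
discrete estimates apply at all intermediate times.
\<close>

lemma simple_integral_grid:
  fixes \<omega> :: "'d::finite path" and n :: nat
  assumes T: "0 < T" and t: "t \<in> {0..T}"
  defines "z \<equiv> \<lambda>i. \<omega> (min (grid T n i) t)"
  shows "simple_integral (grid_integrand T R \<kappa> w \<delta> n) t \<omega> = gain (position R \<kappa> w \<delta> n z) z (Suc n)"
proof -
  define h where "h k = position R \<kappa> w \<delta> n (\<lambda>i. \<omega> (min (grid T n i) T)) k" for k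
  have gpos: "0 \<le> grid T n k" for k using grid_mono[of T 0 k n] T by simp
  have stop: "stop_at (\<lambda>\<omega>. ennreal (grid T n k)) t \<omega> = min (grid T n k) t" for k
    using gpos t by (simp add: stop_at_def min_ennreal)
  have "simple_integral (grid_integrand T R \<kappa> w \<delta> n) t \<omega> = (\<Sum>k. h k \<bullet> (z (Suc k) - z k))"
    by (simp add: simple_integral_def grid_integrand_def stop h_def z_def)
  also have "\<dots> = (\<Sum>k<Suc n. h k \<bullet> (z (Suc k) - z k))"
  proof (rule suminf_finite)
    fix k assume "k \<notin> {..<Suc n}"
    then have "T \<le> grid T n k" "T \<le> grid T n (Suc k)"
      using grid_mono[of T "Suc n" k n] grid_mono[of T "Suc n" "Suc k" n] T by auto
    then show "h k \<bullet> (z (Suc k) - z k) = 0"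
      using t by (simp add: z_def min_absorb2)
  qed simp
  also have "\<dots> = (\<Sum>k<Suc n. position R \<kappa> w \<delta> n z k \<bullet> (z (Suc k) - z k))"
  proof (rule sum.cong[OF refl])
    fix k
    show "h k \<bullet> (z (Suc k) - z k) = position R \<kappa> w \<delta> n z k \<bullet> (z (Suc k) - z k)"
    proof (cases "grid T n k \<le> t")
      case True
      have "\<omega> (min (grid T n i) T) = z i" if "i \<le> k" for i
        using grid_mono[OF _ that, of T n] True t T by (simp add: z_def min_absorb1)
      then have "h k = position R \<kappa> w \<delta> n z k"
        unfolding h_def by (rule position_cong)
      then show ?thesis by simp
    next
      case False
      then have "z (Suc k) = z k"
        using grid_mono[of T k "Suc k" n] T by (simp add: z_def min_absorb2)
      then show ?thesis by simp
    qed
  qed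
  finally show ?thesis by (simp add: gain_def)
qed

section \<open>Admissibility and the limit of refining grids\<close>

lemma S_closed_skorokhod: "S_closed T \<Omega> \<Longrightarrow> \<omega> \<in> \<Omega> \<Longrightarrow> \<omega> \<in> skorokhod_space T"
  by (auto simp: S_closed_def)

lemma grid_integral_ge:
  fixes \<omega> :: "'d::finite path"
  assumes T: "0 < T" and w: "\<omega> \<in> skorokhod_space T" and t: "t \<in> {0..T}"
    and R: "0 < R" and weights: "\<And>j. 0 \<le> w j" "1 / R + (\<Sum>j<n. 2 * R * w j) \<le> \<kappa>"
  shows "- (\<kappa> * real CARD('d) * sup_norm T \<omega>) \<le> simple_integral (grid_integrand T R \<kappa> w \<delta> n) t \<omega>"
proof -
  define z where "z i = \<omega> (min (grid T n i) t)" for i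
  have nonneg: "0 \<le> \<omega> u $ i" if "u \<in> {0..T}" for u i
    using w that by (simp add: skorokhod_space_def)
  have "min (grid T n i) t \<in> {0..T}" for i
    using grid_mono[of T 0 i n] T t by auto
  then have z: "0 \<le> z i $ j" for i j unfolding z_def by (rule nonneg)
  have \<kappa>: "0 \<le> \<kappa>"
  proof -
    have "0 \<le> 1 / R + (\<Sum>j<n. 2 * R * w j)"
      using R weights(1) by (intro add_nonneg_nonneg sum_nonneg) auto
    then show ?thesis using weights(2) by simp
  qed
  have "z (Suc n) = \<omega> t" using t by (simp add: z_def)
  then have "0 \<le> gain (position R \<kappa> w \<delta> n z) z (Suc n) + \<kappa> * (1 \<bullet> \<omega> t)"
    using gain_nonneg[where R=R and \<kappa>=\<kappa> and w=w and \<delta>=\<delta> and n=n and y=z and N="Suc n", OF R weights z] by simp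
  moreover have "\<kappa> * (1 \<bullet> \<omega> t) \<le> \<kappa> * (real CARD('d) * sup_norm T \<omega>)"
  proof (rule mult_left_mono[OF _ \<kappa>])
    have "1 \<bullet> \<omega> t \<le> real CARD('d) * norm (\<omega> t)"
      using nonneg[OF t] by (rule norm_le_inner_one)
    also have "\<dots> \<le> real CARD('d) * sup_norm T \<omega>"
      by (intro mult_left_mono norm_le_sup_norm skorokhod_bounded w t) simp
    finally show "1 \<bullet> \<omega> t \<le> real CARD('d) * sup_norm T \<omega>" .
  qed
  moreover have "simple_integral (grid_integrand T R \<kappa> w \<delta> n) t \<omega> = gain (position R \<kappa> w \<delta> n z) z (Suc n)"
    unfolding z_def by (rule simple_integral_grid[OF T t])
  ultimately show ?thesis by (simp add: mult.assoc)
qed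

lemma borel_growthI:
  fixes f :: "'d::finite path \<Rightarrow> real"
  assumes f: "f \<in> borel_measurable (path_borel T \<Omega>)" and le: "\<And>\<omega>. \<omega> \<in> \<Omega> \<Longrightarrow> \<bar>f \<omega>\<bar> \<le> C * (1 + sup_norm T \<omega> powr r)"
  shows "(\<lambda>\<omega>. ereal (f \<omega>)) \<in> borel_growth T \<Omega> r"
proof -
  have "\<bar>ereal (f \<omega>) / ereal (1 + sup_norm T \<omega> powr r)\<bar> \<le> ereal C" if "\<omega> \<in> \<Omega>" for \<omega>
  proof -
    have "0 < 1 + sup_norm T \<omega> powr r" by (simp add: add_pos_nonneg)
    then show ?thesis
      using le[OF that] by (simp add: abs_divide pos_divide_le_eq)
  qed
  moreover have "(\<lambda>\<omega>. ereal (f \<omega>)) \<in> borel_fun T \<Omega>"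
    unfolding borel_fun_def using f by (rule borel_measurable_ereal)
  ultimately show ?thesis
    unfolding borel_growth_def by blast
qed

lemma sup_norm_growth:
  fixes \<Omega> :: "'d::finite path set"
  assumes T: "0 < T" and \<Omega>: "S_closed T \<Omega>" and q: "1 \<le> q" and c: "0 \<le> c"
  shows "(\<lambda>\<omega>. ereal (c * sup_norm T \<omega>)) \<in> borel_growth_nonneg T \<Omega> q"
proof -
  have pos: "0 \<le> sup_norm T \<omega>" if "\<omega> \<in> \<Omega>" for \<omega>
    using order_trans[OF norm_ge_zero norm_le_sup_norm[OF skorokhod_bounded[OF S_closed_skorokhod[OF \<Omega> that]], of 0]] T
    by simp
  have "(\<lambda>\<omega>. ereal (c * sup_norm T \<omega>)) \<in> borel_growth T \<Omega> q"
  proof (rule borel_growthI)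
    show "(\<lambda>\<omega>. c * sup_norm T \<omega>) \<in> borel_measurable (path_borel T \<Omega>)"
      by (intro borel_measurable_times borel_measurable_const borel_measurable_sup_norm T \<Omega>)
    fix \<omega> assume w: "\<omega> \<in> \<Omega>"
    have "sup_norm T \<omega> \<le> 1 + sup_norm T \<omega> powr q"
    proof (cases "sup_norm T \<omega> \<le> 1")
      case False
      then have "sup_norm T \<omega> powr 1 \<le> sup_norm T \<omega> powr q" using q by (intro powr_mono) auto
      then show ?thesis using False by simp
    qed (simp add: add_increasing2)
    then show "\<bar>c * sup_norm T \<omega>\<bar> \<le> c * (1 + sup_norm T \<omega> powr q)"
      using c pos[OF w] by (simp add: abs_mult mult_left_mono)
  qed
  then show ?thesis
    using c pos by (simp add: borel_growth_nonneg_def)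
qed

lemma grid_integrand_simple:
  fixes \<Omega> :: "'d::finite path set"
  assumes T: "0 < T" and \<Omega>: "S_closed T \<Omega>" and R: "0 \<le> R" and w: "\<And>j. 0 \<le> w j" and \<kappa>: "0 \<le> \<kappa>"
  shows "simple_integrand T \<Omega> q (grid_integrand T R \<kappa> w \<delta> n)"
proof -
  have gpos: "0 \<le> grid T n k" for k using grid_mono[of T 0 k n] T by simp
  have mem: "min (grid T n i) T \<in> {0..T}" for i using gpos[of i] T by simp
  have h_le: "norm (position R \<kappa> w \<delta> n y k) \<le> (\<Sum>j<n. 2 * w j * R) + \<kappa> * norm (1 :: real^'d)" for y :: "nat \<Rightarrow> real^'d" and k
    by (rule norm_position_le[OF R w \<kappa>])
  show ?thesis
    unfolding simple_integrand_def grid_integrand_def split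
  proof (intro conjI allI ballI)
    show "stopping_time (path_filtration T \<Omega>) (\<lambda>\<omega>. ennreal (grid T n k))" for k
      by (rule stopping_time_const)
    show "ennreal (grid T n k) \<le> ennreal (grid T n (Suc k))" for k
      using T by (intro ennreal_leI grid_mono) auto
    show "\<exists>k. ennreal T \<le> ennreal (grid T n k)"
      by (rule exI[of _ "Suc n"]) simp
    show "(\<lambda>\<omega>. position R \<kappa> w \<delta> n (\<lambda>i. \<omega> (min (grid T n i) T)) k)
        \<in> borel_measurable (filtration.pre_sigma \<Omega> (path_filtration T \<Omega>) (\<lambda>\<omega>. ennreal (grid T n k)))" for k
    proof (intro pre_sigma_const_measurable T gpos borel_measurable_position raw_filtration_evaluation)
      fix i assume "i \<le> k"
      then have "grid T n i \<le> grid T n k" using T by (intro grid_mono) auto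
      then show "min (grid T n i) T \<in> {0..min (grid T n k) T}" using gpos[of i] T by auto
    qed
    show "(\<lambda>\<omega>. ereal (position R \<kappa> w \<delta> n (\<lambda>i. \<omega> (min (grid T n i) T)) k $ i)) \<in> borel_growth T \<Omega> (q - 1)" for k i
    proof (rule borel_growthI)
      have "(\<lambda>\<omega>. position R \<kappa> w \<delta> n (\<lambda>i. \<omega> (min (grid T n i) T)) k) \<in> borel_measurable (path_borel T \<Omega>)"
        by (intro borel_measurable_position borel_measurable_evaluation T \<Omega> mem)
      then have "(\<lambda>\<omega>. position R \<kappa> w \<delta> n (\<lambda>i. \<omega> (min (grid T n i) T)) k \<bullet> axis i 1) \<in> borel_measurable (path_borel T \<Omega>)"
        by (intro borel_measurable_inner borel_measurable_const)
      then show "(\<lambda>\<omega>. position R \<kappa> w \<delta> n (\<lambda>i. \<omega> (min (grid T n i) T)) k $ i) \<in> borel_measurable (path_borel T \<Omega>)"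
        by (simp add: inner_axis)
      fix \<omega> :: "'d path"
      let ?C = "(\<Sum>j<n. 2 * w j * R) + \<kappa> * norm (1 :: real^'d)"
      let ?h = "position R \<kappa> w \<delta> n (\<lambda>i. \<omega> (min (grid T n i) T)) k"
      have "\<bar>?h $ i\<bar> \<le> ?C"
        using component_le_norm_cart[of ?h i] h_le by (rule order_trans)
      also have "\<dots> \<le> ?C * (1 + sup_norm T \<omega> powr (q - 1))"
      proof -
        have "0 \<le> ?C" using order_trans[OF norm_ge_zero h_le] .
        then have "0 \<le> ?C * (sup_norm T \<omega> powr (q - 1))" by simp
        then show ?thesis by (simp only: distrib_left mult_1_right le_add_same_cancel1)
      qed
      finally show "\<bar>?h $ i\<bar> \<le> ?C * (1 + sup_norm T \<omega> powr (q - 1))" .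
    qed
  qed
qed

lemma grid_integrands_admissible:
  fixes \<Omega> :: "'d::finite path set"
  assumes T: "0 < T" and \<Omega>: "S_closed T \<Omega>" and q: "1 \<le> q" and R: "0 < R"
    and weights: "\<And>j. 0 \<le> w j" "\<And>n. 1 / R + (\<Sum>j<n. 2 * R * w j) \<le> \<kappa>"
  shows "(\<lambda>n. grid_integrand T R \<kappa> w \<delta> n) \<in> admissible T \<Omega> q"
proof -
  let ?\<Lambda> = "\<lambda>\<omega>. ereal (\<kappa> * real CARD('d) * sup_norm T \<omega>)"
  have \<kappa>: "0 \<le> \<kappa>" using weights(2)[of 0] R by (simp add: order_trans[of 0 "1 / R"])
  then have \<Lambda>: "?\<Lambda> \<in> borel_growth_nonneg T \<Omega> q"
    by (intro sup_norm_growth T \<Omega> q) simp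
  have lower: "- ?\<Lambda> \<omega> \<le> ereal (simple_integral (grid_integrand T R \<kappa> w \<delta> n) t \<omega>)"
    if "\<omega> \<in> \<Omega>" "t \<in> {0..T}" for n t \<omega>
    using grid_integral_ge[OF T S_closed_skorokhod[OF \<Omega> that(1)] that(2) R weights(1) weights(2)[of n]] by simp
  have stop: "stop_at \<tau> t \<omega> \<in> {0..T}" if "t \<in> {0..T}" for \<tau> t and \<omega> :: "'d path"
  proof -
    have "enn2real (min (\<tau> \<omega>) (ennreal t)) \<le> enn2real (ennreal t)"
      by (intro enn2real_mono) auto
    then show ?thesis using that by (simp add: stop_at_def)
  qed
  have "grid_integrand T R \<kappa> w \<delta> n \<in> simple_admissible T \<Omega> q" for n
    unfolding simple_admissible_def mem_Collect_eq
    using grid_integrand_simple[OF T \<Omega> less_imp_le[OF R] weights(1) \<kappa>] lower stop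
    by (intro conjI bexI[OF _ \<Lambda>]) auto
  with lower show ?thesis
    unfolding admissible_def mem_Collect_eq by (intro conjI bexI[OF _ \<Lambda>]) auto
qed

text \<open>
The first grid point at or after \<open>t\<close>. Approaching \<open>t\<close> from the right makes the values of a path
converge.
\<close>

definition grid_index :: "real \<Rightarrow> nat \<Rightarrow> real \<Rightarrow> nat" where
  "grid_index T n t = nat \<lceil>t * real (Suc n) / T\<rceil>"

lemma grid_index:
  assumes T: "0 < T" and t: "t \<in> {0..T}"
  shows "t \<le> grid T n (grid_index T n t)" "grid T n (grid_index T n t) < t + T / real (Suc n)"
    "grid_index T n t \<le> Suc n"
proof -
  define N where "N = real (Suc n)"
  have N: "N > 0" by (simp add: N_def)
  define x where "x = t * N / T"
  have x: "0 \<le> x" using t T N by (simp add: x_def)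
  have g: "grid T n (grid_index T n t) = real_of_int \<lceil>x\<rceil> * T / N"
    using x by (simp add: grid_def grid_index_def x_def N_def)
  have tx: "t = x * T / N" using N T by (simp add: x_def)
  have "x * T / N \<le> real_of_int \<lceil>x\<rceil> * T / N"
    using T N by (intro divide_right_mono mult_right_mono) auto
  then show "t \<le> grid T n (grid_index T n t)" unfolding g using tx by simp
  have "real_of_int \<lceil>x\<rceil> < x + 1" by linarith
  then have "real_of_int \<lceil>x\<rceil> * T / N < (x + 1) * T / N"
    using T N by (intro divide_strict_right_mono mult_strict_right_mono) auto
  also have "\<dots> = t + T / N" using tx by (simp add: distrib_right add_divide_distrib)
  finally show "grid T n (grid_index T n t) < t + T / real (Suc n)" unfolding g N_def .
  have "x \<le> N" using t T N by (simp add: x_def pos_divide_le_eq mult.commute)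
  then have "\<lceil>x\<rceil> \<le> int (Suc n)" by (simp add: N_def ceiling_le_iff)
  then have "nat \<lceil>x\<rceil> \<le> Suc n" by (simp only: nat_le_iff)
  then show "grid_index T n t \<le> Suc n" by (simp only: grid_index_def x_def N_def)
qed

lemma grid_index_tendsto:
  assumes T: "0 < T" and t: "t \<in> {0..T}"
  shows "(\<lambda>n. grid T n (grid_index T n t)) \<longlonglongrightarrow> t"
proof (rule tendsto_sandwich)
  show "(\<lambda>n. t) \<longlonglongrightarrow> t" by simp
  have "(\<lambda>n. t + T * (1 / real (Suc n))) \<longlonglongrightarrow> t + T * 0"
    by (intro tendsto_intros LIMSEQ_Suc[OF lim_1_over_n])
  then show "(\<lambda>n. t + T / real (Suc n)) \<longlonglongrightarrow> t" by simp
qed (use grid_index[OF T t] in \<open>auto intro!: always_eventually less_imp_le\<close>)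

lemma path_grid_tendsto:
  assumes T: "0 < T" and w: "\<omega> \<in> skorokhod_space T" and t: "t \<in> {0..T}"
  shows "(\<lambda>n. \<omega> (min (grid T n (grid_index T n t)) T)) \<longlonglongrightarrow> \<omega> t"
proof (rule tendstoI)
  fix e :: real assume e: "e > 0"
  have lim: "((\<lambda>u. \<omega> (min u T)) \<longlongrightarrow> \<omega> (min t T)) (at_right t)"
    using t by (intro skorokhod_right_limit w) simp
  have "min t T = t" using t by simp
  with tendstoD[OF lim e] obtain b where b: "b > t" "\<And>u. t < u \<Longrightarrow> u < b \<Longrightarrow> dist (\<omega> (min u T)) (\<omega> t) < e"
    unfolding eventually_at_right[of t "t + 1", simplified] by auto
  have "\<forall>\<^sub>F n in sequentially. grid T n (grid_index T n t) < b"
    by (rule order_tendstoD(2)[OF grid_index_tendsto[OF T t] b(1)])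
  then show "\<forall>\<^sub>F n in sequentially. dist (\<omega> (min (grid T n (grid_index T n t)) T)) (\<omega> t) < e"
  proof eventually_elim
    case (elim n)
    then show ?case
      using b(2)[of "grid T n (grid_index T n t)"] grid_index(1)[OF T t, of n] e \<open>min t T = t\<close>
      by (cases "grid T n (grid_index T n t) = t") auto
  qed
qed

text \<open>
Every fine enough grid sees finitely many given oscillations, since their pairs can be shifted to
the right onto the grid.
\<close>

lemma oscillates_grid:
  fixes \<omega> :: "'d::finite path"
  assumes T: "0 < T" and w: "\<omega> \<in> skorokhod_space T" and \<delta>: "0 \<le> \<delta>" and osc: "oscillates T (2 * \<delta>) m \<omega>"
  shows "\<forall>\<^sub>F n in sequentially. real m * \<delta>\<^sup>2 \<le> energy \<delta> (\<lambda>i. \<omega> (min (grid T n i) T)) (Suc n)"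
proof -
  obtain s t where st: "\<And>k. k < m \<Longrightarrow> 0 \<le> s k \<and> s k < t k \<and> t k \<le> T \<and> 2 * \<delta> < norm (\<omega> (t k) - \<omega> (s k))"
    "\<And>k. Suc k < m \<Longrightarrow> t k < s (Suc k)"
    using osc unfolding oscillates_def by blast
  have mem: "s k \<in> {0..T}" "t k \<in> {0..T}" if "k < m" for k
    using st(1)[OF that] by auto
  let ?g = "\<lambda>n u. grid T n (grid_index T n u)"
  have before: "\<forall>\<^sub>F n in sequentially. grid_index T n u < grid_index T n v" if "u \<in> {0..T}" "v \<in> {0..T}" "u < v" for u v
  proof -
    have "\<forall>\<^sub>F n in sequentially. ?g n u < (u + v) / 2"
      by (rule order_tendstoD(2)[OF grid_index_tendsto[OF T that(1)]]) (use that in simp)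
    moreover have "\<forall>\<^sub>F n in sequentially. (u + v) / 2 < ?g n v"
      by (rule order_tendstoD(1)[OF grid_index_tendsto[OF T that(2)]]) (use that in simp)
    ultimately show ?thesis
    proof eventually_elim
      case (elim n)
      then show ?case
        using grid_mono[of T "grid_index T n v" "grid_index T n u" n] T by linarith
    qed
  qed
  have "\<forall>\<^sub>F n in sequentially. \<forall>k\<in>{..<m}. 2 * \<delta> < norm (\<omega> (min (?g n (t k)) T) - \<omega> (min (?g n (s k)) T))"
  proof (intro eventually_ball_finite ballI)
    fix k assume "k \<in> {..<m}"
    then have k: "k < m" by simp
    show "\<forall>\<^sub>F n in sequentially. 2 * \<delta> < norm (\<omega> (min (?g n (t k)) T) - \<omega> (min (?g n (s k)) T))"
      by (rule order_tendstoD(1)[OF tendsto_norm[OF tendsto_diff[OF path_grid_tendsto path_grid_tendsto]]])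
        (use T w mem[OF k] st(1)[OF k] in auto)
  qed simp
  moreover have "\<forall>\<^sub>F n in sequentially. \<forall>k\<in>{..<m}. grid_index T n (s k) < grid_index T n (t k)"
    using mem st(1) by (intro eventually_ball_finite ballI before) auto
  moreover have "\<forall>\<^sub>F n in sequentially. \<forall>k\<in>{k. Suc k < m}. grid_index T n (t k) < grid_index T n (s (Suc k))"
  proof (intro eventually_ball_finite ballI)
    show "finite {k. Suc k < m}" by (rule finite_subset[of _ "{..<m}"]) auto
    fix k assume "k \<in> {k. Suc k < m}"
    then have k: "Suc k < m" "k < m" by simp_all
    show "\<forall>\<^sub>F n in sequentially. grid_index T n (t k) < grid_index T n (s (Suc k))"
      by (intro before mem k st(2))
  qed
  ultimately show ?thesis
  proof eventually_elim
    case (elim n)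
    show ?case
    proof (rule energy_pairs[OF \<delta>, where i = "\<lambda>k. grid_index T n (s k)" and j = "\<lambda>k. grid_index T n (t k)"])
      show "grid_index T n (s k) < grid_index T n (t k) \<and> grid_index T n (t k) \<le> Suc n \<and>
          2 * \<delta> < norm (\<omega> (min (?g n (t k)) T) - \<omega> (min (?g n (s k)) T))" if "k < m" for k
        using elim that grid_index(3)[OF T mem(2)[OF that]] by simp
      show "grid_index T n (t k) \<le> grid_index T n (s (Suc k))" if "Suc k < m" for k
        using elim that by (simp add: less_imp_le)
    qed
  qed
qed

text \<open>
Every untame path is detected on all fine enough grids, either by its exit or by its oscillation
at some level \<open>j\<close>, for which the \<open>n\<close>-th integrand contains the matching anchor strategy as soon as
\<open>j < n\<close>. Passing to the limit inferior superhedges the union over all levels, although each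
integrand accounts for finitely many.
\<close>

lemma liminf_grid_integral_ge:
  fixes \<Omega> :: "'d::finite path set"
  assumes T: "0 < T" and \<Omega>: "S_closed T \<Omega>" and R: "0 < R"
    and weights: "\<And>j. 0 \<le> w j" "\<And>n. 1 / R + (\<Sum>j<n. 2 * R * w j) \<le> \<kappa>"
    and \<delta>: "\<And>j. \<delta> j = 1 / (2 * real (Suc j))" and m: "\<And>j. 1 \<le> w j * (real (m j) * (\<delta> j)\<^sup>2)"
    and \<omega>: "\<omega> \<in> \<Omega>"
  shows "ereal (indicator (\<Omega> - tame_paths T \<Omega> R m) \<omega> - \<kappa> * (1 \<bullet> \<omega> T))
    \<le> liminf_integral (\<lambda>n. grid_integrand T R \<kappa> w \<delta> n) T \<omega>"
proof -
  have sk: "\<omega> \<in> skorokhod_space T" by (rule S_closed_skorokhod[OF \<Omega> \<omega>])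
  define z where "z n i = \<omega> (min (grid T n i) T)" for n i
  have "min (grid T n i) T \<in> {0..T}" for n i
    using grid_mono[of T 0 i n] T by auto
  then have z: "0 \<le> z n i $ k" for n i k
    using sk by (simp add: z_def skorokhod_space_def)
  define g where "g n = gain (position R \<kappa> w \<delta> n (z n)) (z n) (Suc n)" for n
  have end_value: "z n (Suc n) = \<omega> T" for n by (simp add: z_def)
  have integral: "simple_integral (grid_integrand T R \<kappa> w \<delta> n) T \<omega> = g n" for n
    unfolding g_def z_def using T by (intro simple_integral_grid) auto
  have "\<forall>\<^sub>F n in sequentially. indicator (\<Omega> - tame_paths T \<Omega> R m) \<omega> - \<kappa> * (1 \<bullet> \<omega> T) \<le> g n"
  proof (cases "\<omega> \<in> tame_paths T \<Omega> R m")
    case True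
    have "- (\<kappa> * (1 \<bullet> \<omega> T)) \<le> g n" for n
      using gain_nonneg[where R=R and \<kappa>=\<kappa> and w=w and \<delta>=\<delta> and n=n and y="z n" and N="Suc n", OF R weights z]
      unfolding g_def end_value by linarith
    with True show ?thesis by simp
  next
    case False
    have "\<forall>\<^sub>F n in sequentially. 1 \<le> g n + \<kappa> * (1 \<bullet> z n (Suc n))"
    proof (cases "\<exists>t\<in>{0..T}. R < norm (\<omega> t)")
      case True
      then obtain t where t: "t \<in> {0..T}" "R < norm (\<omega> t)" by blast
      have "\<forall>\<^sub>F n in sequentially. R < norm (z n (grid_index T n t))"
        unfolding z_def by (rule order_tendstoD(1)[OF tendsto_norm[OF path_grid_tendsto[OF T sk t(1)]] t(2)])
      then show ?thesis
      proof eventually_elim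
        case (elim n)
        then show ?case
          unfolding g_def using grid_index(3)[OF T t(1), of n]
          by (intro gain_exit[OF R weights z]) blast
      qed
    next
      case False
      with \<open>\<omega> \<notin> tame_paths T \<Omega> R m\<close> \<omega> obtain j where j: "oscillates T (1 / real (Suc j)) (m j) \<omega>"
        by (auto simp: tame_paths_def not_less)
      have "1 / real (Suc j) = 2 * \<delta> j" by (simp add: \<delta> del: of_nat_Suc)
      with j have "oscillates T (2 * \<delta> j) (m j) \<omega>" by simp
      from oscillates_grid[OF T sk _ this]
      have "\<forall>\<^sub>F n in sequentially. real (m j) * (\<delta> j)\<^sup>2 \<le> energy (\<delta> j) (z n) (Suc n)"
        unfolding z_def by (simp add: \<delta>)
      then show ?thesis
        using eventually_gt_at_top[of j]
      proof eventually_elim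
        case (elim n)
        have "1 \<le> w j * energy (\<delta> j) (z n) (Suc n)"
          using m[of j] mult_left_mono[OF elim(1) weights(1)[of j]] by (rule order_trans)
        then show ?case
          unfolding g_def by (intro gain_energy[OF R weights z elim(2)])
      qed
    qed
    then show ?thesis
      using False \<omega> by (simp add: end_value diff_le_eq)
  qed
  then show ?thesis
    unfolding liminf_integral_def integral by (intro Liminf_bounded) simp
qed

text \<open>
The weights are such that the exit costs \<open>1 / R\<close> and all oscillation levels together at most
\<open>2 / R\<close>.
\<close>

lemma oscillation_weights:
  fixes R :: real
  assumes R: "0 < R"
  shows "1 / R + (\<Sum>j<n. 2 * R * (1 / (2 * R\<^sup>2 * 2 ^ j))) \<le> 3 / R"
proof -
  have "(\<Sum>j<n. 2 * R * (1 / (2 * R\<^sup>2 * 2 ^ j))) = (1 / R) * (\<Sum>j<n. (1 / 2) ^ j)"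
    unfolding sum_distrib_left using R by (intro sum.cong) (auto simp: power2_eq_square power_divide)
  also have "(\<Sum>j<n. (1 / 2 :: real) ^ j) = 2 - 2 * (1 / 2) ^ n"
    by (simp add: geometric_sum)
  also have "(1 / R) * \<dots> \<le> (1 / R) * 2"
    using R by (intro mult_left_mono) auto
  finally show ?thesis by simp
qed

lemma tame_paths_mono:
  assumes "R \<le> R'" "\<And>j. m j \<le> m' j"
  shows "tame_paths T \<Omega> R m \<subseteq> tame_paths T \<Omega> R' m'"
proof
  fix \<omega> assume \<omega>: "\<omega> \<in> tame_paths T \<Omega> R m"
  then have "\<not> oscillates T (1 / real (Suc j)) (m' j) \<omega>" for j
    using oscillates_antimono[of T "1 / real (Suc j)" "m' j" \<omega> "m j", OF _ assms(2)] \<omega>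
    by (auto simp: tame_paths_def simp del: of_nat_Suc)
  moreover have "norm (\<omega> t) \<le> R'" if "t \<in> {0..T}" for t
    using \<omega> that assms(1) by (force simp: tame_paths_def)
  ultimately show "\<omega> \<in> tame_paths T \<Omega> R' m'"
    using \<omega> by (simp add: tame_paths_def)
qed

lemma superhedging_mono:
  assumes "\<And>\<omega>. \<omega> \<in> \<Omega> \<Longrightarrow> \<xi> \<omega> \<le> \<xi>' \<omega>"
  shows "superhedging \<Omega> \<xi> I \<le> superhedging \<Omega> \<xi>' I"
proof -
  have "{c. \<exists>l\<in>I. \<forall>\<omega>\<in>\<Omega>. \<xi>' \<omega> \<le> ereal c + l \<omega>} \<subseteq> {c. \<exists>l\<in>I. \<forall>\<omega>\<in>\<Omega>. \<xi> \<omega> \<le> ereal c + l \<omega>}"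
    using order_trans[OF assms] by fast
  then show ?thesis
    unfolding superhedging_def by (intro Inf_superset_mono image_mono)
qed

text \<open>
The claim \<open>\<kappa> * (1 \<bullet> \<omega> T)\<close> with \<open>\<kappa> = 3 / R\<close> is at most \<open>\<kappa>\<close> times the dimension times
\<open>1 + norm (\<omega> T) powr q\<close>, so it is dominated by a constant and a multiple of \<open>\<xi>\<close>. The bound on
\<open>m j\<close> makes \<open>m j\<close> squared moves of size \<open>\<delta> j\<close>, weighted by \<open>1 / (2 * R\<^sup>2 * 2 ^ j)\<close>, worth at least
\<open>1\<close>.
\<close>

lemma superhedging_tame_paths_le:
  fixes \<Omega> :: "'d::finite path set" and R :: real
  assumes T: "0 < T" and \<Omega>: "S_closed T \<Omega>" and q: "1 \<le> q" and G: "fun_convex_cone G"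
    and \<xi>: "\<xi> \<in> G" "\<And>\<omega>. \<omega> \<in> \<Omega> \<Longrightarrow> norm (\<omega> T) powr q \<le> c + \<xi> \<omega>"
    and R: "0 < R" and m: "\<And>j. 8 * R\<^sup>2 * (real (Suc j))\<^sup>2 * 2 ^ j \<le> real (m j)"
  shows "superhedging \<Omega> (indicator (\<Omega> - tame_paths T \<Omega> R m)) (attainable T \<Omega> q G)
    \<le> ereal (3 / R * real CARD('d) * (1 + c))"
proof -
  define w where "w j = 1 / (2 * R\<^sup>2 * 2 ^ j)" for j :: nat
  define \<delta> where "\<delta> j = 1 / (2 * real (Suc j))" for j
  define \<kappa> where "\<kappa> = 3 / R"
  let ?H = "\<lambda>n. grid_integrand T R \<kappa> w \<delta> n" and ?a = "\<kappa> * real CARD('d)"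
  have w: "0 \<le> w j" for j using R by (simp add: w_def)
  have \<kappa>: "1 / R + (\<Sum>j<n. 2 * R * w j) \<le> \<kappa>" for n
    unfolding w_def \<kappa>_def by (rule oscillation_weights[OF R])
  have a: "0 \<le> ?a" using R by (simp add: \<kappa>_def)
  have m': "1 \<le> w j * (real (m j) * (\<delta> j)\<^sup>2)" for j
  proof -
    have "1 = w j * ((8 * R\<^sup>2 * (real (Suc j))\<^sup>2 * 2 ^ j) * (\<delta> j)\<^sup>2)"
      using R unfolding w_def \<delta>_def power_divide power_mult_distrib by (simp add: field_simps del: of_nat_Suc)
    also have "\<dots> \<le> w j * (real (m j) * (\<delta> j)\<^sup>2)"
      by (intro mult_left_mono mult_right_mono m w) simp
    finally show ?thesis .
  qed
  have "(\<lambda>\<omega>. ?a * \<xi> \<omega> + 0 * \<xi> \<omega>) \<in> G"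
    using G \<xi>(1) a unfolding fun_convex_cone_def by blast
  then have \<gamma>: "(\<lambda>\<omega>. ?a * \<xi> \<omega>) \<in> G" by simp
  have adm: "?H \<in> admissible T \<Omega> q"
    by (rule grid_integrands_admissible[OF T \<Omega> q R w \<kappa>])
  have "indicator (\<Omega> - tame_paths T \<Omega> R m) \<omega> \<le> ereal (?a * (1 + c)) + (ereal (?a * \<xi> \<omega>) + liminf_integral ?H T \<omega>)"
    if \<omega>: "\<omega> \<in> \<Omega>" for \<omega>
  proof -
    let ?i = "indicator (\<Omega> - tame_paths T \<Omega> R m) \<omega> :: real"
    have "0 \<le> \<omega> T $ i" for i
      using S_closed_skorokhod[OF \<Omega> \<omega>] T by (simp add: skorokhod_space_def)
    then have "1 \<bullet> \<omega> T \<le> real CARD('d) * norm (\<omega> T)"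
      by (rule norm_le_inner_one)
    also have "\<dots> \<le> real CARD('d) * (1 + c + \<xi> \<omega>)"
    proof (rule mult_left_mono)
      have "norm (\<omega> T) \<le> 1 + norm (\<omega> T) powr q"
      proof (cases "norm (\<omega> T) \<le> 1")
        case False
        then have "norm (\<omega> T) powr 1 \<le> norm (\<omega> T) powr q" using q by (intro powr_mono) auto
        then show ?thesis using False by simp
      qed (simp add: add_increasing2)
      then show "norm (\<omega> T) \<le> 1 + c + \<xi> \<omega>" using \<xi>(2)[OF \<omega>] by simp
    qed simp
    finally have "\<kappa> * (1 \<bullet> \<omega> T) \<le> \<kappa> * (real CARD('d) * (1 + c + \<xi> \<omega>))"
      using R by (intro mult_left_mono) (auto simp: \<kappa>_def)
    then have "?i \<le> ?a * (1 + c) + (?a * \<xi> \<omega> + (?i - \<kappa> * (1 \<bullet> \<omega> T)))"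
      by (simp add: algebra_simps)
    then have "ereal ?i \<le> ereal (?a * (1 + c)) + (ereal (?a * \<xi> \<omega>) + ereal (?i - \<kappa> * (1 \<bullet> \<omega> T)))"
      by simp
    then have "ereal ?i \<le> ereal (?a * (1 + c)) + (ereal (?a * \<xi> \<omega>) + liminf_integral ?H T \<omega>)"
    proof (rule order_trans)
      show "ereal (?a * (1 + c)) + (ereal (?a * \<xi> \<omega>) + ereal (?i - \<kappa> * (1 \<bullet> \<omega> T)))
          \<le> ereal (?a * (1 + c)) + (ereal (?a * \<xi> \<omega>) + liminf_integral ?H T \<omega>)"
        by (intro add_left_mono liminf_grid_integral_ge[OF T \<Omega> R w \<kappa> \<delta>_def m' \<omega>])
    qed
    moreover have "ereal ?i = indicator (\<Omega> - tame_paths T \<Omega> R m) \<omega>"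
      by (simp add: indicator_def one_ereal_def zero_ereal_def)
    ultimately show ?thesis by (simp only:)
  qed
  then have "?a * (1 + c) \<in> {c. \<exists>l\<in>attainable T \<Omega> q G. \<forall>\<omega>\<in>\<Omega>. indicator (\<Omega> - tame_paths T \<Omega> R m) \<omega> \<le> ereal c + l \<omega>}"
    using \<gamma> adm unfolding attainable_def
    by (intro CollectI bexI[of _ "\<lambda>\<omega>. ereal (?a * \<xi> \<omega>) + liminf_integral ?H T \<omega>"] ballI
        exI[of _ "\<lambda>\<omega>. ?a * \<xi> \<omega>"] exI[of _ ?H] conjI refl)
  then show ?thesis
    unfolding superhedging_def \<kappa>_def by (intro Inf_lower imageI)
qed

theorem theorem6p4:
  fixes T p q :: real
    and \<Omega> :: "'d::finite path set"
    and G :: "('d path \<Rightarrow> real) set"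
  assumes "0 < T"
    and "\<Omega> \<noteq> {}" and "S_closed T \<Omega>"
    and "1 \<le> p" and "p < q"
    and "G \<subseteq> cont_growth2 T \<Omega> q p" and "fun_convex_cone G"
    and "\<exists>c\<ge>0. \<exists>\<xi>\<in>G. \<forall>\<omega>\<in>\<Omega>. norm (\<omega> T) powr q \<le> c + \<xi> \<omega>"
  shows "\<exists>K :: nat \<Rightarrow> 'd path set.
    incseq K \<and> (\<forall>n. compactin (S_star_topology T \<Omega>) (K n)) \<and>
    (\<exists>L :: ereal. (\<lambda>n. superhedging \<Omega> (indicator (\<Omega> - K n)) (attainable T \<Omega> q G)) \<longlonglongrightarrow> L \<and> L \<le> 0)"
proof -
  obtain c \<xi> where c: "0 \<le> c" and \<xi>: "\<xi> \<in> G" "\<And>\<omega>. \<omega> \<in> \<Omega> \<Longrightarrow> norm (\<omega> T) powr q \<le> c + \<xi> \<omega>"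
    using assms(8) by blast
  define m where "m n j = 8 * (Suc n)\<^sup>2 * (Suc j)\<^sup>2 * 2 ^ j" for n j :: nat
  define K where "K n = tame_paths T \<Omega> (real (Suc n)) (m n)" for n
  define \<Phi> where "\<Phi> n = superhedging \<Omega> (indicator (\<Omega> - K n)) (attainable T \<Omega> q G)" for n
  have K_mono: "incseq K"
  proof (rule incseq_SucI)
    fix n
    show "K n \<subseteq> K (Suc n)"
      unfolding K_def m_def by (intro tame_paths_mono mult_right_mono mult_left_mono power_mono) auto
  qed
  have compact: "compactin (S_star_topology T \<Omega>) (K n)" for n
    unfolding K_def by (rule compactin_tame_paths[OF assms(1,3)])
  have "decseq \<Phi>"
  proof (rule decseq_SucI)
    fix n
    show "\<Phi> (Suc n) \<le> \<Phi> n"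
      unfolding \<Phi>_def using incseq_SucD[OF K_mono, of n]
      by (intro superhedging_mono) (auto simp: indicator_def)
  qed
  then have lim: "\<Phi> \<longlonglongrightarrow> (INF n. \<Phi> n)"
    by (rule LIMSEQ_INF)
  have bound: "\<Phi> n \<le> ereal (3 / real (Suc n) * real CARD('d) * (1 + c))" for n
    unfolding \<Phi>_def K_def using assms(4,5)
    by (intro superhedging_tame_paths_le[OF assms(1,3) _ assms(7) \<xi>]) (auto simp: m_def)
  have "(\<lambda>n. 3 * real CARD('d) * (1 + c) * (1 / real (Suc n))) \<longlonglongrightarrow> 3 * real CARD('d) * (1 + c) * 0"
    by (intro tendsto_mult tendsto_const LIMSEQ_Suc[OF lim_1_over_n])
  then have "(\<lambda>n. ereal (3 / real (Suc n) * real CARD('d) * (1 + c))) \<longlonglongrightarrow> ereal 0"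
    by (intro tendsto_ereal) (simp add: field_simps)
  from LIMSEQ_le[OF lim this] bound have "(INF n. \<Phi> n) \<le> 0"
    by (simp add: zero_ereal_def)
  with K_mono compact lim show ?thesis
    unfolding \<Phi>_def by blast
qed

end
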